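(* Let $k$ be a positive integer, let $G$ be a graph (multiple edges and loops allowed) and let $T \subseteq V(G)$. If every edge-cut in $G$ separating $T$ has size at least $6k+6$, then $G$ contains $k$ pairwise edge-disjoint $T$-connectors.
   Context: An edge-cut of $G$ is a set of edges of the form $\delta(X)$ (all edges with exactly one end in $X$) for some $\emptyset \neq X \subsetneq V(G)$. An edge-cut $C$ separates $T$ if at least two components of $G \setminus C$ contain vertices of $T$. For two edges $e=uv$ and $e'=uv'$ sharing the end $u$, splitting $e$ and $e'$ from $u$ means deleting $e$ and $e'$ and adding a new edge $vv'$. A $T$-connector is a subgraph of $G$ which can be turned, by repeatedly splitting pairs of edges, into a connected graph with vertex set $T$ (vertices outside $T$ that become isolated being discarded). *)

theory Defs
  imports Main
begin

text \<open>
  Undirected multigraphs with labelled edges. The ends of an edge form an unordered pair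
  \<open>{u, v}\<close>; a loop at \<open>u\<close> has the singleton \<open>{u} = {u, u}\<close>. The value of \<open>ends\<close> outside
  \<open>edges\<close> is irrelevant.
\<close>

record ('v, 'e) multigraph =
  vertices :: "'v set"
  edges :: "'e set"
  ends :: "'e \<Rightarrow> 'v set"

definition wf_multigraph :: "('v, 'e) multigraph \<Rightarrow> bool" where
  "wf_multigraph G \<longleftrightarrow>
     (\<forall>e \<in> edges G. \<exists>u \<in> vertices G. \<exists>v \<in> vertices G. ends G e = {u, v})"

definition finite_multigraph :: "('v, 'e) multigraph \<Rightarrow> bool" where
  "finite_multigraph G \<longleftrightarrow> wf_multigraph G \<and> finite (vertices G) \<and> finite (edges G)"

definition subgraph :: "('v, 'e) multigraph \<Rightarrow> ('v, 'e) multigraph \<Rightarrow> bool" where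
  "subgraph H G \<longleftrightarrow>
     wf_multigraph H \<and> vertices H \<subseteq> vertices G \<and> edges H \<subseteq> edges G \<and>
     (\<forall>e \<in> edges H. ends H e = ends G e)"

definition adjacent :: "('v, 'e) multigraph \<Rightarrow> 'v \<Rightarrow> 'v \<Rightarrow> bool" where
  "adjacent G u v \<longleftrightarrow> (\<exists>e \<in> edges G. ends G e = {u, v})"

text \<open>The graph without vertices counts as connected; this matters only for \<open>T = {}\<close>.\<close>

definition connected_graph :: "('v, 'e) multigraph \<Rightarrow> bool" where
  "connected_graph G \<longleftrightarrow> (\<forall>u \<in> vertices G. \<forall>v \<in> vertices G. (adjacent G)\<^sup>*\<^sup>* u v)"

text \<open>Components are represented by their vertex sets.\<close>

definition components :: "('v, 'e) multigraph \<Rightarrow> 'v set set" where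
  "components G = {{v \<in> vertices G. (adjacent G)\<^sup>*\<^sup>* u v} | u. u \<in> vertices G}"

definition delete_edges :: "('v, 'e) multigraph \<Rightarrow> 'e set \<Rightarrow> ('v, 'e) multigraph" where
  "delete_edges G C = G\<lparr>edges := edges G - C\<rparr>"

definition boundary :: "('v, 'e) multigraph \<Rightarrow> 'v set \<Rightarrow> 'e set" where
  "boundary G X = {e \<in> edges G. \<exists>u v. ends G e = {u, v} \<and> u \<in> X \<and> v \<notin> X}"

definition edge_cut :: "('v, 'e) multigraph \<Rightarrow> 'e set \<Rightarrow> bool" where
  "edge_cut G C \<longleftrightarrow> (\<exists>X. X \<noteq> {} \<and> X \<subset> vertices G \<and> C = boundary G X)"

definition separates :: "('v, 'e) multigraph \<Rightarrow> 'e set \<Rightarrow> 'v set \<Rightarrow> bool" where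
  "separates G C T \<longleftrightarrow>
     (\<exists>K \<in> components (delete_edges G C). \<exists>L \<in> components (delete_edges G C).
        K \<noteq> L \<and> K \<inter> T \<noteq> {} \<and> L \<inter> T \<noteq> {})"

text \<open>
  The label \<open>f\<close> of the new edge is arbitrary, apart from not naming a remaining edge. It may
  be one of the labels just freed, so a label is available even if \<open>'e\<close> is finite.
\<close>

definition split_step :: "('v, 'e) multigraph \<Rightarrow> ('v, 'e) multigraph \<Rightarrow> bool" where
  "split_step G H \<longleftrightarrow>
     (\<exists>u v v' e e' f.
        e \<in> edges G \<and> e' \<in> edges G \<and> e \<noteq> e' \<and>
        ends G e = {u, v} \<and> ends G e' = {u, v'} \<and>
        f \<notin> edges G - {e, e'} \<and>
        H = \<lparr>vertices = vertices G,
             edges = insert f (edges G - {e, e'}),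
             ends = (ends G)(f := {v, v'})\<rparr>)"

definition isolated :: "('v, 'e) multigraph \<Rightarrow> 'v \<Rightarrow> bool" where
  "isolated G v \<longleftrightarrow> (\<forall>e \<in> edges G. v \<notin> ends G e)"

definition discard_isolated :: "'v set \<Rightarrow> ('v, 'e) multigraph \<Rightarrow> ('v, 'e) multigraph" where
  "discard_isolated T G = G\<lparr>vertices := {v \<in> vertices G. v \<in> T \<or> \<not> isolated G v}\<rparr>"

definition T_connector :: "('v, 'e) multigraph \<Rightarrow> 'v set \<Rightarrow> ('v, 'e) multigraph \<Rightarrow> bool" where
  "T_connector G T H \<longleftrightarrow>
     subgraph H G \<and>
     (\<exists>H'. split_step\<^sup>*\<^sup>* H H' \<and>
           vertices (discard_isolated T H') = T \<and>
           connected_graph (discard_isolated T H'))"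

end

theory Submission
  imports Defs
begin

text \<open>
  Every edge is given a colour in \<open>0..k\<close> (\<open>0\<close> meaning unused) and the coloured half-edges at each
  nonterminal are paired within their colour, so that each colour class decomposes into trails that
  may be split off. The stronger statement proved by induction fixes a terminal \<open>v\<close> of degree exactly
  \<open>6k + 6\<close> whose edges are coloured in advance: if enough edges of some set of good edges at \<open>v\<close> are
  left unused, the colouring extends so that each colour connects \<open>T - {v}\<close> without passing through
  \<open>v\<close> and reaches every precoloured edge, while prescribed numbers of good edges at the other tight
  terminals stay unused. This interface is what makes the statement survive cutting the graph along a
  tight set \<open>X\<close>: the side \<open>X\<close>, solved with the other side contracted to \<open>v\<close>, determines the good edges
  demanded at the contracted vertex of the other side.

  If all tight sets are trivial, every edge off the tight terminals can be deleted, and a Mader-type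
  uncrossing argument detaches a pair of edges at each nonterminal of degree at least four. The graphs
  that remain are hypergraphs on \<open>T\<close> whose edges have two or three vertices. There the triples are
  trimmed to pairs without spoiling a partition-connectivity bound with slack, and matroid union of
  \<open>k\<close> graphic matroids together with one uniform matroid per demand yields the trees.
\<close>

section \<open>Matroid union\<close>

text \<open>The condition on the root colours must be fixed before they are known: the side of a
  tight cut that contains the root is coloured first, and the other side has to accept what comes
  across. What can block an extension is a bipartition of the terminals other than \<open>v\<close>
  that is crossed by fewer than \<open>k\<close> links avoiding \<open>v\<close>. Adding the cut
  bounds for both of its sides yields \<open>2 * rv + b \<le> 2 * k\<close>, with \<open>b\<close>
  the number of root edges outside \<open>gv\<close>, and this is the form in which demands are
  imposed on tight terminals. Demands compete with the trees for links, and a link may count for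
  demands at both of its ends; hence the decisive inequality is doubled. After \<open>2 * k\<close>
  for demand and bad edges and one for the imbalance of the routes, a terminal of degree
  \<open>6 * k + 6\<close> keeps \<open>4 * k + 5\<close> edges, while the trees need
  \<open>2 * k\<close> per class to be merged.\<close>

lemma union_rank_closure:
  fixes r :: "'a set \<Rightarrow> nat"
  assumes "finite P" and sub: "\<And>A B. r (A \<union> B) + r (A \<inter> B) \<le> r A + r B"
    and mono: "\<And>A B. A \<subseteq> B \<Longrightarrow> r A \<le> r B"
    and "\<And>e. e \<in> P \<Longrightarrow> r (insert e A) = r A"
  shows "r (A \<union> P) = r A"
  using assms(1,4)
proof (induction P rule: finite_induct)
  case (insert x F)
  have "r ((A \<union> F) \<union> insert x A) + r ((A \<union> F) \<inter> insert x A) \<le> r (A \<union> F) + r (insert x A)"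
    by (rule sub)
  moreover have "r A \<le> r ((A \<union> F) \<inter> insert x A)" by (rule mono) auto
  moreover have "(A \<union> F) \<union> insert x A = A \<union> insert x F" by auto
  moreover have "r A \<le> r (A \<union> insert x F)" by (rule mono) auto
  ultimately show ?case using insert by auto
qed simp

text \<open>The \<open>F j\<close> are partial choices, so that the statement serves as its own
  induction hypothesis. Each step moves one element \<open>e\<close> of \<open>P\<close> into one
  \<open>F j\<close>. This lowers \<open>card (P - A)\<close> by one, which is harmless where the
  condition has slack; so \<open>e\<close> must raise the rank over every tight set avoiding
  it.\<close>

theorem disjoint_bases:
  fixes r :: "'j \<Rightarrow> 'a set \<Rightarrow> nat"
  assumes J: "finite J" and "finite P"
    and sub: "\<And>j A B. j \<in> J \<Longrightarrow> r j (A \<union> B) + r j (A \<inter> B) \<le> r j A + r j B"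
    and mono: "\<And>j A B. j \<in> J \<Longrightarrow> A \<subseteq> B \<Longrightarrow> r j A \<le> r j B"
    and bound: "\<And>j A. j \<in> J \<Longrightarrow> r j A \<le> \<rho> j"
    and cond: "\<And>A. A \<subseteq> P \<Longrightarrow> (\<Sum>j\<in>J. \<rho> j) \<le> card (P - A) + (\<Sum>j\<in>J. r j (A \<union> F j))"
  shows "\<exists>F'. (\<forall>j\<in>J. F j \<subseteq> F' j \<and> F' j \<subseteq> F j \<union> P \<and> r j (F' j) = \<rho> j) \<and>
              (\<forall>i\<in>J. \<forall>j\<in>J. i \<noteq> j \<longrightarrow> (F' i - F i) \<inter> (F' j - F j) = {})"
  using assms(2) cond
proof (induction "card P" arbitrary: P F rule: less_induct)
  case less
  note fin = less.prems(1) and cond = less.prems(2)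
  show ?case
  proof (cases "\<forall>j\<in>J. r j (F j) = \<rho> j")
    case True
    then show ?thesis by (intro exI[of _ F]) auto
  next
    case False
    \<comment> \<open>A tight set has no slack in the condition; a nontrivial one leaves some index
      unspanned. Tight sets are closed under union, so with \<open>A\<close> a maximal nontrivial
      one, any tight set not inside \<open>A\<close> has with it a trivial union, which is all of
      \<open>P\<close>. If there is none, the empty set takes the place of \<open>A\<close>.\<close>
    define tight where
      "tight B \<longleftrightarrow> B \<subseteq> P \<and> card (P - B) + (\<Sum>j\<in>J. r j (B \<union> F j)) = (\<Sum>j\<in>J. \<rho> j)" for B
    define nontriv where "nontriv B \<longleftrightarrow> (\<exists>j\<in>J. r j (B \<union> F j) < \<rho> j)" for B
    have triv_full: "B = P" if "tight B" "\<not> nontriv B" for B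
    proof -
      have "(\<Sum>j\<in>J. r j (B \<union> F j)) = (\<Sum>j\<in>J. \<rho> j)"
        using that(2) bound unfolding nontriv_def not_less bex_simps by (intro sum.cong refl) (metis le_antisym not_less)
      then have "card (P - B) = 0" using that(1) unfolding tight_def by simp
      then show ?thesis using that(1) fin unfolding tight_def by auto
    qed
    have tight_un: "tight (A \<union> B)" if "tight A" "tight B" for A B
    proof -
      have "(\<Sum>j\<in>J. r j (A \<union> B \<union> F j)) + (\<Sum>j\<in>J. r j ((A \<inter> B) \<union> F j)) \<le>
            (\<Sum>j\<in>J. r j (A \<union> F j)) + (\<Sum>j\<in>J. r j (B \<union> F j))"
        unfolding sum.distrib[symmetric]
      proof (rule sum_mono)
        fix j assume "j \<in> J"
        have "(A \<union> F j) \<union> (B \<union> F j) = A \<union> B \<union> F j" "(A \<union> F j) \<inter> (B \<union> F j) = (A \<inter> B) \<union> F j" by auto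
        then show "r j (A \<union> B \<union> F j) + r j ((A \<inter> B) \<union> F j) \<le> r j (A \<union> F j) + r j (B \<union> F j)"
          using sub[OF \<open>j \<in> J\<close>, of "A \<union> F j" "B \<union> F j"] by simp
      qed
      moreover have "card (P - A) + card (P - B) = card (P - (A \<union> B)) + card (P - (A \<inter> B))"
        using card_Un_Int[of "P - A" "P - B"] fin by (simp add: Diff_Un Diff_Int Int_commute)
      moreover have "(\<Sum>j\<in>J. \<rho> j) \<le> card (P - (A \<union> B)) + (\<Sum>j\<in>J. r j (A \<union> B \<union> F j))"
        "(\<Sum>j\<in>J. \<rho> j) \<le> card (P - (A \<inter> B)) + (\<Sum>j\<in>J. r j ((A \<inter> B) \<union> F j))"
        using that cond[of "A \<union> B"] cond[of "A \<inter> B"] unfolding tight_def by auto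
      ultimately show ?thesis using that unfolding tight_def by auto
    qed
    obtain A j where A: "A \<subseteq> P" "j \<in> J" "r j (A \<union> F j) < \<rho> j"
      and dich: "\<And>B. tight B \<Longrightarrow> B \<subseteq> A \<or> A \<union> B = P"
    proof (cases "\<exists>B. tight B \<and> nontriv B")
      case True
      have "finite {B. tight B \<and> nontriv B}"
        by (rule finite_subset[of _ "Pow P"]) (use fin in \<open>auto simp: tight_def\<close>)
      then obtain A where A: "tight A" "nontriv A"
        and mx: "\<And>B. tight B \<Longrightarrow> nontriv B \<Longrightarrow> A \<subseteq> B \<Longrightarrow> A = B"
        using finite_has_maximal[of "{B. tight B \<and> nontriv B}"] True by blast
      obtain j where "j \<in> J" "r j (A \<union> F j) < \<rho> j" using A unfolding nontriv_def by blast
      moreover have "B \<subseteq> A \<or> A \<union> B = P" if "tight B" for B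
        using tight_un[OF A(1) that] mx[of "A \<union> B"] triv_full[of "A \<union> B"] by blast
      ultimately show thesis using A that unfolding tight_def by blast
    next
      case none: False
      obtain j where "j \<in> J" "r j (F j) < \<rho> j"
        using False bound by (metis le_neq_implies_less)
      moreover have "B \<subseteq> {} \<or> {} \<union> B = P" if "tight B" for B
        using none triv_full[OF that] that by auto
      ultimately show thesis using that[of "{}" j] by simp
    qed
    have fullP: "r j (P \<union> F j) = \<rho> j"
    proof (rule ccontr)
      assume "r j (P \<union> F j) \<noteq> \<rho> j"
      then have "r j (P \<union> F j) < \<rho> j" using bound[OF A(2)] le_neq_implies_less by blast
      then have "(\<Sum>j\<in>J. r j (P \<union> F j)) < (\<Sum>j\<in>J. \<rho> j)"
        using J A(2) bound by (intro sum_strict_mono_ex1) auto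
      then show False using cond[of P] by simp
    qed
    obtain e where e: "e \<in> P" "r j (insert e (A \<union> F j)) \<noteq> r j (A \<union> F j)"
    proof (rule ccontr)
      assume "\<not> thesis"
      then have "\<And>e. e \<in> P \<Longrightarrow> r j (insert e (A \<union> F j)) = r j (A \<union> F j)" using that by blast
      then have "r j ((A \<union> F j) \<union> P) = r j (A \<union> F j)"
        using union_rank_closure[OF fin, of "r j"] sub[OF A(2)] mono[OF A(2)] by blast
      moreover have "r j (P \<union> F j) \<le> r j ((A \<union> F j) \<union> P)" by (rule mono[OF A(2)]) auto
      ultimately show False using A(3) fullP by simp
    qed
    then have eA: "e \<notin> A" "e \<notin> F j" by (metis UnCI insert_absorb)+
    define F1 where "F1 = F(j := insert e (F j))"
    have "\<exists>F'. (\<forall>l\<in>J. F1 l \<subseteq> F' l \<and> F' l \<subseteq> F1 l \<union> (P - {e}) \<and> r l (F' l) = \<rho> l) \<and>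
              (\<forall>i\<in>J. \<forall>l\<in>J. i \<noteq> l \<longrightarrow> (F' i - F1 i) \<inter> (F' l - F1 l) = {})"
    proof (rule less.hyps)
      show "card (P - {e}) < card P" using e(1) fin by (rule card_Diff1_less[rotated])
      show "finite (P - {e})" using fin by simp
      fix B assume B: "B \<subseteq> P - {e}"
      have cP: "card (P - B) = Suc (card (P - {e} - B))"
        using card_Suc_Diff1[of "P - B" e] fin e(1) B
        by (metis Diff_iff Diff_insert Diff_insert2 finite_Diff insertI1 subset_Diff_insert)
      have jsum: "(\<Sum>l\<in>J. r l (B \<union> F1 l)) = (\<Sum>l\<in>J - {j}. r l (B \<union> F l)) + r j (insert e (B \<union> F j))"
        using J A(2) unfolding F1_def by (subst sum.remove[of _ j]) auto
      have jsum0: "(\<Sum>l\<in>J. r l (B \<union> F l)) = (\<Sum>l\<in>J - {j}. r l (B \<union> F l)) + r j (B \<union> F j)"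
        using J A(2) by (subst sum.remove[of _ j]) auto
      have le: "r j (B \<union> F j) \<le> r j (insert e (B \<union> F j))" by (rule mono[OF A(2)]) auto
      show "(\<Sum>l\<in>J. \<rho> l) \<le> card (P - {e} - B) + (\<Sum>l\<in>J. r l (B \<union> F1 l))"
      proof (cases "tight B")
        case False
        have "(\<Sum>l\<in>J. \<rho> l) < card (P - B) + (\<Sum>l\<in>J. r l (B \<union> F l))"
          using cond[of B] B False unfolding tight_def by fastforce
        then show ?thesis using cP jsum jsum0 le by linarith
      next
        case True
        \<comment> \<open>\<open>e\<close> lies in neither set, which rules out the second
          alternative of \<open>dich\<close>. Submodularity then carries the rank increase caused by
          \<open>e\<close> over \<open>A\<close> down to its subset \<open>B\<close>.\<close>
        have "A \<union> B \<noteq> P" using eA e(1) B by auto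
        then have "B \<subseteq> A" using dich[OF True] by blast
        have "r j ((A \<union> F j) \<union> insert e (B \<union> F j)) + r j ((A \<union> F j) \<inter> insert e (B \<union> F j))
           \<le> r j (A \<union> F j) + r j (insert e (B \<union> F j))" by (rule sub[OF A(2)])
        moreover have "(A \<union> F j) \<union> insert e (B \<union> F j) = insert e (A \<union> F j)" using \<open>B \<subseteq> A\<close> by auto
        moreover have "(A \<union> F j) \<inter> insert e (B \<union> F j) = B \<union> F j" using \<open>B \<subseteq> A\<close> eA by auto
        moreover have "r j (A \<union> F j) \<le> r j (insert e (A \<union> F j))" by (rule mono[OF A(2)]) auto
        ultimately have "r j (B \<union> F j) < r j (insert e (B \<union> F j))" using e(2) by simp
        then show ?thesis using True cP jsum jsum0 unfolding tight_def by linarith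
      qed
    qed
    then obtain F' where F': "\<forall>l\<in>J. F1 l \<subseteq> F' l \<and> F' l \<subseteq> F1 l \<union> (P - {e}) \<and> r l (F' l) = \<rho> l"
      "\<forall>i\<in>J. \<forall>l\<in>J. i \<noteq> l \<longrightarrow> (F' i - F1 i) \<inter> (F' l - F1 l) = {}" by blast
    show ?thesis
    proof (intro exI[of _ F'] conjI ballI impI)
      fix l assume "l \<in> J"
      then show "F l \<subseteq> F' l" "F' l \<subseteq> F l \<union> P" "r l (F' l) = \<rho> l"
        using F'(1) e(1) unfolding F1_def by (auto split: if_splits)
    next
      fix i l assume il: "i \<in> J" "l \<in> J" "i \<noteq> l"
      have sub1: "F' i - F i \<subseteq> insert e (F' i - F1 i)" for i
        unfolding F1_def by auto
      have ne: "F' i - F i = F' i - F1 i" if "i \<noteq> j" for i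
        using that unfolding F1_def by simp
      have en: "e \<notin> F' i - F1 i" if "i \<in> J" for i
        using bspec[OF F'(1) that] by auto
      have disj: "(F' i - F1 i) \<inter> (F' l - F1 l) = {}" using F'(2) il by blast
      show "(F' i - F i) \<inter> (F' l - F l) = {}"
      proof (cases "i = j")
        case True
        then show ?thesis using sub1[of i] ne[of l] en[OF il(2)] il(3) disj by auto
      next
        case False
        then show ?thesis using sub1[of l] ne[of i] en[OF il(1)] il(3) disj by auto
      qed
    qed
  qed
qed

section \<open>Components of relations and trimming of triples\<close>

definition lnk :: "'a rel \<Rightarrow> 'a rel" where
  "lnk R = (R \<union> R\<inverse>)\<^sup>*"

text \<open>For \<open>R\<close> inside \<open>V \<times> V\<close>, the number
  \<open>card V - ncomp V R\<close> is the rank of \<open>R\<close> in the graphic matroid on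
  \<open>V\<close>.\<close>

definition ncomp :: "'a set \<Rightarrow> 'a rel \<Rightarrow> nat" where
  "ncomp V R = card ((\<lambda>x. lnk R `` {x}) ` V)"

definition rel_of :: "('i \<Rightarrow> 'a set) \<Rightarrow> 'i set \<Rightarrow> 'a rel" where
  "rel_of N A = (\<Union>i\<in>A. N i \<times> N i)"

lemma lnk_refl [simp]: "(x, x) \<in> lnk R"
  unfolding lnk_def by simp

lemma lnk_sym: "(x, y) \<in> lnk R \<Longrightarrow> (y, x) \<in> lnk R"
  unfolding lnk_def by (metis converse_Un converse_converse rtrancl_converseD sup_commute)

lemma lnk_trans: "(x, y) \<in> lnk R \<Longrightarrow> (y, z) \<in> lnk R \<Longrightarrow> (x, z) \<in> lnk R"
  unfolding lnk_def by (rule rtrancl_trans)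

lemma lnk_mono: "R \<subseteq> S \<Longrightarrow> lnk R \<subseteq> lnk S"
  unfolding lnk_def by (intro rtrancl_mono) auto

lemma lnk_base: "(x, y) \<in> R \<Longrightarrow> (x, y) \<in> lnk R"
  unfolding lnk_def by auto

lemma lnk_least:
  assumes "R \<subseteq> M" "\<And>x. (x, x) \<in> M" "\<And>x y. (x, y) \<in> M \<Longrightarrow> (y, x) \<in> M"
    "\<And>x y z. (x, y) \<in> M \<Longrightarrow> (y, z) \<in> M \<Longrightarrow> (x, z) \<in> M"
  shows "lnk R \<subseteq> M"
proof
  fix p assume "p \<in> lnk R"
  then have "(fst p, snd p) \<in> (R \<union> R\<inverse>)\<^sup>*" unfolding lnk_def by simp
  then have "(fst p, snd p) \<in> M"
    by (induction rule: rtrancl_induct) (use assms in blast)+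
  then show "p \<in> M" by simp
qed

lemma lnk_lnk_subset: "R \<subseteq> lnk S \<Longrightarrow> lnk R \<subseteq> lnk S"
  by (rule lnk_least) (auto intro: lnk_sym lnk_trans)

lemma lnk_class_eq: "lnk R `` {x} = lnk R `` {y} \<longleftrightarrow> (x, y) \<in> lnk R"
proof
  assume "lnk R `` {x} = lnk R `` {y}"
  then have "y \<in> lnk R `` {x}" by simp
  then show "(x, y) \<in> lnk R" by simp
next
  assume "(x, y) \<in> lnk R"
  then show "lnk R `` {x} = lnk R `` {y}" using lnk_sym[of x y R] lnk_trans[of x y R] lnk_trans[of y x R] by auto
qed

lemma lnk_insert:
  "lnk (insert (a, b) R) = lnk R \<union> {(x, y). x \<in> lnk R `` {a, b} \<and> y \<in> lnk R `` {a, b}}" (is "_ = ?M")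
proof
  have C: "y \<in> lnk R `` {a, b}" if "x \<in> lnk R `` {a, b}" "(x, y) \<in> lnk R" for x y
    using that by (auto intro: lnk_trans)
  show "lnk (insert (a, b) R) \<subseteq> ?M"
  proof (rule lnk_least)
    have "a \<in> lnk R `` {a, b}" "b \<in> lnk R `` {a, b}" by (auto simp: Image_iff)
    then show "insert (a, b) R \<subseteq> ?M" by (auto intro: lnk_base)
    show "(x, x) \<in> ?M" for x by simp
    show "(y, x) \<in> ?M" if "(x, y) \<in> ?M" for x y using that lnk_sym[of x y R] by auto
    show "(x, z) \<in> ?M" if "(x, y) \<in> ?M" "(y, z) \<in> ?M" for x y z
    proof (cases "(x, y) \<in> lnk R")
      case True
      then show ?thesis using that C[of y x] lnk_sym[of x y R] lnk_trans[of x y R z] by auto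
    next
      case False
      then show ?thesis using that C[of y z] by auto
    qed
  qed
  have mono: "lnk R \<subseteq> lnk (insert (a, b) R)" by (rule lnk_mono) auto
  have ab: "(a, b) \<in> lnk (insert (a, b) R)" by (rule lnk_base) simp
  have "(x, a) \<in> lnk (insert (a, b) R)" if "x \<in> lnk R `` {a, b}" for x
  proof -
    have "(a, x) \<in> lnk R \<or> (b, x) \<in> lnk R" using that by auto
    then show ?thesis using mono ab lnk_sym lnk_trans by (metis subsetD)
  qed
  then show "?M \<subseteq> lnk (insert (a, b) R)"
    using mono lnk_sym[of _ a "insert (a, b) R"] lnk_trans[of _ a "insert (a, b) R"] by blast
qed

lemma ncomp_insert:
  assumes V: "finite V" "a \<in> V" "b \<in> V"
  shows "ncomp V R = ncomp V (insert (a, b) R) + (if (a, b) \<in> lnk R then 0 else 1)"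
proof (cases "(a, b) \<in> lnk R")
  case True
  then have "lnk (insert (a, b) R) \<subseteq> lnk R"
    by (intro lnk_lnk_subset) (auto intro: lnk_base)
  then have "lnk (insert (a, b) R) = lnk R" using lnk_mono[of R "insert (a, b) R"] by blast
  then show ?thesis using True unfolding ncomp_def by simp
next
  case False
  let ?c = "\<lambda>x. lnk R `` {x}" and ?d = "\<lambda>x. lnk (insert (a, b) R) `` {x}"
  have d: "?d x = (if x \<in> ?c a \<union> ?c b then ?c a \<union> ?c b else ?c x)" for x
  proof -
    have "?c x \<subseteq> ?c a \<union> ?c b" if "x \<in> ?c a \<union> ?c b" using that lnk_trans by fastforce
    then show ?thesis unfolding lnk_insert by auto
  qed
  have ne: "?c a \<noteq> ?c b" using False lnk_class_eq by metis
  have c_eq: "?c x = ?c a \<longleftrightarrow> x \<in> ?c a" "?c x = ?c b \<longleftrightarrow> x \<in> ?c b" for x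
    unfolding lnk_class_eq using lnk_sym[of _ _ R] by auto
  have img: "?d ` V = insert (?c a \<union> ?c b) (?c ` V - {?c a, ?c b})"
  proof (rule set_eqI, rule iffI)
    fix C assume "C \<in> ?d ` V"
    then obtain x where "x \<in> V" "C = ?d x" by blast
    then show "C \<in> insert (?c a \<union> ?c b) (?c ` V - {?c a, ?c b})"
      using c_eq[of x] unfolding d[of x] by (cases "x \<in> ?c a \<union> ?c b") auto
  next
    fix C assume C: "C \<in> insert (?c a \<union> ?c b) (?c ` V - {?c a, ?c b})"
    show "C \<in> ?d ` V"
    proof (cases "C = ?c a \<union> ?c b")
      case True
      then have "C = ?d a" unfolding d[of a] by simp
      then show ?thesis using V by blast
    next
      case False
      then obtain x where x: "x \<in> V" "C = ?c x" "?c x \<noteq> ?c a" "?c x \<noteq> ?c b" using C by auto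
      then have "C = ?d x" using c_eq[of x] unfolding d[of x] by auto
      then show ?thesis using x by blast
    qed
  qed
  have "?c a \<union> ?c b \<notin> ?c ` V - {?c a, ?c b}"
  proof
    assume "?c a \<union> ?c b \<in> ?c ` V - {?c a, ?c b}"
    then obtain x where x: "?c x = ?c a \<union> ?c b" by auto
    have "a \<in> ?c x" "b \<in> ?c x" unfolding x by auto
    then show False using False lnk_sym[of x a R] lnk_trans[of a x R b] by simp
  qed
  then have "card (?d ` V) = Suc (card (?c ` V - {?c a, ?c b}))"
    unfolding img using V by simp
  moreover have "card (?c ` V - {?c a, ?c b}) = card (?c ` V) - 2"
    using V ne by (subst card_Diff_subset) auto
  moreover have "card (?c ` V) \<ge> 2"
    using card_mono[of "?c ` V" "{?c a, ?c b}"] V ne by auto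
  ultimately show ?thesis using False unfolding ncomp_def by simp
qed

text \<open>Diminishing returns: the pairs of \<open>D\<close> are added one at a time, and a pair
  that merges two classes of the larger relation also merges two classes of the smaller one. Taking
  an intersection for \<open>X\<close> gives submodularity of the graphic rank.\<close>

lemma ncomp_diminishing:
  assumes V: "finite V" and D: "finite D" "D \<subseteq> V \<times> V" and "X \<subseteq> R"
  shows "ncomp V R + ncomp V (X \<union> D) \<le> ncomp V X + ncomp V (R \<union> D)"
  using D
proof (induction D rule: finite_induct)
  case (insert p D)
  obtain a b where p: "p = (a, b)" by (cases p)
  have ab: "a \<in> V" "b \<in> V" using insert p by auto
  have "lnk (X \<union> D) \<subseteq> lnk (R \<union> D)" using \<open>X \<subseteq> R\<close> by (intro lnk_mono) auto
  then show ?case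
    using insert ncomp_insert[OF V ab, of "X \<union> D"] ncomp_insert[OF V ab, of "R \<union> D"] unfolding p
    by (auto split: if_splits)
qed simp

lemma ncomp_submodular:
  assumes "finite V" "R \<subseteq> V \<times> V" "S \<subseteq> V \<times> V"
  shows "ncomp V R + ncomp V S \<le> ncomp V (R \<union> S) + ncomp V (R \<inter> S)"
  using ncomp_diminishing[of V S "R \<inter> S" R] assms finite_subset[of S "V \<times> V"]
  by (simp add: Int_absorb2 Un_absorb1)

lemma ncomp_antimono:
  assumes V: "finite V" and "R \<subseteq> S" "S \<subseteq> V \<times> V"
  shows "ncomp V S \<le> ncomp V R"
proof -
  have "finite D \<Longrightarrow> D \<subseteq> V \<times> V \<Longrightarrow> ncomp V (R \<union> D) \<le> ncomp V R" for D
  proof (induction D rule: finite_induct)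
    case (insert p D)
    then show ?case using ncomp_insert[OF V, of "fst p" "snd p" "R \<union> D"]
      by (auto simp: mem_Times_iff split: if_splits)
  qed simp
  then have "ncomp V (R \<union> S) \<le> ncomp V R" using assms finite_subset[of S "V \<times> V"] by simp
  then show ?thesis using \<open>R \<subseteq> S\<close> by (simp add: Un_absorb1)
qed

lemma ncomp_le: "finite V \<Longrightarrow> ncomp V R \<le> card V"
  unfolding ncomp_def by (rule card_image_le)

lemma ncomp_pos: "finite V \<Longrightarrow> V \<noteq> {} \<Longrightarrow> ncomp V R \<ge> 1"
  unfolding ncomp_def by (simp add: Suc_leI card_gt_0_iff)

lemma ncomp_one_iff:
  assumes "finite V" "ncomp V R \<le> 1" "x \<in> V" "y \<in> V"
  shows "(x, y) \<in> lnk R"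
proof -
  have "card ((\<lambda>x. lnk R `` {x}) ` V) \<le> 1" using assms(2) unfolding ncomp_def .
  then have "C = D" if "C \<in> (\<lambda>x. lnk R `` {x}) ` V" "D \<in> (\<lambda>x. lnk R `` {x}) ` V" for C D
    using that card_le_Suc0_iff_eq[OF finite_imageI[OF assms(1)]] One_nat_def by metis
  then have "lnk R `` {x} = lnk R `` {y}" using imageI[OF assms(3)] imageI[OF assms(4)] by this
  then show ?thesis unfolding lnk_class_eq .
qed

lemma rel_of_subset: "(\<And>i. i \<in> A \<Longrightarrow> N i \<subseteq> V) \<Longrightarrow> rel_of N A \<subseteq> V \<times> V"
  unfolding rel_of_def by blast

lemma rel_of_mono: "A \<subseteq> B \<Longrightarrow> rel_of N A \<subseteq> rel_of N B"
  unfolding rel_of_def by blast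

lemma rel_of_Un: "rel_of N (A \<union> B) = rel_of N A \<union> rel_of N B"
  unfolding rel_of_def by blast

lemma rel_of_insert: "rel_of N (insert i A) = N i \<times> N i \<union> rel_of N A"
  unfolding rel_of_def by blast

lemma ncomp_rel_of_submodular:
  assumes "finite V" "\<And>i. i \<in> A \<union> B \<Longrightarrow> N i \<subseteq> V"
  shows "ncomp V (rel_of N A) + ncomp V (rel_of N B) \<le>
    ncomp V (rel_of N (A \<union> B)) + ncomp V (rel_of N (A \<inter> B))"
proof -
  have sub: "rel_of N A \<subseteq> V \<times> V" "rel_of N B \<subseteq> V \<times> V"
    by (rule rel_of_subset; use assms in blast)+
  have "ncomp V (rel_of N A \<inter> rel_of N B) \<le> ncomp V (rel_of N (A \<inter> B))"
    using sub by (intro ncomp_antimono assms) (auto simp: rel_of_def)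
  then show ?thesis using ncomp_submodular[OF assms(1) sub] unfolding rel_of_Un by linarith
qed

text \<open>Two different vertices of a triple cannot both be indispensable: if dropping \<open>x\<close> and dropping
  \<open>y\<close> both violate the bound, submodularity and convexity give a violation before the drop.\<close>

lemma drop_vertex:
  fixes g :: "nat \<Rightarrow> nat"
  assumes V: "finite V" and I: "finite I" and N: "\<And>i. i \<in> I \<Longrightarrow> N i \<subseteq> V"
    and cond: "\<And>A. A \<subseteq> I \<Longrightarrow> g (ncomp V (rel_of N A)) \<le> card (I - A)"
    and convex: "\<And>a p q b. a \<le> p \<Longrightarrow> a \<le> q \<Longrightarrow> p + q \<le> a + b \<Longrightarrow> g p + g q \<le> g a + g b"
    and i: "i \<in> I" "N i = {x, y, z}"
  shows "(\<forall>A\<subseteq>I. g (ncomp V (rel_of (N(i := {y, z})) A)) \<le> card (I - A)) \<or>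
         (\<forall>A\<subseteq>I. g (ncomp V (rel_of (N(i := {x, z})) A)) \<le> card (I - A))"
proof (rule ccontr)
  assume "\<not> ?thesis"
  then obtain A1 A2 where A1: "A1 \<subseteq> I" "card (I - A1) < g (ncomp V (rel_of (N(i := {y, z})) A1))"
    and A2: "A2 \<subseteq> I" "card (I - A2) < g (ncomp V (rel_of (N(i := {x, z})) A2))"
    by (auto simp: not_le)
  have same: "rel_of (N(i := M)) A = rel_of N A" if "i \<notin> A" for A M
    using that unfolding rel_of_def by (intro SUP_cong) auto
  \<comment> \<open>A family without \<open>i\<close> does not see the trimming, so it cannot
    violate the bound.\<close>
  have iA: "i \<in> A1" "i \<in> A2"
    using A1 A2 cond same not_le by metis+
  define B1 B2 where "B1 = A1 - {i}" and "B2 = A2 - {i}"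
  define R1 R2 where "R1 = rel_of N B1 \<union> {y, z} \<times> {y, z}" and "R2 = rel_of N B2 \<union> {x, z} \<times> {x, z}"
  have R: "rel_of (N(i := {y, z})) A1 = R1" "rel_of (N(i := {x, z})) A2 = R2"
    using rel_of_insert[of "N(i := {y, z})" i B1] rel_of_insert[of "N(i := {x, z})" i B2] same
      insert_Diff[OF iA(1)] insert_Diff[OF iA(2)]
    unfolding R1_def R2_def B1_def[symmetric] B2_def[symmetric] by (auto simp: B1_def B2_def)
  have xyz: "{x, y, z} \<subseteq> V" using N[OF i(1)] i(2) by simp
  have RV: "R1 \<subseteq> V \<times> V" "R2 \<subseteq> V \<times> V"
    using rel_of_subset[of B1 N V] rel_of_subset[of B2 N V] N A1(1) A2(1) xyz
    unfolding R1_def R2_def B1_def B2_def by blast+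
  define U where "U = insert i (B1 \<union> B2)"
  have UI: "U \<subseteq> I" "B1 \<inter> B2 \<subseteq> I" using i A1 A2 unfolding U_def B1_def B2_def by auto
  have relU: "rel_of N U = rel_of N B1 \<union> rel_of N B2 \<union> {x, y, z} \<times> {x, y, z}"
    using i(2) unfolding U_def rel_of_insert rel_of_Un by auto
  \<comment> \<open>The two shortened pairs share \<open>z\<close>, so together they join
    \<open>x\<close>, \<open>y\<close> and \<open>z\<close>, and \<open>R1 \<union> R2\<close> has
    the classes of the untrimmed family on \<open>U\<close>.\<close>
  have "rel_of N U \<subseteq> lnk (R1 \<union> R2)"
  proof -
    have "R1 \<union> R2 \<subseteq> lnk (R1 \<union> R2)" by (auto intro: lnk_base)
    moreover have "(x, z) \<in> lnk (R1 \<union> R2)" "(y, z) \<in> lnk (R1 \<union> R2)"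
      unfolding R1_def R2_def by (auto intro!: lnk_base)
    moreover have "(x, y) \<in> lnk (R1 \<union> R2)" using calculation lnk_sym lnk_trans by metis
    ultimately have "{x, y, z} \<times> {x, y, z} \<subseteq> lnk (R1 \<union> R2)"
      using lnk_sym[of x z] lnk_sym[of y z] lnk_sym[of x y] by simp
    then show ?thesis using \<open>R1 \<union> R2 \<subseteq> lnk (R1 \<union> R2)\<close> unfolding relU R1_def R2_def by blast
  qed
  moreover have "R1 \<union> R2 \<subseteq> rel_of N U" unfolding relU R1_def R2_def by auto
  ultimately have "lnk (rel_of N U) = lnk (R1 \<union> R2)"
    using lnk_lnk_subset lnk_mono by (metis subset_antisym)
  then have cU: "ncomp V (rel_of N U) = ncomp V (R1 \<union> R2)" unfolding ncomp_def by simp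
  have cI: "ncomp V (R1 \<inter> R2) \<le> ncomp V (rel_of N (B1 \<inter> B2))"
    by (rule ncomp_antimono[OF V]) (use RV in \<open>auto simp: R1_def R2_def rel_of_def\<close>)
  have sm: "ncomp V R1 + ncomp V R2 \<le> ncomp V (R1 \<union> R2) + ncomp V (R1 \<inter> R2)"
    by (rule ncomp_submodular[OF V RV])
  have le: "ncomp V (R1 \<union> R2) \<le> ncomp V R1" "ncomp V (R1 \<union> R2) \<le> ncomp V R2"
    by (rule ncomp_antimono[OF V]; use RV in auto)+
  have "g (ncomp V R1) + g (ncomp V R2) \<le> g (ncomp V (rel_of N U)) + g (ncomp V (rel_of N (B1 \<inter> B2)))"
    by (rule convex) (use cU cI sm le in auto)
  also have "\<dots> \<le> card (I - U) + card (I - (B1 \<inter> B2))"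
    by (intro add_mono cond UI)
  finally have 1: "g (ncomp V R1) + g (ncomp V R2) \<le> card (I - U) + card (I - (B1 \<inter> B2))" .
  have "U = A1 \<union> A2" "insert i (B1 \<inter> B2) = A1 \<inter> A2" using iA unfolding U_def B1_def B2_def by auto
  then have "I - U = (I - A1) \<inter> (I - A2)" "I - (B1 \<inter> B2) = insert i ((I - A1) \<union> (I - A2))"
    using i(1) unfolding B1_def B2_def by auto
  \<comment> \<open>\<open>i\<close> lies in \<open>A1\<close> and \<open>A2\<close> but not in
    \<open>B1 \<inter> B2\<close>, which costs one; the two strict violations together gain
    two.\<close>
  then have "card (I - U) + card (I - (B1 \<inter> B2)) = Suc (card (I - A1) + card (I - A2))"
    using card_Un_Int[of "I - A1" "I - A2"] I iA by simp
  then show False using 1 A1(2) A2(2) unfolding R by linarith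
qed

lemma trim_triples:
  fixes g :: "nat \<Rightarrow> nat"
  assumes V: "finite V" and I: "finite I"
    and convex: "\<And>a p q b. a \<le> p \<Longrightarrow> a \<le> q \<Longrightarrow> p + q \<le> a + b \<Longrightarrow> g p + g q \<le> g a + g b"
    and N: "\<And>i. i \<in> I \<Longrightarrow> N i \<subseteq> V \<and> (card (N i) = 2 \<or> card (N i) = 3)"
    and cond: "\<And>A. A \<subseteq> I \<Longrightarrow> g (ncomp V (rel_of N A)) \<le> card (I - A)"
  shows "\<exists>N'. (\<forall>i\<in>I. N' i \<subseteq> N i \<and> card (N' i) = 2) \<and>
    (\<forall>A\<subseteq>I. g (ncomp V (rel_of N' A)) \<le> card (I - A))"
  using N cond
proof (induction "card {i\<in>I. card (N i) = 3}" arbitrary: N rule: less_induct)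
  case less
  show ?case
  proof (cases "{i\<in>I. card (N i) = 3} = {}")
    case True
    then show ?thesis using less.prems by (intro exI[of _ N]) auto
  next
    case False
    then obtain i where i: "i \<in> I" "card (N i) = 3" by blast
    then obtain x y z where xyz: "N i = {x, y, z}" "x \<noteq> y" "x \<noteq> z" "y \<noteq> z"
      by (auto simp: card_3_iff)
    obtain M where M: "M \<subseteq> N i" "card M = 2"
      and ok: "\<forall>A\<subseteq>I. g (ncomp V (rel_of (N(i := M)) A)) \<le> card (I - A)"
    proof -
      have "(\<forall>A\<subseteq>I. g (ncomp V (rel_of (N(i := {y, z})) A)) \<le> card (I - A)) \<or>
         (\<forall>A\<subseteq>I. g (ncomp V (rel_of (N(i := {x, z})) A)) \<le> card (I - A))"
        by (rule drop_vertex[OF V I _ less.prems(2) convex i(1) xyz(1)]) (use less.prems(1) in auto)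
      then show thesis
      proof
        assume "\<forall>A\<subseteq>I. g (ncomp V (rel_of (N(i := {y, z})) A)) \<le> card (I - A)"
        then show thesis using xyz by (intro that[of "{y, z}"]) auto
      next
        assume "\<forall>A\<subseteq>I. g (ncomp V (rel_of (N(i := {x, z})) A)) \<le> card (I - A)"
        then show thesis using xyz by (intro that[of "{x, z}"]) auto
      qed
    qed
    have "{j\<in>I. card ((N(i := M)) j) = 3} \<subset> {j\<in>I. card (N j) = 3}"
      using i M(2) by (auto split: if_splits)
    then have "card {j\<in>I. card ((N(i := M)) j) = 3} < card {j\<in>I. card (N j) = 3}"
      using I by (intro psubset_card_mono) auto
    moreover have N2: "(N(i := M)) j \<subseteq> V \<and> (card ((N(i := M)) j) = 2 \<or> card ((N(i := M)) j) = 3)"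
      if "j \<in> I" for j
      using less.prems(1)[OF that] less.prems(1)[OF i(1)] M by auto
    ultimately obtain N' where "\<forall>j\<in>I. N' j \<subseteq> (N(i := M)) j \<and> card (N' j) = 2"
      "\<forall>A\<subseteq>I. g (ncomp V (rel_of N' A)) \<le> card (I - A)"
      using less.hyps[of "N(i := M)"] N2 ok by blast
    moreover have "(N(i := M)) j \<subseteq> N j" for j using M(1) by simp
    ultimately show ?thesis by (meson subset_trans)
  qed
qed

lemma ncomp_ge_card_image:
  assumes "finite V" "\<And>x y. (x, y) \<in> R \<Longrightarrow> f x = f y"
  shows "card (f ` V) \<le> ncomp V R"
proof -
  have const: "(x, y) \<in> lnk R \<Longrightarrow> f x = f y" for x y
    using lnk_least[of R "{(x, y). f x = f y}"] assms(2) by fastforce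
  define F where "F C = f (SOME z. z \<in> C)" for C
  have "F (lnk R `` {x}) = f x" for x
  proof -
    have "(SOME z. z \<in> lnk R `` {x}) \<in> lnk R `` {x}" by (rule someI[of _ x]) simp
    then show ?thesis unfolding F_def using const[of x] by fastforce
  qed
  then have "f ` V = F ` ((\<lambda>x. lnk R `` {x}) ` V)" by (simp add: image_image)
  then show ?thesis unfolding ncomp_def using assms(1) by (simp add: card_image_le)
qed

text \<open>Collapsing \<open>S\<close> to a point shows that pairs inside \<open>S\<close> alone
  leave at least \<open>card V - card S + 1\<close> classes. By submodularity they merge no more
  classes on top of \<open>R\<close> than they do on their own.\<close>

lemma ncomp_union_within:
  assumes V: "finite V" and S: "S \<subseteq> V" "S \<noteq> {}" and R: "R \<subseteq> V \<times> V" and D: "D \<subseteq> S \<times> S"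
  shows "ncomp V R + 1 \<le> ncomp V (R \<union> D) + card S"
proof -
  obtain s where s: "s \<in> S" using S by blast
  define f where "f x = (if x \<in> S then s else x)" for x
  have "f ` V = insert s (V - S)" using s S unfolding f_def by auto
  then have "card (f ` V) = Suc (card (V - S))" using V s by simp
  moreover have "card (V - S) = card V - card S" using V S by (intro card_Diff_subset finite_subset[OF S(1)]) auto
  moreover have "card S \<le> card V" using card_mono[OF V S(1)] .
  ultimately have "card V + 1 \<le> ncomp V D + card S"
    using ncomp_ge_card_image[of V D f] V D unfolding f_def by fastforce
  moreover have "ncomp V R + ncomp V D \<le> ncomp V (R \<union> D) + ncomp V (R \<inter> D)"
    by (rule ncomp_submodular) (use V R D S in auto)
  moreover have "ncomp V (R \<inter> D) \<le> card V" using ncomp_le[OF V] .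
  ultimately show ?thesis by linarith
qed

text \<open>A pair outside \<open>A\<close> is counted at most once, or twice if it lies inside
  \<open>S\<close>; the latter pairs form \<open>J\<close>, so the sum is at most
  \<open>card (I - A) + card J\<close>. Adding \<open>J\<close> to \<open>A\<close> merges at most
  \<open>card S - 1\<close> classes, so \<open>cond\<close> for \<open>A \<union> J\<close> bounds
  the \<open>g\<close> term by \<open>card (I - A) - card J\<close>, and \<open>card J\<close>
  cancels.\<close>

lemma double_cover_bound:
  fixes g :: "nat \<Rightarrow> nat"
  assumes V: "finite V" and I: "finite I" and N: "\<And>i. i \<in> I \<Longrightarrow> N i \<subseteq> V \<and> card (N i) = 2"
    and cond: "\<And>A. A \<subseteq> I \<Longrightarrow> g (ncomp V (rel_of N A)) \<le> card (I - A)"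
    and g: "mono g" and S: "S \<subseteq> V" "S \<noteq> {}" and A: "A \<subseteq> I"
    and G: "\<And>t. t \<in> S \<Longrightarrow> G t \<subseteq> {i \<in> I. t \<in> N i}"
  shows "(\<Sum>t\<in>S. card (G t - A)) + g (max 1 (ncomp V (rel_of N A) + 1 - card S)) \<le> 2 * card (I - A)"
proof -
  have finS: "finite S" using V S finite_subset by blast
  define J where "J = {i \<in> I - A. N i \<subseteq> S}"
  have "(\<Sum>t\<in>S. card (G t - A)) \<le> (\<Sum>t\<in>S. card {i \<in> I - A. t \<in> N i})"
    using G I by (intro sum_mono card_mono) auto
  also have "\<dots> = (\<Sum>t\<in>S. \<Sum>i\<in>I - A. if t \<in> N i then 1 else 0)"
    using I by (intro sum.cong refl) (simp add: sum.If_cases Int_def)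
  also have "\<dots> = (\<Sum>i\<in>I - A. \<Sum>t\<in>S. if t \<in> N i then 1 else 0)" by (rule sum.swap)
  also have "\<dots> = (\<Sum>i\<in>I - A. card (N i \<inter> S))"
    using finS by (intro sum.cong refl) (simp add: sum.If_cases Int_commute)
  also have "\<dots> \<le> (\<Sum>i\<in>I - A. 1 + (if N i \<subseteq> S then 1 else 0))"
  proof (rule sum_mono)
    fix i assume i: "i \<in> I - A"
    then have fN: "finite (N i)" "card (N i) = 2" using N finite_subset[OF _ V] by auto
    show "card (N i \<inter> S) \<le> 1 + (if N i \<subseteq> S then 1 else 0)"
    proof (cases "N i \<subseteq> S")
      case False
      then have "card (N i \<inter> S) < card (N i)" using fN by (intro psubset_card_mono) auto
      then show ?thesis using fN by simp
    qed (use fN in \<open>simp add: Int_absorb2\<close>)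
  qed
  also have "\<dots> = card (I - A) + card J"
    using I unfolding sum.distrib J_def by (simp add: sum.If_cases Int_def)
  finally have 1: "(\<Sum>t\<in>S. card (G t - A)) \<le> card (I - A) + card J" .
  have J: "J \<subseteq> I - A" "finite J" unfolding J_def using I by auto
  have "rel_of N J \<subseteq> S \<times> S" unfolding J_def rel_of_def by auto
  moreover have "rel_of N A \<subseteq> V \<times> V" by (rule rel_of_subset) (use A N in blast)
  ultimately have "ncomp V (rel_of N A) + 1 \<le> ncomp V (rel_of N (A \<union> J)) + card S"
    unfolding rel_of_Un by (intro ncomp_union_within V S)
  moreover have "ncomp V (rel_of N (A \<union> J)) \<ge> 1" using ncomp_pos[OF V] S by blast
  ultimately have "g (max 1 (ncomp V (rel_of N A) + 1 - card S)) \<le> g (ncomp V (rel_of N (A \<union> J)))"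
    by (intro monoD[OF g]) auto
  also have "\<dots> \<le> card (I - (A \<union> J))" using J A by (intro cond) auto
  also have "\<dots> = card (I - A) - card J"
    using J I card_Diff_subset[of J "I - A"] by (simp add: Diff_Diff_Int set_diff_eq)
  finally show ?thesis using 1 card_mono[of "I - A" J] J I by auto
qed

text \<open>An orientation in which no out-degree exceeds the in-degree by more than one. Two pairs
  meeting at \<open>t\<close> are replaced by one pair of their other ends; its orientation is then
  routed through \<open>t\<close>, adding one arc in and one arc out there. When no two pairs meet,
  any orientation will do.\<close>

lemma balanced_orientation:
  fixes ab :: "'i \<Rightarrow> 'v \<times> 'v"
  assumes "finite I"
  shows "\<exists>p. (\<forall>i\<in>I. p i = ab i \<or> p i = prod.swap (ab i)) \<and>
    (\<forall>t. card {i\<in>I. fst (p i) = t} \<le> card {i\<in>I. snd (p i) = t} + 1)"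
proof -
  define d where "d q t = (of_bool (fst q = t) - of_bool (snd q = t) :: int)" for q :: "'v \<times> 'v" and t
  have "\<exists>p. (\<forall>i\<in>I. p i = ab i \<or> p i = prod.swap (ab i)) \<and> (\<forall>t. (\<Sum>i\<in>I. d (p i) t) \<le> 1)"
    using assms
  proof (induction "card I" arbitrary: I ab rule: less_induct)
    case less
    show ?case
    proof (cases "\<exists>i j t. i \<in> I \<and> j \<in> I \<and> i \<noteq> j \<and> (t = fst (ab i) \<or> t = snd (ab i)) \<and> (t = fst (ab j) \<or> t = snd (ab j))")
      case True
      then obtain i j t x y where ij: "i \<in> I" "j \<in> I" "i \<noteq> j"
        and abi: "ab i = (t, x) \<or> ab i = (x, t)" and abj: "ab j = (t, y) \<or> ab j = (y, t)"
        by (metis prod.collapse)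
      have "card (I - {j}) < card I" using ij less.prems by (intro psubset_card_mono) auto
      then obtain p where p: "\<forall>l\<in>I - {j}. p l = (ab(i := (x, y))) l \<or> p l = prod.swap ((ab(i := (x, y))) l)"
        and bal: "\<And>t. (\<Sum>l\<in>I - {j}. d (p l) t) \<le> 1"
        using less.hyps[of "I - {j}" "ab(i := (x, y))"] less.prems by auto
      define p' where "p' = p(i := if p i = (x, y) then (x, t) else (t, x), j := if p i = (x, y) then (t, y) else (y, t))"
      have pi: "p i = (x, y) \<or> p i = (y, x)" using bspec[OF p, of i] ij by simp
      have "(\<Sum>l\<in>I. d (p' l) s) = (\<Sum>l\<in>I - {j}. d (p l) s)" for s
      proof -
        have "(\<Sum>l\<in>I. d (p' l) s) = d (p' j) s + (d (p' i) s + (\<Sum>l\<in>I - {j} - {i}. d (p' l) s))"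
          using less.prems ij by (subst sum.remove[of I j], simp, simp, subst sum.remove[of "I - {j}" i]) auto
        moreover have "(\<Sum>l\<in>I - {j} - {i}. d (p' l) s) = (\<Sum>l\<in>I - {j} - {i}. d (p l) s)"
          by (intro sum.cong) (auto simp: p'_def)
        moreover have "d (p' j) s + d (p' i) s = d (p i) s"
        proof (cases "p i = (x, y)")
          case True
          then show ?thesis using ij unfolding p'_def d_def by simp
        next
          case False
          then have "p' i = (t, x)" "p' j = (y, t)" "p i = (y, x)" using ij pi unfolding p'_def by simp_all
          then show ?thesis unfolding d_def by simp
        qed
        moreover have "(\<Sum>l\<in>I - {j}. d (p l) s) = d (p i) s + (\<Sum>l\<in>I - {j} - {i}. d (p l) s)"
          using less.prems ij by (subst sum.remove[of _ i]) auto
        ultimately show ?thesis by linarith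
      qed
      moreover have "\<forall>l\<in>I. p' l = ab l \<or> p' l = prod.swap (ab l)"
      proof
        fix l assume "l \<in> I"
        show "p' l = ab l \<or> p' l = prod.swap (ab l)"
        proof (cases "l = i \<or> l = j")
          case True
          then show ?thesis using abi abj ij unfolding p'_def by auto
        next
          case False
          then show ?thesis using bspec[OF p, of l] \<open>l \<in> I\<close> unfolding p'_def by simp
        qed
      qed
      ultimately show ?thesis using bal by (intro exI[of _ p']) auto
    next
      case False
      have "(\<Sum>i\<in>I. d (ab i) t) \<le> 1" for t
      proof (cases "\<exists>i\<in>I. t = fst (ab i) \<or> t = snd (ab i)")
        case True
        then obtain i where i: "i \<in> I" "t = fst (ab i) \<or> t = snd (ab i)" by blast
        have "(\<Sum>l\<in>I. d (ab l) t) = d (ab i) t + (\<Sum>l\<in>I - {i}. d (ab l) t)"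
          using less.prems i by (subst sum.remove[of _ i]) auto
        also have "(\<Sum>l\<in>I - {i}. d (ab l) t) = 0"
          using False i by (intro sum.neutral ballI) (auto simp: d_def)
        finally show ?thesis unfolding d_def by auto
      next
        case False
        then have "(\<Sum>i\<in>I. d (ab i) t) = 0" by (intro sum.neutral ballI) (auto simp: d_def)
        then show ?thesis by simp
      qed
      then show ?thesis by (intro exI[of _ ab]) auto
    qed
  qed
  then obtain p where p: "\<forall>i\<in>I. p i = ab i \<or> p i = prod.swap (ab i)" and bal: "\<And>t. (\<Sum>i\<in>I. d (p i) t) \<le> 1"
    by blast
  have "(\<Sum>i\<in>I. d (p i) t) = int (card {i\<in>I. fst (p i) = t}) - int (card {i\<in>I. snd (p i) = t})" for t
    unfolding d_def sum_subtractf using assms by (simp add: of_bool_def sum.If_cases Int_def)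
  then have "card {i\<in>I. fst (p i) = t} \<le> card {i\<in>I. snd (p i) = t} + 1" for t
    using bal[of t] by simp
  then show ?thesis using p by blast
qed

section \<open>Link systems\<close>

text \<open>A link is a nonterminal of degree two or three together with its edges, or an edge joining
  two terminals. \<open>H\<close> is the set of half-edges at terminals, \<open>loc\<close> gives the terminal and \<open>lk\<close>
  the link of a half-edge.\<close>

definition link_cut :: "'h set \<Rightarrow> ('h \<Rightarrow> 'v) \<Rightarrow> ('h \<Rightarrow> 'l) \<Rightarrow> 'v set \<Rightarrow> 'l set" where
  "link_cut H loc lk X = {l. (\<exists>h\<in>H. lk h = l \<and> loc h \<in> X) \<and> (\<exists>h\<in>H. lk h = l \<and> loc h \<notin> X)}"

locale link_system =
  fixes H :: "'h set" and loc :: "'h \<Rightarrow> 'v" and lk :: "'h \<Rightarrow> 'l" and T :: "'v set" and v :: 'v and k :: nat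
  assumes fin: "finite H" "finite T" and vT: "v \<in> T" and locT: "\<And>h. h \<in> H \<Longrightarrow> loc h \<in> T"
    and size: "\<And>h. h \<in> H \<Longrightarrow> card {h' \<in> H. lk h' = lk h} = 2 \<or> card {h' \<in> H. lk h' = lk h} = 3"
    and inj: "\<And>h h'. h \<in> H \<Longrightarrow> h' \<in> H \<Longrightarrow> lk h = lk h' \<Longrightarrow> loc h = loc h' \<Longrightarrow> h = h'"
    and cut: "\<And>X. X \<subseteq> T \<Longrightarrow> X \<noteq> {} \<Longrightarrow> X \<noteq> T \<Longrightarrow> 6 * k + 6 \<le> card (link_cut H loc lk X)"
    and degv: "card {h \<in> H. loc h = v} = 6 * k + 6"
begin

text \<open>\<open>E0\<close> are the links avoiding the root, \<open>Y3\<close> the root links with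
  two further ends, \<open>D1\<close> the direct links from the root to one terminal. Only
  \<open>Y3\<close> offers a choice: uncoloured, such a link acts as a pair on \<open>T'\<close>;
  coloured, it must carry its colour to one of two ends.\<close>

definition "L = lk ` H"
definition "ends_of l = loc ` {h \<in> H. lk h = l}"
definition "N l = ends_of l - {v}"
definition "Lv = {l \<in> L. v \<in> ends_of l}"
definition "E0 = L - Lv"
definition "Y3 = {l \<in> Lv. card (N l) = 2}"
definition "D1 = {l \<in> Lv. card (N l) = 1}"
definition "half l t = (SOME h. h \<in> H \<and> lk h = l \<and> loc h = t)"
definition "T' = T - {v}"

lemma finite_sets [simp]: "finite H" "finite T" "finite L" "finite Lv" "finite E0" "finite Y3" "finite D1" "finite T'"
  "finite (ends_of l)" "finite (N l)"
  using fin unfolding L_def Lv_def E0_def Y3_def D1_def T'_def ends_of_def N_def by auto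

lemma half:
  assumes "t \<in> ends_of l"
  shows "half l t \<in> H" "lk (half l t) = l" "loc (half l t) = t"
proof -
  have "\<exists>h. h \<in> H \<and> lk h = l \<and> loc h = t" using assms unfolding ends_of_def by auto
  from someI_ex[OF this] show "half l t \<in> H" "lk (half l t) = l" "loc (half l t) = t"
    unfolding half_def by auto
qed

lemma half_eq: "h \<in> H \<Longrightarrow> half (lk h) (loc h) = h"
  using half[of "loc h" "lk h"] inj[of "half (lk h) (loc h)" h] unfolding ends_of_def by blast

lemma loc_ends: "h \<in> H \<Longrightarrow> loc h \<in> ends_of (lk h)" "h \<in> H \<Longrightarrow> lk h \<in> L"
  unfolding ends_of_def L_def by auto

lemma ends_T: "ends_of l \<subseteq> T" "N l \<subseteq> T'"
  using locT unfolding ends_of_def N_def T'_def by auto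

lemma card_ends: "l \<in> L \<Longrightarrow> card (ends_of l) = 2 \<or> card (ends_of l) = 3"
proof -
  assume "l \<in> L"
  then obtain h where h: "h \<in> H" "l = lk h" unfolding L_def by blast
  have "card (ends_of l) = card {h' \<in> H. lk h' = l}"
    unfolding ends_of_def by (rule card_image) (auto simp: inj_on_def intro: inj)
  then show ?thesis using size[OF h(1)] h(2) by simp
qed

lemma link_cut_eq: "link_cut H loc lk X = {l \<in> L. ends_of l \<inter> X \<noteq> {} \<and> ends_of l - X \<noteq> {}}"
  unfolding link_cut_def L_def ends_of_def by auto

lemma N_E0: "l \<in> E0 \<Longrightarrow> N l = ends_of l"
  unfolding E0_def Lv_def N_def by auto

lemma card_N_Lv: "l \<in> Lv \<Longrightarrow> card (N l) = 1 \<or> card (N l) = 2"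
  using card_ends[of l] unfolding Lv_def N_def by (auto simp: card_Diff_singleton_if)

lemma Lv_split: "Lv = Y3 \<union> D1" "Y3 \<inter> D1 = {}" "L = E0 \<union> Lv" "E0 \<inter> Lv = {}"
  using card_N_Lv unfolding Y3_def D1_def E0_def Lv_def by auto

lemma card_Lv: "card Lv = 6 * k + 6"
proof -
  have "bij_betw lk {h \<in> H. loc h = v} Lv"
    unfolding bij_betw_def inj_on_def
  proof (intro conjI ballI impI)
    show "h = h'" if "h \<in> {h \<in> H. loc h = v}" "h' \<in> {h \<in> H. loc h = v}" "lk h = lk h'" for h h'
      using that inj[of h h'] by simp
    show "lk ` {h \<in> H. loc h = v} = Lv"
    proof
      show "Lv \<subseteq> lk ` {h \<in> H. loc h = v}"
      proof
        fix l assume "l \<in> Lv"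
        then have "half l v \<in> {h \<in> H. loc h = v}" "lk (half l v) = l" using half[of v l] unfolding Lv_def by auto
        then show "l \<in> lk ` {h \<in> H. loc h = v}" by (metis imageI)
      qed
    qed (auto simp: Lv_def L_def ends_of_def)
  qed
  then show ?thesis using degv bij_betw_same_card by metis
qed

lemma card_Y3_D1: "card Y3 + card D1 = 6 * k + 6"
  using card_Lv Lv_split(1,2) card_Un_disjoint[of Y3 D1] by simp

text \<open>The cut condition is summed over the classes of \<open>R\<close> on \<open>T'\<close>. A
  link avoiding the root crosses at most three of these cuts, and none if it lies within a class. A
  root link crosses one cut for each class that it meets, so the \<open>6 * k + 6\<close> root links
  give one each and the triples split by \<open>R\<close> one more.\<close>

lemma partition_bound:
  assumes R: "R \<subseteq> T' \<times> T'"
  shows "(6 * k + 6) * ncomp T' R \<le>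
    3 * card {l \<in> E0. \<not> N l \<times> N l \<subseteq> lnk R} + (6 * k + 6) + card {l \<in> Y3. \<not> N l \<times> N l \<subseteq> lnk R}"
proof -
  define Cs where "Cs = (\<lambda>x. lnk R `` {x}) ` T'"
  have finC: "finite Cs" unfolding Cs_def by simp
  have "lnk R \<subseteq> {(x, y). x \<in> T' \<longleftrightarrow> y \<in> T'}" by (rule lnk_least) (use R in auto)
  then have sub: "C \<subseteq> T'" if "C \<in> Cs" for C using that unfolding Cs_def by auto
  have ne: "C \<noteq> {}" if C: "C \<in> Cs" for C
  proof -
    obtain x where "C = lnk R `` {x}" using C unfolding Cs_def by blast
    then have "x \<in> C" by simp
    then show ?thesis by blast
  qed
  have same: "C = lnk R `` {x}" if C: "C \<in> Cs" "x \<in> C" for C x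
  proof -
    obtain y where "C = lnk R `` {y}" using C unfolding Cs_def by blast
    then show ?thesis using C(2) lnk_class_eq[of R y x] by simp
  qed
  define K where "K l = {C \<in> Cs. l \<in> link_cut H loc lk C}" for l
  have KN: "K l \<subseteq> (\<lambda>x. lnk R `` {x}) ` N l" for l
  proof
    fix C assume C: "C \<in> K l"
    then obtain x where x: "x \<in> ends_of l" "x \<in> C" unfolding K_def link_cut_eq by blast
    have "C \<in> Cs" using C unfolding K_def by simp
    then have "x \<in> N l" using sub[of C] x unfolding N_def T'_def by auto
    then show "C \<in> (\<lambda>x. lnk R `` {x}) ` N l" using same[OF \<open>C \<in> Cs\<close> x(2)] by blast
  qed
  have K_le: "card (K l) \<le> card (N l)" for l
    using surj_card_le[OF _ KN] by simp
  have "(6 * k + 6) * ncomp T' R = (\<Sum>C\<in>Cs. 6 * k + 6)" unfolding ncomp_def Cs_def by simp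
  also have "\<dots> \<le> (\<Sum>C\<in>Cs. card (link_cut H loc lk C))"
  proof (rule sum_mono)
    fix C assume "C \<in> Cs"
    then have "C \<subseteq> T'" "C \<noteq> {}" using sub ne by auto
    then show "6 * k + 6 \<le> card (link_cut H loc lk C)"
      using vT unfolding T'_def by (intro cut) auto
  qed
  also have "\<dots> = (\<Sum>C\<in>Cs. \<Sum>l\<in>L. if l \<in> link_cut H loc lk C then 1 else 0)"
    by (intro sum.cong refl) (simp add: sum.If_cases link_cut_eq Int_def)
  also have "\<dots> = (\<Sum>l\<in>L. \<Sum>C\<in>Cs. if l \<in> link_cut H loc lk C then 1 else 0)" by (rule sum.swap)
  also have "\<dots> = (\<Sum>l\<in>L. card (K l))"
    using finC unfolding K_def by (intro sum.cong refl) (simp add: sum.If_cases Int_def)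
  also have "\<dots> = (\<Sum>l\<in>E0. card (K l)) + (\<Sum>l\<in>Lv. card (K l))"
    unfolding Lv_split(3) by (rule sum.union_disjoint) (use Lv_split(4) in auto)
  also have "\<dots> \<le> (\<Sum>l\<in>E0. if \<not> N l \<times> N l \<subseteq> lnk R then 3 else 0) +
      (\<Sum>l\<in>Lv. 1 + (if l \<in> Y3 \<and> \<not> N l \<times> N l \<subseteq> lnk R then 1 else 0))"
  proof (intro add_mono sum_mono)
    fix l assume l: "l \<in> E0"
    have "K l = {}" if c: "N l \<times> N l \<subseteq> lnk R"
    proof (rule ccontr)
      assume "K l \<noteq> {}"
      then obtain C where C: "C \<in> K l" by blast
      then obtain x y where xy: "x \<in> N l" "x \<in> C" "y \<in> N l" "y \<notin> C" and "C \<in> Cs"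
        using N_E0[OF l] unfolding K_def link_cut_eq by blast
      then have "C = lnk R `` {x}" using same by blast
      then show False using xy c by auto
    qed
    moreover have "card (K l) \<le> 3"
      using K_le[of l] card_ends[of l] N_E0[OF l] l unfolding E0_def by auto
    ultimately show "card (K l) \<le> (if \<not> N l \<times> N l \<subseteq> lnk R then 3 else 0)" by auto
  next
    fix l assume l: "l \<in> Lv"
    have "card (K l) \<le> 1" if "N l \<times> N l \<subseteq> lnk R"
    proof -
      have "C = D" if CD: "C \<in> K l" "D \<in> K l" for C D
      proof -
        obtain x y where "x \<in> N l" "y \<in> N l" "C = lnk R `` {x}" "D = lnk R `` {y}"
          using KN CD by (meson imageE subsetD)
        then show ?thesis using \<open>N l \<times> N l \<subseteq> lnk R\<close> unfolding \<open>C = _\<close> \<open>D = _\<close> lnk_class_eq by auto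
      qed
      moreover have "finite (K l)" using finite_subset[OF KN] by simp
      ultimately show ?thesis using card_le_Suc0_iff_eq[of "K l"] by auto
    qed
    then show "card (K l) \<le> 1 + (if l \<in> Y3 \<and> \<not> N l \<times> N l \<subseteq> lnk R then 1 else 0)"
      using K_le[of l] card_N_Lv[OF l] l unfolding Y3_def by auto
  qed
  also have "\<dots> = 3 * card {l \<in> E0. \<not> N l \<times> N l \<subseteq> lnk R} + (6 * k + 6) + card {l \<in> Y3. \<not> N l \<times> N l \<subseteq> lnk R}"
  proof -
    have "Lv \<inter> {l. l \<in> Y3 \<and> \<not> N l \<times> N l \<subseteq> lnk R} = {l \<in> Y3. \<not> N l \<times> N l \<subseteq> lnk R}"
      unfolding Y3_def by auto
    then show ?thesis unfolding sum.distrib using card_Lv by (simp add: sum.If_cases Int_def mult.commute)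
  qed
  finally show ?thesis .
qed

section \<open>Bipartitions crossed by few links that avoid the root\<close>

definition "split Y l \<longleftrightarrow> N l \<inter> Y \<noteq> {} \<and> N l - Y \<noteq> {}"
definition "e0 Y = card {l \<in> E0. split Y l}"
text \<open>These are the bipartitions across which \<open>k\<close> trees cannot pass without help
  from uncoloured root triples.\<close>

definition "weak Y \<longleftrightarrow> Y \<subseteq> T' \<and> Y \<noteq> {} \<and> Y \<noteq> T' \<and> e0 Y < k"

text \<open>The cuts around \<open>Y\<close> and around \<open>T' - Y\<close> are added. Their union
  consists of crossing links and root links, and a link in both cuts has ends in \<open>Y\<close>
  and in \<open>T' - Y\<close>. So the \<open>6 * k + 6\<close> root links are paid for only
  once.\<close>

lemma bipartition_bound:
  assumes Y: "Y \<subseteq> T'" "Y \<noteq> {}" "Y \<noteq> T'"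
  shows "6 * k + 6 \<le> 2 * e0 Y + card {l \<in> Y3. split Y l}"
proof -
  let ?A = "link_cut H loc lk Y" and ?B = "link_cut H loc lk (T' - Y)"
  have "12 * k + 12 \<le> card ?A + card ?B"
    using cut[of Y] cut[of "T' - Y"] Y vT unfolding T'_def by fastforce
  also have "\<dots> = card (?A \<union> ?B) + card (?A \<inter> ?B)"
    by (rule card_Un_Int) (auto simp: link_cut_eq)
  also have "card (?A \<union> ?B) \<le> card ({l \<in> E0. split Y l} \<union> Lv)"
  proof (rule card_mono)
    have "l \<in> Lv \<or> split Y l" if "l \<in> ?A \<union> ?B" for l
    proof (cases "l \<in> Lv")
      case False
      then have "v \<notin> ends_of l" using that unfolding Lv_def link_cut_eq by auto
      then have "N l = ends_of l" "ends_of l \<subseteq> T'" using ends_T(2)[of l] unfolding N_def by auto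
      then show ?thesis using that unfolding link_cut_eq split_def by blast
    qed simp
    moreover have "?A \<union> ?B \<subseteq> L" unfolding link_cut_eq by auto
    ultimately show "?A \<union> ?B \<subseteq> {l \<in> E0. split Y l} \<union> Lv" unfolding E0_def by blast
  qed simp
  also have "\<dots> \<le> e0 Y + card Lv" unfolding e0_def by (rule card_Un_le)
  also have "card (?A \<inter> ?B) \<le> card ({l \<in> E0. split Y l} \<union> {l \<in> Y3. split Y l})"
  proof (rule card_mono)
    show "?A \<inter> ?B \<subseteq> {l \<in> E0. split Y l} \<union> {l \<in> Y3. split Y l}"
    proof
      fix l assume l: "l \<in> ?A \<inter> ?B"
      then obtain x y where "x \<in> ends_of l" "x \<in> Y" "y \<in> ends_of l" "y \<in> T' - Y" and lL: "l \<in> L"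
        unfolding link_cut_eq by blast
      then have xy: "x \<in> N l" "y \<in> N l" "x \<noteq> y" using Y unfolding N_def T'_def by auto
      then have s: "split Y l" using \<open>x \<in> Y\<close> \<open>y \<in> T' - Y\<close> unfolding split_def by blast
      have "card (N l) \<ge> 2" using card_mono[of "N l" "{x, y}"] xy by auto
      then have "l \<in> E0 \<or> l \<in> Y3" using card_N_Lv[of l] lL unfolding E0_def Y3_def by auto
      then show "l \<in> {l \<in> E0. split Y l} \<union> {l \<in> Y3. split Y l}" using s by blast
    qed
  qed simp
  also have "\<dots> \<le> e0 Y + card {l \<in> Y3. split Y l}" unfolding e0_def by (rule card_Un_le)
  finally show ?thesis using card_Lv by linarith
qed

text \<open>Two different weak bipartitions would divide \<open>T'\<close> into at least three parts
  crossed by at most \<open>2 * k - 2\<close> links avoiding the root. Then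
  \<open>partition_bound\<close> gives \<open>18 * k + 18\<close> at most
  \<open>3 * (2 * k - 2) + 2 * (6 * k + 6)\<close>, which is \<open>18 * k + 6\<close>.\<close>

lemma weak_unique:
  assumes Y: "weak Y" and Z: "weak Z"
  shows "Z = Y \<or> Z = T' - Y"
proof (rule ccontr)
  assume neg: "\<not> ?thesis"
  define A where "A = {l \<in> E0. \<not> split Y l \<and> \<not> split Z l}"
  define R where "R = rel_of N A"
  define f where "f x = (x \<in> Y, x \<in> Z)" for x
  have RT: "R \<subseteq> T' \<times> T'" unfolding R_def by (rule rel_of_subset) (rule ends_T(2))
  have "f x = f y" if "(x, y) \<in> R" for x y
    using that unfolding R_def A_def rel_of_def f_def split_def by blast
  then have fc: "card (f ` T') \<le> ncomp T' R" by (intro ncomp_ge_card_image) auto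
  have "Y \<subseteq> T'" "Y \<noteq> {}" "Y \<noteq> T'" "Z \<subseteq> T'" "Z \<noteq> {}" "Z \<noteq> T'"
    using Y Z unfolding weak_def by auto
  then obtain a b c d where abcd: "a \<in> T'" "b \<in> T'" "c \<in> T'" "d \<in> T'" "a \<in> Y" "b \<notin> Y" "c \<in> Z" "d \<notin> Z" by blast
  obtain x where x: "x \<in> T'" "x \<in> Z \<longleftrightarrow> x \<notin> Y" using neg \<open>Y \<subseteq> T'\<close> \<open>Z \<subseteq> T'\<close> by blast
  obtain y where y: "y \<in> T'" "y \<in> Z \<longleftrightarrow> y \<in> Y" using neg \<open>Y \<subseteq> T'\<close> \<open>Z \<subseteq> T'\<close> by blast
  \<comment> \<open>The coordinates of \<open>f x\<close> differ and those of \<open>f y\<close> are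
    equal, so these two values agree in exactly one coordinate. If no third value occurred, that
    coordinate would be constant on \<open>T'\<close>, although \<open>Y\<close> and
    \<open>Z\<close> are proper and nonempty.\<close>
  have "3 \<le> card (f ` T')"
  proof -
    have "\<exists>p q r. {p, q, r} \<subseteq> f ` T' \<and> p \<noteq> q \<and> p \<noteq> r \<and> q \<noteq> r"
    proof -
      have "f a \<in> f ` T'" "f b \<in> f ` T'" "f c \<in> f ` T'" "f d \<in> f ` T'" "f x \<in> f ` T'" "f y \<in> f ` T'"
        using abcd x y by auto
      moreover have "f x \<noteq> f y" using x y unfolding f_def by auto
      moreover have "(f a \<noteq> f x \<and> f a \<noteq> f y) \<or> (f b \<noteq> f x \<and> f b \<noteq> f y) \<or> (f c \<noteq> f x \<and> f c \<noteq> f y) \<or> (f d \<noteq> f x \<and> f d \<noteq> f y)"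
        using abcd x y unfolding f_def by auto
      ultimately show ?thesis by (metis empty_subsetI insert_subset)
    qed
    then obtain p q r where "{p, q, r} \<subseteq> f ` T'" "p \<noteq> q" "p \<noteq> r" "q \<noteq> r" by blast
    then show ?thesis using card_mono[of "f ` T'" "{p, q, r}"] by simp
  qed
  then have 3: "3 \<le> ncomp T' R" using fc by linarith
  have "N l \<times> N l \<subseteq> lnk R" if "l \<in> A" for l
    using that unfolding R_def rel_of_def by (auto intro: lnk_base)
  then have "{l \<in> E0. \<not> N l \<times> N l \<subseteq> lnk R} \<subseteq> {l \<in> E0. split Y l} \<union> {l \<in> E0. split Z l}"
    unfolding A_def by blast
  then have "card {l \<in> E0. \<not> N l \<times> N l \<subseteq> lnk R} \<le> card ({l \<in> E0. split Y l} \<union> {l \<in> E0. split Z l})"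
    by (intro card_mono) auto
  also have "\<dots> \<le> e0 Y + e0 Z" unfolding e0_def by (rule card_Un_le)
  finally have 1: "card {l \<in> E0. \<not> N l \<times> N l \<subseteq> lnk R} + 2 \<le> 2 * k" using Y Z unfolding weak_def by linarith
  have "card {l \<in> Y3. \<not> N l \<times> N l \<subseteq> lnk R} \<le> card Y3" by (intro card_mono) auto
  then have 2: "card {l \<in> Y3. \<not> N l \<times> N l \<subseteq> lnk R} \<le> 6 * k + 6" using card_Y3_D1 by linarith
  have "(6 * k + 6) * 3 \<le> (6 * k + 6) * ncomp T' R" using 3 by (intro mult_le_mono) auto
  from order_trans[OF this partition_bound[OF RT]] show False using 1 2 by simp
qed

end

section \<open>Tree packing with slack, and routes for coloured triples\<close>

context link_system
begin

text \<open>Two lower bounds for the number of links across a partition into \<open>p\<close>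
  classes: \<open>k * (p - 1)\<close> is what \<open>k\<close> trees require, the other is
  \<open>partition_bound\<close> divided by three, with all of \<open>Y3\<close> counted as split.
  The excess of the second over the first pays for demands.\<close>

definition "gfun p = max (k * (p - 1)) ((2 * k + 2) * (p - 1) - card Y3 div 3)"

lemma gfun_mono: "mono gfun"
proof (rule monoI)
  fix p q :: nat assume "p \<le> q"
  then have "k * (p - 1) \<le> k * (q - 1)" "(2 * k + 2) * (p - 1) \<le> (2 * k + 2) * (q - 1)"
    by (intro mult_le_mono2 diff_le_mono, assumption)+
  then show "gfun p \<le> gfun q" unfolding gfun_def by linarith
qed

text \<open>Up to the shift by one, \<open>gfun\<close> is a maximum of two affine functions;
  truncation is harmless beside \<open>k * x\<close>. For each choice of the function attained at
  \<open>p\<close> and at \<open>q\<close> the claim is linear, since both functions are lower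
  bounds at \<open>a\<close> and \<open>b\<close>.\<close>

lemma gfun_convex:
  assumes "a \<le> p" "a \<le> q" "p + q \<le> a + b"
  shows "gfun p + gfun q \<le> gfun a + gfun b"
proof -
  define w where "w = card Y3 div 3"
  define h where "h x = max (k * x) ((2 * k + 2) * x - w)" for x
  have hl: "k * x \<le> h x" "2 * (k * x) + 2 * x \<le> h x + w" for x unfolding h_def by (simp_all add: algebra_simps)
  have hu: "h x = k * x \<or> h x + w = 2 * (k * x) + 2 * x" for x
    unfolding h_def by (auto simp: algebra_simps max_def)
  have *: "h P + h Q \<le> h A + h B" if PQ: "A \<le> P" "A \<le> Q" "P + Q \<le> A + B" for P Q A B
  proof -
    obtain d where d: "P = A + d" using PQ(1) le_Suc_ex by blast
    obtain d' where d': "Q = A + d'" using PQ(2) le_Suc_ex by blast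
    obtain e where e: "B = A + d + d' + e"
      using PQ(3) le_Suc_ex[of "P + Q" "A + B"] unfolding d d' by auto
    have exp: "k * P = k * A + k * d" "k * Q = k * A + k * d'" "k * B = k * A + k * d + k * d' + k * e"
      unfolding d d' e by (simp_all add: algebra_simps)
    from hu[of P] hu[of Q] show ?thesis
      using hl[of A] hl[of B] exp d d' e by (elim disjE) linarith+
  qed
  have "gfun x = h (x - 1)" for x unfolding gfun_def h_def w_def by simp
  then show ?thesis using *[of "a - 1" "p - 1" "q - 1" "b - 1"] assms by simp
qed

text \<open>A root triple whose root edge has colour 0 can be used by a tree as a link of
  \<open>T'\<close>; a triple in \<open>Ah\<close> is bound to its root colour. \<open>I0\<close> is
  the ground set for the trees.\<close>

definition "U \<phi> = {l \<in> Y3. \<phi> (half l v) = (0::nat)}"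
definition "Ah \<phi> = Y3 - U \<phi>"
definition "I0 \<phi> = E0 \<union> U \<phi>"

lemma finite_sets2 [simp]: "finite (U \<phi>)" "finite (Ah \<phi>)" "finite (I0 \<phi>)"
  unfolding U_def Ah_def I0_def by auto

lemma L_cases: "L = I0 \<phi> \<union> Ah \<phi> \<union> D1" "I0 \<phi> \<inter> Ah \<phi> = {}" "(I0 \<phi> \<union> Ah \<phi>) \<inter> D1 = {}"
  using Lv_split unfolding I0_def Ah_def U_def Y3_def by auto

lemma card_N_I0: "l \<in> I0 \<phi> \<Longrightarrow> card (N l) = 2 \<or> card (N l) = 3"
  using card_ends[of l] N_E0[of l] unfolding I0_def U_def Y3_def E0_def by auto

text \<open>The part of \<open>gfun\<close> with \<open>2 * k + 2\<close> is
  \<open>partition_bound\<close>. With at least three classes, that is \<open>q \<ge> 2\<close>, it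
  also gives \<open>k * q\<close>, because \<open>2 * (k + 1) * (q - 1)\<close> is at least
  \<open>k * q\<close>. Two classes form a bipartition: either it is not weak, or
  \<open>root\<close> supplies the missing links.\<close>

lemma packing_condition:
  assumes root: "\<And>Y. weak Y \<Longrightarrow> k \<le> e0 Y + card {l \<in> Y3. split Y l \<and> \<phi> (half l v) = 0}"
    and A: "A \<subseteq> I0 \<phi>" and T': "T' \<noteq> {}"
  shows "gfun (ncomp T' (rel_of N A)) \<le> card (I0 \<phi> - A)"
proof -
  define R where "R = rel_of N A"
  have RT: "R \<subseteq> T' \<times> T'" unfolding R_def by (rule rel_of_subset) (rule ends_T(2))
  have link: "N l \<times> N l \<subseteq> lnk R" if "l \<in> A" for l
    using that unfolding R_def rel_of_def by (auto intro: lnk_base)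
  obtain q where q: "ncomp T' R = Suc q" using ncomp_pos[of T' R] T' by (metis One_nat_def Suc_le_D finite_sets(8))
  have c1: "card {l \<in> E0. \<not> N l \<times> N l \<subseteq> lnk R} \<le> card (I0 \<phi> - A)"
    using link by (intro card_mono) (auto simp: I0_def)
  have c2: "card {l \<in> Y3. \<not> N l \<times> N l \<subseteq> lnk R} \<le> card Y3" by (intro card_mono) auto
  have main: "6 * (k * q) + 6 * q \<le> 3 * card (I0 \<phi> - A) + card Y3"
    using partition_bound[OF RT] c1 c2 unfolding q by (simp add: algebra_simps)
  then have g2: "(2 * k + 2) * q - card Y3 div 3 \<le> card (I0 \<phi> - A)"
    by (simp add: algebra_simps)
  have "k * q \<le> card (I0 \<phi> - A)"
  proof -
    consider "q = 0" | "q = 1" | d where "q = Suc (Suc d)" by (metis One_nat_def not0_implies_Suc)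
    then show ?thesis
    proof cases
      case 2
      obtain x where x: "x \<in> T'" using T' by blast
      define Y where "Y = lnk R `` {x} \<inter> T'"
      have nonsplit: "\<not> split Y l" if "l \<in> A" for l
      proof
        assume "split Y l"
        then obtain a b where ab: "a \<in> N l" "a \<in> Y" "b \<in> N l" "b \<notin> Y" unfolding split_def by blast
        then have "(a, b) \<in> lnk R" using link[OF that] by blast
        moreover have "b \<in> T'" using ab(3) ends_T(2) by blast
        ultimately show False using ab lnk_trans[of x a R b] unfolding Y_def by simp
      qed
      have "Y \<noteq> T'"
      proof
        assume "Y = T'"
        then have "\<And>y. y \<in> T' \<Longrightarrow> lnk R `` {y} = lnk R `` {x}"
          unfolding Y_def lnk_class_eq using lnk_sym[of x _ R] by blast
        then have "(\<lambda>x. lnk R `` {x}) ` T' \<subseteq> {lnk R `` {x}}" by blast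
        then have "ncomp T' R \<le> card {lnk R `` {x}}" unfolding ncomp_def by (intro card_mono) auto
        then have "ncomp T' R \<le> 1" by simp
        then show False using q 2 by simp
      qed
      moreover have "x \<in> Y" "Y \<subseteq> T'" using x unfolding Y_def by auto
      ultimately have Y: "Y \<subseteq> T'" "Y \<noteq> {}" "Y \<noteq> T'" by auto
      have "k \<le> e0 Y + card {l \<in> U \<phi>. split Y l}"
      proof (cases "weak Y")
        case True
        have "{l \<in> U \<phi>. split Y l} = {l \<in> Y3. split Y l \<and> \<phi> (half l v) = 0}" unfolding U_def by auto
        then show ?thesis using root[OF True] by simp
      qed (use Y in \<open>simp add: weak_def\<close>)
      also have "\<dots> = card ({l \<in> E0. split Y l} \<union> {l \<in> U \<phi>. split Y l})"
        unfolding e0_def using Lv_split(4) by (intro card_Un_disjoint[symmetric]) (auto simp: U_def Y3_def)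
      also have "\<dots> \<le> card (I0 \<phi> - A)"
        using nonsplit by (intro card_mono) (auto simp: I0_def)
      finally show ?thesis using 2 by simp
    next
      case 3
      have "card Y3 \<le> 6 * k + 6" using card_Y3_D1 by simp
      then show ?thesis using main unfolding 3 by (simp add: algebra_simps)
    qed simp
  qed
  then show ?thesis using g2 unfolding gfun_def R_def[symmetric] q by simp
qed

text \<open>A coloured triple hands its colour to one of its two other ends and thereby releases the
  half-edge at the other. A bad half-edge is sacrificed if there is one; the remaining triples are
  oriented evenly, so that at each terminal the good half-edges spent exceed the released ones by at
  most one.\<close>

lemma balanced_routes:
  "\<exists>route. (\<forall>l\<in>Ah \<phi>. route l \<in> N l) \<and> (\<forall>t. card {l \<in> Ah \<phi>. route l = t \<and> half l t \<in> good} \<le>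
     card {l \<in> Ah \<phi>. t \<in> N l \<and> route l \<noteq> t \<and> half l t \<in> good} + 1)"
proof -
  have "\<exists>p. fst p \<noteq> snd p \<and> N l = {fst p, snd p}" if "l \<in> Ah \<phi>" for l
    using that unfolding Ah_def Y3_def by (auto simp: card_2_iff)
  then obtain ab where ab: "\<And>l. l \<in> Ah \<phi> \<Longrightarrow> fst (ab l) \<noteq> snd (ab l) \<and> N l = {fst (ab l), snd (ab l)}"
    by metis
  define G where "G = {l \<in> Ah \<phi>. \<forall>t\<in>N l. half l t \<in> good}"
  obtain p where p: "\<forall>l\<in>G. p l = ab l \<or> p l = prod.swap (ab l)"
    and bal: "\<And>t. card {l\<in>G. fst (p l) = t} \<le> card {l\<in>G. snd (p l) = t} + 1"
    using balanced_orientation[of G ab] unfolding G_def by auto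
  have pN: "N l = {fst (p l), snd (p l)}" "fst (p l) \<noteq> snd (p l)" if lG: "l \<in> G" for l
  proof -
    have "l \<in> Ah \<phi>" using that unfolding G_def by simp
    note abl = ab[OF this]
    show "N l = {fst (p l), snd (p l)}" "fst (p l) \<noteq> snd (p l)"
    proof -
      consider "p l = ab l" | "p l = prod.swap (ab l)" using bspec[OF p lG] by blast
      then have "N l = {fst (p l), snd (p l)} \<and> fst (p l) \<noteq> snd (p l)"
      proof cases
        case 1
        then show ?thesis using abl by metis
      next
        case 2
        then have "fst (p l) = snd (ab l)" "snd (p l) = fst (ab l)" by simp_all
        then show ?thesis using abl by (metis insert_commute)
      qed
      then show "N l = {fst (p l), snd (p l)}" "fst (p l) \<noteq> snd (p l)" by blast+
    qed
  qed
  define route where "route l = (if l \<in> G then fst (p l) else SOME t. t \<in> N l \<and> half l t \<notin> good)" for l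
  have bad: "route l \<in> N l \<and> half l (route l) \<notin> good" if "l \<in> Ah \<phi>" "l \<notin> G" for l
  proof -
    have "\<exists>t. t \<in> N l \<and> half l t \<notin> good" using that unfolding G_def by blast
    from someI_ex[OF this] show ?thesis using that unfolding route_def by simp
  qed
  have "route l \<in> N l" if "l \<in> Ah \<phi>" for l
  proof (cases "l \<in> G")
    case True
    then have "route l = fst (p l)" unfolding route_def by simp
    then show ?thesis using pN(1)[OF True] by blast
  qed (use bad[OF that] in blast)
  moreover have "card {l \<in> Ah \<phi>. route l = t \<and> half l t \<in> good} \<le>
     card {l \<in> Ah \<phi>. t \<in> N l \<and> route l \<noteq> t \<and> half l t \<in> good} + 1" for t
  proof -
    have "{l \<in> Ah \<phi>. route l = t \<and> half l t \<in> good} \<subseteq> {l\<in>G. fst (p l) = t}"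
    proof
      fix l assume l: "l \<in> {l \<in> Ah \<phi>. route l = t \<and> half l t \<in> good}"
      then have "l \<in> G" using bad[of l] by auto
      moreover have "fst (p l) = t" using l calculation by (simp add: route_def)
      ultimately show "l \<in> {l\<in>G. fst (p l) = t}" by simp
    qed
    then have "card {l \<in> Ah \<phi>. route l = t \<and> half l t \<in> good} \<le> card {l\<in>G. fst (p l) = t}"
      by (intro card_mono) (auto simp: G_def)
    also have "\<dots> \<le> card {l\<in>G. snd (p l) = t} + 1" by (rule bal)
    also have "card {l\<in>G. snd (p l) = t} \<le> card {l \<in> Ah \<phi>. t \<in> N l \<and> route l \<noteq> t \<and> half l t \<in> good}"
    proof (rule card_mono)
      show "{l\<in>G. snd (p l) = t} \<subseteq> {l \<in> Ah \<phi>. t \<in> N l \<and> route l \<noteq> t \<and> half l t \<in> good}"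
      proof
        fix l assume l: "l \<in> {l \<in> G. snd (p l) = t}"
        then have lG: "l \<in> G" "snd (p l) = t" by auto
        then have "t \<in> N l" using pN(1)[OF lG(1)] by blast
        moreover have "route l \<noteq> t" using pN(2)[OF lG(1)] lG unfolding route_def by simp
        ultimately have "t \<in> N l" "route l \<noteq> t" by blast+
        then show "l \<in> {l \<in> Ah \<phi>. t \<in> N l \<and> route l \<noteq> t \<and> half l t \<in> good}" using lG unfolding G_def by blast
      qed
    qed simp
    finally show ?thesis by simp
  qed
  ultimately show ?thesis by blast
qed

text \<open>Direct links disappear from the cut around \<open>{v, t}\<close> and are counted at both
  of its vertices. With \<open>n\<close> of them the cut has at most
  \<open>2 * (6 * k + 6) - 2 * n\<close> links, and at least \<open>6 * k + 6\<close> because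
  \<open>T'\<close> contains a further terminal.\<close>

lemma direct_bound:
  assumes t: "t \<in> T'" "T' \<noteq> {t}" "card {h \<in> H. loc h = t} = 6 * k + 6"
  shows "card {l \<in> D1. t \<in> N l} \<le> 3 * k + 3"
proof -
  define Lt where "Lt = {l \<in> L. t \<in> ends_of l}"
  have "Lt = lk ` {h \<in> H. loc h = t}"
  proof
    show "Lt \<subseteq> lk ` {h \<in> H. loc h = t}"
    proof
      fix l assume "l \<in> Lt"
      then have "half l t \<in> {h \<in> H. loc h = t}" "lk (half l t) = l" using half[of t l] unfolding Lt_def by auto
      then show "l \<in> lk ` {h \<in> H. loc h = t}" by (metis imageI)
    qed
  qed (auto simp: Lt_def L_def ends_of_def)
  then have cLt: "card Lt \<le> 6 * k + 6" using card_image_le[of "{h \<in> H. loc h = t}" lk] t(3) by simp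
  define Dt where "Dt = {l \<in> D1. t \<in> N l}"
  have Dt: "Dt \<subseteq> Lv \<inter> Lt" unfolding Dt_def D1_def Lv_def Lt_def N_def by auto
  have fin: "finite Lt" "finite Dt" unfolding Lt_def Dt_def by auto
  have "{v, t} \<subseteq> T" "{v, t} \<noteq> T" using t vT unfolding T'_def by auto
  then have "6 * k + 6 \<le> card (link_cut H loc lk {v, t})" by (intro cut) auto
  also have "\<dots> \<le> card (Lv \<union> Lt - Dt)"
  proof (rule card_mono)
    show "link_cut H loc lk {v, t} \<subseteq> Lv \<union> Lt - Dt"
    proof
      fix l assume l: "l \<in> link_cut H loc lk {v, t}"
      have "l \<notin> Dt"
      proof
        assume "l \<in> Dt"
        then have "N l = {t}" unfolding Dt_def D1_def by (auto simp: card_1_singleton_iff)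
        then show False using l unfolding link_cut_eq N_def by auto
      qed
      then show "l \<in> Lv \<union> Lt - Dt" using l unfolding link_cut_eq Lv_def Lt_def by auto
    qed
  qed (use fin in simp)
  also have "\<dots> = card (Lv \<union> Lt) - card Dt" using Dt fin by (intro card_Diff_subset) auto
  finally have 1: "6 * k + 6 \<le> card (Lv \<union> Lt) - card Dt" .
  have "card (Lv \<union> Lt) + card (Lv \<inter> Lt) = card Lv + card Lt" using card_Un_Int[of Lv Lt] fin by simp
  moreover have "card Dt \<le> card (Lv \<inter> Lt)" using Dt fin by (intro card_mono) auto
  ultimately show ?thesis using 1 cLt card_Lv unfolding Dt_def[symmetric] by linarith
qed

end

lemma min_card_submodular:
  assumes "finite G"
  shows "min D (card ((A \<union> B) \<inter> G)) + min D (card ((A \<inter> B) \<inter> G)) \<le> min D (card (A \<inter> G)) + min D (card (B \<inter> G))"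
proof -
  have "card (A \<inter> G) + card (B \<inter> G) = card ((A \<union> B) \<inter> G) + card ((A \<inter> B) \<inter> G)"
  proof -
    have "(A \<union> B) \<inter> G = (A \<inter> G) \<union> (B \<inter> G)" "(A \<inter> B) \<inter> G = (A \<inter> G) \<inter> (B \<inter> G)" by auto
    then show ?thesis using card_Un_Int[of "A \<inter> G" "B \<inter> G"] assms by simp
  qed
  moreover have "card ((A \<inter> B) \<inter> G) \<le> card (A \<inter> G)" "card ((A \<inter> B) \<inter> G) \<le> card (B \<inter> G)"
    using assms by (auto intro!: card_mono)
  ultimately show ?thesis by (simp add: min_def)
qed

section \<open>Matroid union applied to a coloured root\<close>

context link_system
begin

text \<open>The inequality has the shape that \<open>weak_root_set\<close> produces for the root, so
  that a root condition can be imposed as a demand elsewhere.\<close>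

definition "valid_demand good r \<longleftrightarrow> (\<forall>t\<in>T'. r t = 0 \<or>
  (card {h \<in> H. loc h = t} = 6 * k + 6 \<and> 2 * r t + card {h \<in> H. loc h = t \<and> h \<notin> good} \<le> 2 * k))"

text \<open>Half-edges at the root are left out, since a colour has to connect \<open>T'\<close>
  without passing through \<open>v\<close>.\<close>

definition "joined \<psi> i = {(loc h, loc h') | h h'. h \<in> H \<and> h' \<in> H \<and> lk h = lk h' \<and>
  \<psi> h = (i::nat) \<and> \<psi> h' = i \<and> loc h \<noteq> v \<and> loc h' \<noteq> v}"

text \<open>A link carries at most one colour, and exactly two of its half-edges carry it: even a
  triple is used as a pair.\<close>

definition "extends \<phi> good r \<psi> \<longleftrightarrow> (\<forall>h\<in>H. \<psi> h \<le> k) \<and> (\<forall>h\<in>H. loc h = v \<longrightarrow> \<psi> h = \<phi> h) \<and>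
  (\<forall>l\<in>L. (\<forall>h\<in>H. lk h = l \<longrightarrow> \<psi> h = 0) \<or> (\<exists>h1\<in>H. \<exists>h2\<in>H. h1 \<noteq> h2 \<and> lk h1 = l \<and> lk h2 = l \<and>
     \<psi> h1 \<noteq> 0 \<and> \<psi> h1 = \<psi> h2 \<and> (\<forall>h\<in>H. lk h = l \<and> h \<noteq> h1 \<and> h \<noteq> h2 \<longrightarrow> \<psi> h = 0))) \<and>
  (\<forall>i\<in>{1..k}. \<forall>s\<in>T'. \<forall>t\<in>T'. (s, t) \<in> lnk (joined \<psi> i)) \<and>
  (\<forall>t\<in>T'. r t \<le> card {h \<in> H. loc h = t \<and> h \<in> good \<and> \<psi> h = (0::nat)})"

text \<open>The arithmetic of the doubled packing condition: \<open>\<sigma>\<close> counts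
  terminals with unmet demand, \<open>c\<close> classes, \<open>a\<close> direct links at those
  terminals, and \<open>4 * k + 5\<close> is the surplus \<open>count\<close> of
  \<open>extension_core\<close>. The critical case is \<open>\<sigma> = 1\<close>: there
  \<open>a \<le> 3 * k + 3\<close> and \<open>a + card Y3 \<le> 6 * k + 6\<close> give
  \<open>a + card Y3 div 3 \<le> 4 * k + 4\<close>, one less than what is available.\<close>

lemma packing_inequality:
  fixes \<sigma> c a :: nat
  assumes "\<sigma> \<ge> 1" "c \<ge> 1" and a1: "a \<le> card D1" and a2: "\<sigma> = 1 \<Longrightarrow> a \<le> 3 * k + 3"
  shows "2 * (k * (c - 1)) + a \<le> (4 * k + 5) * \<sigma> + gfun (max 1 (c + 1 - \<sigma>))"
proof -
  have Z: "a + card Y3 div 3 \<le> (2 * k + 5) * \<sigma> + 2 * k"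
  proof (cases "\<sigma> = 1")
    case True
    then show ?thesis using a1 a2 card_Y3_D1 by simp
  next
    case False
    then have "(2 * k + 5) * 2 \<le> (2 * k + 5) * \<sigma>" using assms(1) by (intro mult_le_mono2) simp
    moreover have "card Y3 div 3 \<le> card Y3" by simp
    ultimately have "a + card Y3 div 3 \<le> 6 * k + 6" using a1 card_Y3_D1 by linarith
    moreover have "6 * k + 6 \<le> (2 * k + 5) * 2 + 2 * k" by simp
    ultimately have "a + card Y3 div 3 \<le> (2 * k + 5) * 2 + 2 * k" by (rule le_trans)
    then show ?thesis using \<open>(2 * k + 5) * 2 \<le> (2 * k + 5) * \<sigma>\<close> by (meson add_le_mono1 le_trans)
  qed
  show ?thesis
  proof (cases "c \<ge> \<sigma>")
    case True
    then obtain q where q: "c = \<sigma> + q" using le_Suc_ex by blast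
    obtain s where s: "\<sigma> = Suc s" using assms(1) by (metis One_nat_def Suc_le_D)
    have "max 1 (c + 1 - \<sigma>) = q + 1" using q by simp
    then have "(2 * k + 2) * q \<le> gfun (max 1 (c + 1 - \<sigma>)) + card Y3 div 3" unfolding gfun_def by simp
    then show ?thesis using Z unfolding q s by (simp add: algebra_simps)
  next
    case False
    then have "k * (c - 1) \<le> k * (\<sigma> - 1)" by (intro mult_le_mono2) simp
    moreover obtain s where s: "\<sigma> = Suc s" using assms(1) by (metis One_nat_def Suc_le_D)
    ultimately show ?thesis using Z unfolding s by (simp add: algebra_simps)
  qed
qed

lemma extension_core:
  assumes \<phi>: "\<And>h. \<phi> h \<le> k"
    and root: "\<And>Y. weak Y \<Longrightarrow> k \<le> e0 Y + card {l \<in> Y3. split Y l \<and> \<phi> (half l v) = 0}"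
    and two: "2 \<le> card T'" and dem: "valid_demand good r"
  shows "\<exists>\<psi>. extends \<phi> good r \<psi>"
proof -
  let ?I = "I0 \<phi>" and ?n = "card T'"
  have ne: "T' \<noteq> {}" using two by auto
  obtain N' where N': "\<And>l. l \<in> ?I \<Longrightarrow> N' l \<subseteq> N l \<and> card (N' l) = 2"
    and condN': "\<And>A. A \<subseteq> ?I \<Longrightarrow> gfun (ncomp T' (rel_of N' A)) \<le> card (?I - A)"
  proof -
    have "\<exists>N'. (\<forall>i\<in>?I. N' i \<subseteq> N i \<and> card (N' i) = 2) \<and>
      (\<forall>A\<subseteq>?I. gfun (ncomp T' (rel_of N' A)) \<le> card (?I - A))"
    proof (rule trim_triples)
      show "gfun p + gfun q \<le> gfun a + gfun b" if "a \<le> p" "a \<le> q" "p + q \<le> a + b" for a p q b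
        using that by (rule gfun_convex)
      show "N i \<subseteq> T' \<and> (card (N i) = 2 \<or> card (N i) = 3)" if "i \<in> ?I" for i
        using card_N_I0[OF that] ends_T(2) by simp
      show "gfun (ncomp T' (rel_of N A)) \<le> card (?I - A)" if "A \<subseteq> ?I" for A
        using packing_condition[OF root that ne] .
    qed simp_all
    then show thesis using that by blast
  qed
  have N'T: "N' l \<subseteq> T'" if "l \<in> ?I" for l using N'[OF that] ends_T(2) by blast
  obtain route where route: "\<And>l. l \<in> Ah \<phi> \<Longrightarrow> route l \<in> N l"
    and bal: "\<And>t. card {l \<in> Ah \<phi>. route l = t \<and> half l t \<in> good} \<le>
     card {l \<in> Ah \<phi>. t \<in> N l \<and> route l \<noteq> t \<and> half l t \<in> good} + 1"
    using balanced_routes[of \<phi> good] by blast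
  \<comment> \<open>Good half-edges at \<open>t\<close> that stay uncoloured anyway: the vertex
    trimmed off a triple, the end of a coloured triple not chosen by its route, the end of a direct
    link with uncoloured root edge. Only the excess \<open>D t\<close> of the demand must be met by
    reserving links of \<open>Gg t\<close>, which are then lost to the trees.\<close>
  define Rel where "Rel t = {l \<in> L. t \<in> N l \<and> half l t \<in> good \<and>
    ((l \<in> ?I \<and> t \<notin> N' l) \<or> (l \<in> Ah \<phi> \<and> route l \<noteq> t) \<or> (l \<in> D1 \<and> \<phi> (half l v) = 0))}" for t
  define Gg where "Gg t = {l \<in> ?I. t \<in> N' l \<and> half l t \<in> good}" for t
  define ad where "ad t = {l \<in> D1. t \<in> N l}" for t
  define D where "D t = r t - card (Rel t)" for t
  have fin': "finite (Rel t)" "finite (Gg t)" "finite (ad t)" for t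
    unfolding Rel_def Gg_def ad_def by auto
  \<comment> \<open>\<open>4 * k + 5\<close> is \<open>(6 * k + 6) - 2 * k - 1\<close>. The good
    half-edges at \<open>t\<close> lie in \<open>Gg t\<close>, \<open>Rel t\<close> or
    \<open>ad t\<close> or are spent by routes, at most \<open>card (Rel t) + 1\<close> of them in
    the last way. The term \<open>2 * card (Rel t)\<close> is absorbed by
    \<open>r t = D t + card (Rel t)\<close> in the demand inequality.\<close>
  have count: "2 * D t + 4 * k + 5 \<le> card (Gg t) + card (ad t)" if t: "t \<in> T'" "D t > 0" for t
  proof -
    define Rt where "Rt = {l \<in> Ah \<phi>. route l = t \<and> half l t \<in> good}"
    have tv: "t \<noteq> v" using t unfolding T'_def by auto
    have d: "card {h \<in> H. loc h = t} = 6 * k + 6" "2 * r t + card {h \<in> H. loc h = t \<and> h \<notin> good} \<le> 2 * k"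
      using dem t unfolding valid_demand_def D_def by auto
    have "{h \<in> H. loc h = t \<and> h \<in> good} \<subseteq> (\<lambda>l. half l t) ` (Gg t \<union> Rel t \<union> Rt \<union> ad t)"
    proof
      fix h assume h: "h \<in> {h \<in> H. loc h = t \<and> h \<in> good}"
      define l where "l = lk h"
      have hl: "half l t = h" "l \<in> L" "t \<in> N l"
        using h half_eq[of h] loc_ends[of h] tv unfolding l_def N_def by auto
      have "l \<in> Gg t \<union> Rel t \<union> Rt \<union> ad t"
        using hl h L_cases(1)[of \<phi>] unfolding Gg_def Rel_def Rt_def ad_def by auto
      then show "h \<in> (\<lambda>l. half l t) ` (Gg t \<union> Rel t \<union> Rt \<union> ad t)" using hl(1) by force
    qed
    then have "card {h \<in> H. loc h = t \<and> h \<in> good} \<le> card (Gg t \<union> Rel t \<union> Rt \<union> ad t)"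
      by (rule surj_card_le[rotated]) (use fin' in \<open>simp add: Rt_def\<close>)
    also have "\<dots> \<le> card (Gg t) + card (Rel t) + card Rt + card (ad t)"
      by (meson add_le_mono card_Un_le le_refl le_trans)
    also have "card Rt \<le> card (Rel t) + 1"
    proof -
      have "{l \<in> Ah \<phi>. t \<in> N l \<and> route l \<noteq> t \<and> half l t \<in> good} \<subseteq> Rel t"
        using L_cases(1)[of \<phi>] unfolding Rel_def by auto
      then have "card {l \<in> Ah \<phi>. t \<in> N l \<and> route l \<noteq> t \<and> half l t \<in> good} \<le> card (Rel t)"
        using fin' by (intro card_mono) auto
      then show ?thesis using bal[of t] unfolding Rt_def by linarith
    qed
    finally have 1: "card {h \<in> H. loc h = t \<and> h \<in> good} \<le> card (Gg t) + 2 * card (Rel t) + 1 + card (ad t)" by simp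
    have "card {h \<in> H. loc h = t} = card {h \<in> H. loc h = t \<and> h \<in> good} + card {h \<in> H. loc h = t \<and> h \<notin> good}"
      by (subst card_Un_disjoint[symmetric]) (auto intro: arg_cong[where f = card])
    then show ?thesis using d 1 t(2) unfolding D_def by linarith
  qed
  define J where "J = Inl ` {..<k} \<union> (Inr ` T' :: (nat + 'v) set)"
  define rk where "rk j A = (case j of Inl (i::nat) \<Rightarrow> ?n - ncomp T' (rel_of N' (A \<inter> ?I)) | Inr t \<Rightarrow> min (D t) (card (A \<inter> Gg t)))" for j A
  define \<rho> where "\<rho> j = (case j of Inl (i::nat) \<Rightarrow> ?n - 1 | Inr t \<Rightarrow> D t)" for j
  have nc: "1 \<le> ncomp T' R" "ncomp T' R \<le> ?n" for R
    using ncomp_pos[of T' R] ncomp_le[of T' R] ne by auto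
  have sumJ: "(\<Sum>j\<in>J. f j) = (\<Sum>i<k. f (Inl i)) + (\<Sum>t\<in>T'. f (Inr t))" for f :: "nat + 'v \<Rightarrow> nat"
    unfolding J_def by (subst sum.union_disjoint) (auto simp: sum.reindex)
  have "\<exists>F'. (\<forall>j\<in>J. {} \<subseteq> F' j \<and> F' j \<subseteq> {} \<union> ?I \<and> rk j (F' j) = \<rho> j) \<and>
              (\<forall>i\<in>J. \<forall>j\<in>J. i \<noteq> j \<longrightarrow> (F' i - {}) \<inter> (F' j - {}) = {})"
  proof (rule disjoint_bases)
    show "finite J" "finite ?I" unfolding J_def by auto
    fix j A B assume "j \<in> J"
    show "rk j (A \<union> B) + rk j (A \<inter> B) \<le> rk j A + rk j B"
    proof (cases j)
      case (Inl i)
      have "ncomp T' (rel_of N' (A \<inter> ?I)) + ncomp T' (rel_of N' (B \<inter> ?I)) \<le>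
        ncomp T' (rel_of N' ((A \<union> B) \<inter> ?I)) + ncomp T' (rel_of N' ((A \<inter> B) \<inter> ?I))"
      proof -
        have "(A \<union> B) \<inter> ?I = (A \<inter> ?I) \<union> (B \<inter> ?I)" "(A \<inter> B) \<inter> ?I = (A \<inter> ?I) \<inter> (B \<inter> ?I)" by auto
        moreover have "N' i \<subseteq> T'" if "i \<in> (A \<inter> ?I) \<union> (B \<inter> ?I)" for i using that N'T by blast
        ultimately show ?thesis
          using ncomp_rel_of_submodular[OF finite_sets(8), of "A \<inter> ?I" "B \<inter> ?I" N'] by presburger
      qed
      then show ?thesis unfolding Inl rk_def
        using nc(2)[of "rel_of N' (A \<inter> ?I)"] nc(2)[of "rel_of N' (B \<inter> ?I)"] 
         nc(2)[of "rel_of N' ((A \<union> B) \<inter> ?I)"] nc(2)[of "rel_of N' ((A \<inter> B) \<inter> ?I)"] by simp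
    next
      case (Inr t)
      then show ?thesis unfolding rk_def using min_card_submodular[OF fin'(2)] by simp
    qed
  next
    fix j and A B :: "'l set" assume "j \<in> J" "A \<subseteq> B"
    show "rk j A \<le> rk j B"
    proof (cases j)
      case (Inl i)
      have "ncomp T' (rel_of N' (B \<inter> ?I)) \<le> ncomp T' (rel_of N' (A \<inter> ?I))"
        using \<open>A \<subseteq> B\<close> N'T by (intro ncomp_antimono rel_of_mono rel_of_subset) auto
      then show ?thesis unfolding Inl rk_def by simp
    next
      case (Inr t)
      have "card (A \<inter> Gg t) \<le> card (B \<inter> Gg t)" using \<open>A \<subseteq> B\<close> fin' by (intro card_mono) auto
      then show ?thesis unfolding Inr rk_def by simp
    qed
  next
    fix j and A :: "'l set" assume "j \<in> J"
    show "rk j A \<le> \<rho> j"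
      using nc(1) unfolding rk_def \<rho>_def by (auto split: sum.split intro: diff_le_mono2)
  next
    fix A assume A: "A \<subseteq> ?I"
    define c where "c = ncomp T' (rel_of N' A)"
    have c: "1 \<le> c" "c \<le> ?n" unfolding c_def using nc by auto
    define S where "S = {t \<in> T'. card (A \<inter> Gg t) < D t}"
    have S: "S \<subseteq> T'" "finite S" unfolding S_def by auto
    have AI: "A \<inter> ?I = A" using A by blast
    \<comment> \<open>Terminals outside \<open>S\<close> have their uniform rank saturated by
      \<open>A\<close>, so this is what remains of the matroid union condition. It is proved in
      doubled form, because \<open>b\<close> lets a link outside \<open>A\<close> count for demands
      at both of its ends.\<close>
    have key: "k * (c - 1) + (\<Sum>t\<in>S. D t) \<le> card (?I - A) + (\<Sum>t\<in>S. card (A \<inter> Gg t))"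
    proof (cases "S = {}")
      case True
      have "k * (c - 1) \<le> gfun c" unfolding gfun_def by simp
      then show ?thesis using condN'[OF A] True unfolding c_def by simp
    next
      case False
      have b: "(\<Sum>t\<in>S. card (Gg t - A)) + gfun (max 1 (c + 1 - card S)) \<le> 2 * card (?I - A)"
        unfolding c_def
        by (rule double_cover_bound) (use N' N'T condN' gfun_mono S A False in \<open>auto simp: Gg_def\<close>)
      have "(\<Sum>t\<in>S. 2 * D t + (4 * k + 5)) \<le> (\<Sum>t\<in>S. card (Gg t) + card (ad t))"
        using count S unfolding S_def by (intro sum_mono) fastforce
      then have s1: "2 * (\<Sum>t\<in>S. D t) + (4 * k + 5) * card S \<le> (\<Sum>t\<in>S. card (Gg t)) + (\<Sum>t\<in>S. card (ad t))"
        by (simp add: sum.distrib sum_distrib_right mult.commute)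
      have "card (Gg t) = card (Gg t - A) + card (A \<inter> Gg t)" for t
        using card_Diff_subset_Int[of "Gg t" A] card_mono[of "Gg t" "Gg t \<inter> A"] fin'(2)[of t] 
        by (simp add: Int_commute)
      then have s2: "(\<Sum>t\<in>S. card (Gg t)) = (\<Sum>t\<in>S. card (Gg t - A)) + (\<Sum>t\<in>S. card (A \<inter> Gg t))"
        by (simp add: sum.distrib)
      have ads: "(\<Sum>t\<in>S. card (ad t)) = card (\<Union>t\<in>S. ad t)"
      proof (rule card_UN_disjoint[symmetric])
        show "\<forall>s\<in>S. \<forall>t\<in>S. s \<noteq> t \<longrightarrow> ad s \<inter> ad t = {}"
          unfolding ad_def D1_def by (auto simp: card_1_singleton_iff)
      qed (use S fin' in auto)
      have "2 * (k * (c - 1)) + (\<Sum>t\<in>S. card (ad t)) \<le> (4 * k + 5) * card S + gfun (max 1 (c + 1 - card S))"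
      proof (rule packing_inequality)
        show "1 \<le> card S" using False S by (simp add: Suc_leI card_gt_0_iff)
        show "1 \<le> c" by (rule c)
        show "(\<Sum>t\<in>S. card (ad t)) \<le> card D1"
          unfolding ads by (rule card_mono) (auto simp: ad_def)
        assume "card S = 1"
        then obtain t where t: "S = {t}" by (auto simp: card_1_singleton_iff)
        then have "t \<in> T'" "D t > 0" unfolding S_def by auto
        moreover have "T' \<noteq> {t}" using two by auto
        moreover have "card {h \<in> H. loc h = t} = 6 * k + 6"
          using dem calculation unfolding valid_demand_def D_def by fastforce
        ultimately show "(\<Sum>t\<in>S. card (ad t)) \<le> 3 * k + 3"
          using direct_bound unfolding t ad_def by simp
      qed
      then show ?thesis using b s1 s2 by linarith
    qed
    have "(\<Sum>t\<in>T'. D t) + (\<Sum>t\<in>S. card (A \<inter> Gg t)) = (\<Sum>t\<in>T'. min (D t) (card (A \<inter> Gg t))) + (\<Sum>t\<in>S. D t)"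
    proof -
      have "(\<Sum>t\<in>T'. f t) = (\<Sum>t\<in>S. f t) + (\<Sum>t\<in>T' - S. f t)" for f :: "'v \<Rightarrow> nat"
        using sum.subset_diff[OF S(1)] by (simp add: add.commute)
      moreover have "(\<Sum>t\<in>S. min (D t) (card (A \<inter> Gg t))) = (\<Sum>t\<in>S. card (A \<inter> Gg t))"
        unfolding S_def by (intro sum.cong) auto
      moreover have "(\<Sum>t\<in>T' - S. min (D t) (card (A \<inter> Gg t))) = (\<Sum>t\<in>T' - S. D t)"
        unfolding S_def by (intro sum.cong) auto
      ultimately show ?thesis by simp
    qed
    moreover have "k * (?n - 1) = k * (?n - c) + k * (c - 1)"
      using c by (simp add: add_mult_distrib2[symmetric])
    ultimately show "(\<Sum>j\<in>J. \<rho> j) \<le> card (?I - A) + (\<Sum>j\<in>J. rk j (A \<union> {}))"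
      using key unfolding sumJ by (simp add: rk_def \<rho>_def AI c_def[symmetric])
  qed
  then obtain F where F0: "\<forall>j\<in>J. {} \<subseteq> F j \<and> F j \<subseteq> {} \<union> ?I \<and> rk j (F j) = \<rho> j"
    "\<forall>i\<in>J. \<forall>j\<in>J. i \<noteq> j \<longrightarrow> (F i - {}) \<inter> (F j - {}) = {}" by blast
  have F: "\<And>j. j \<in> J \<Longrightarrow> F j \<subseteq> ?I \<and> rk j (F j) = \<rho> j"
    and disj: "\<And>i j. i \<in> J \<Longrightarrow> j \<in> J \<Longrightarrow> i \<noteq> j \<Longrightarrow> F i \<inter> F j = {}" using F0 by simp_all
  have JI: "Inl i \<in> J" if "i < k" for i using that unfolding J_def by auto
  have JT: "Inr t \<in> J" if "t \<in> T'" for t using that unfolding J_def by auto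
  define col where "col l = (if \<exists>i<k. l \<in> F (Inl i) then Suc (SOME i. i < k \<and> l \<in> F (Inl i)) else 0)" for l
  have col: "col l = Suc i" if i: "i < k" "l \<in> F (Inl i)" for i l
  proof -
    have ex: "\<exists>i. i < k \<and> l \<in> F (Inl i)" using i by blast
    define i' where "i' = (SOME i. i < k \<and> l \<in> F (Inl i))"
    have "i' < k" "l \<in> F (Inl i')" using someI_ex[OF ex] unfolding i'_def by auto
    then have "i' = i" using disj[OF JI JI, of i' i] i by auto
    then have "(SOME i. i < k \<and> l \<in> F (Inl i)) = i" unfolding i'_def .
    then show ?thesis using ex unfolding col_def by simp
  qed
  have col_le: "col l \<le> k" for l
  proof (cases "\<exists>i<k. l \<in> F (Inl i)")
    case True
    then show ?thesis using col by fastforce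
  next
    case False
    then have "col l = 0" unfolding col_def by auto
    then show ?thesis by simp
  qed
  \<comment> \<open>A coloured triple passes the root colour to its route and a direct link to its
    other end. All remaining links colour the two vertices kept by the trimming.\<close>
  define \<psi> where "\<psi> h = (if loc h = v then \<phi> h else if lk h \<in> Ah \<phi> then (if loc h = route (lk h) then \<phi> (half (lk h) v) else 0)
    else if lk h \<in> D1 then \<phi> (half (lk h) v) else if loc h \<in> N' (lk h) then col (lk h) else 0)" for h
  have vN: "v \<notin> N l" for l unfolding N_def by simp
  have Lv_v: "v \<in> ends_of l" if "l \<in> Y3 \<or> l \<in> D1" for l using that unfolding Y3_def D1_def Lv_def by auto
  have links: "(\<forall>h\<in>H. lk h = l \<longrightarrow> \<psi> h = 0) \<or> (\<exists>h1\<in>H. \<exists>h2\<in>H. h1 \<noteq> h2 \<and> lk h1 = l \<and> lk h2 = l \<and>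
     \<psi> h1 \<noteq> 0 \<and> \<psi> h1 = \<psi> h2 \<and> (\<forall>h\<in>H. lk h = l \<and> h \<noteq> h1 \<and> h \<noteq> h2 \<longrightarrow> \<psi> h = 0))" (is "?zero \<or> ?pair") if l: "l \<in> L" for l
  proof -
    have eq: "h = half l (loc h)" if "h \<in> H" "lk h = l" for h using half_eq that by metis
    have pairI: ?pair if "x \<in> ends_of l" "y \<in> ends_of l" "x \<noteq> y" "\<psi> (half l x) \<noteq> 0" "\<psi> (half l x) = \<psi> (half l y)"
      "\<And>h. h \<in> H \<Longrightarrow> lk h = l \<Longrightarrow> loc h \<noteq> x \<Longrightarrow> loc h \<noteq> y \<Longrightarrow> \<psi> h = 0" for x y
    proof -
      note z = that(6)
      have ne: "half l x \<noteq> half l y" using half(3)[OF that(1)] half(3)[OF that(2)] that(3) by metis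
      have "\<forall>h\<in>H. lk h = l \<and> h \<noteq> half l x \<and> h \<noteq> half l y \<longrightarrow> \<psi> h = 0"
        using eq z by metis
      then show ?pair using ne half[OF that(1)] half[OF that(2)] that(4,5) by blast
    qed
    consider "l \<in> ?I" | "l \<in> Ah \<phi>" | "l \<in> D1" using l L_cases(1)[of \<phi>] by blast
    then show ?thesis
    proof cases
      case 1
      then have nl: "l \<notin> Ah \<phi>" "l \<notin> D1" using L_cases(2,3)[of \<phi>] by auto
      have v0: "\<phi> h = 0" if "h \<in> H" "lk h = l" "loc h = v" for h
      proof -
        have "v \<in> ends_of l" "l \<in> L" using loc_ends[of h] that by auto
        then have "l \<in> U \<phi>" using 1 unfolding I0_def E0_def Lv_def by auto
        then show ?thesis using eq[OF that(1,2)] that(3) unfolding U_def by simp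
      qed
      have out: "\<psi> h = 0" if "h \<in> H" "lk h = l" "loc h \<notin> N' l \<or> col l = 0" for h
        using that v0[of h] nl unfolding \<psi>_def by auto
      show ?thesis
      proof (cases "col l = 0")
        case True
        then show ?thesis using out by blast
      next
        case False
        obtain x y where xy: "N' l = {x, y}" "x \<noteq> y" using N'[OF 1] by (auto simp: card_2_iff)
        then have "{x, y} \<subseteq> N l" using N'[OF 1] by simp
        then have e: "x \<in> ends_of l" "y \<in> ends_of l" "x \<noteq> v" "y \<noteq> v" unfolding N_def by auto
        have "\<psi> (half l x) = col l" "\<psi> (half l y) = col l"
          using half[OF e(1)] half[OF e(2)] e nl xy unfolding \<psi>_def by auto
        then have ?pair using pairI[OF e(1,2) xy(2)] False out xy by auto
        then show ?thesis by blast
      qed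
    next
      case 2
      then have Y: "l \<in> Y3" "\<phi> (half l v) \<noteq> 0" unfolding Ah_def U_def by auto
      have e: "v \<in> ends_of l" "route l \<in> ends_of l" "route l \<noteq> v" using Lv_v Y route[OF 2] unfolding N_def by auto
      have "\<psi> (half l v) = \<phi> (half l v)" "\<psi> (half l (route l)) = \<phi> (half l v)"
        using half[OF e(1)] half[OF e(2)] e(3) 2 unfolding \<psi>_def by auto
      moreover have "\<psi> h = 0" if "h \<in> H" "lk h = l" "loc h \<noteq> v" "loc h \<noteq> route l" for h
        using that 2 unfolding \<psi>_def by auto
      ultimately have ?pair using pairI[OF e(1,2)] e(3) Y by auto
      then show ?thesis by blast
    next
      case 3
      then obtain x where x: "N l = {x}" unfolding D1_def by (auto simp: card_1_singleton_iff)
      have nl: "l \<notin> Ah \<phi>" using 3 L_cases(3)[of \<phi>] by auto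
      have e: "v \<in> ends_of l" "x \<in> ends_of l" "x \<noteq> v" using Lv_v 3 x unfolding N_def by auto
      have ps: "\<psi> h = \<phi> (half l v)" if "h \<in> H" "lk h = l" for h
        using that eq[OF that] nl 3 unfolding \<psi>_def by auto
      have "loc h = v \<or> loc h = x" if "h \<in> H" "lk h = l" for h
        using loc_ends(1)[OF that(1)] that(2) x unfolding N_def by auto
      then show ?thesis
        using pairI[OF e(1,2)] e(3) ps half[OF e(1)] half[OF e(2)] by (cases "\<phi> (half l v) = 0") auto
    qed
  qed
  have conn: "(s, t) \<in> lnk (joined \<psi> i)" if i: "i \<in> {1..k}" and st: "s \<in> T'" "t \<in> T'" for i s t
  proof -
    obtain j where j: "i = Suc j" "j < k" using i by (cases i) auto
    have "?n - ncomp T' (rel_of N' (F (Inl j) \<inter> ?I)) = ?n - 1"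
      using F[OF JI[OF j(2)]] unfolding rk_def \<rho>_def by simp
    then have "ncomp T' (rel_of N' (F (Inl j) \<inter> ?I)) \<le> 1"
      using nc[of "rel_of N' (F (Inl j) \<inter> ?I)"] by linarith
    then have "(s, t) \<in> lnk (rel_of N' (F (Inl j) \<inter> ?I))" using st by (intro ncomp_one_iff[of T']) auto
    moreover have "rel_of N' (F (Inl j) \<inter> ?I) \<subseteq> joined \<psi> i"
    proof
      fix p assume "p \<in> rel_of N' (F (Inl j) \<inter> ?I)"
      then obtain l x y where p: "p = (x, y)" and l: "l \<in> F (Inl j)" "l \<in> ?I" and xy: "x \<in> N' l" "y \<in> N' l"
        unfolding rel_of_def by auto
      have "x \<in> N l" "y \<in> N l" using N'[OF l(2)] xy by auto
      then have e: "x \<in> ends_of l" "y \<in> ends_of l" "x \<noteq> v" "y \<noteq> v" unfolding N_def by auto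
      have nl: "l \<notin> Ah \<phi>" "l \<notin> D1" using L_cases(2,3)[of \<phi>] l(2) by auto
      have "\<psi> (half l x) = i" "\<psi> (half l y) = i"
        using half[OF e(1)] half[OF e(2)] e nl xy col[OF j(2) l(1)] j(1) unfolding \<psi>_def by auto
      then show "p \<in> joined \<psi> i"
        unfolding p joined_def using half[OF e(1)] half[OF e(2)] e by (intro CollectI exI[of _ "half l x"] exI[of _ "half l y"]) auto
    qed
    ultimately show ?thesis using lnk_mono by blast
  qed
  have unused: "r t \<le> card {h \<in> H. loc h = t \<and> h \<in> good \<and> \<psi> h = 0}" if t: "t \<in> T'" for t
  proof -
    define Rt where "Rt = F (Inr t) \<inter> Gg t"
    have tv: "t \<noteq> v" using t unfolding T'_def by auto
    have "min (D t) (card Rt) = D t" using F[OF JT[OF t]] unfolding rk_def \<rho>_def Rt_def by simp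
    then have "D t \<le> card Rt" by linarith
    moreover have dis: "Rel t \<inter> Rt = {}"
      using L_cases(2,3)[of \<phi>] unfolding Rel_def Rt_def Gg_def by blast
    ultimately have "r t \<le> card (Rel t \<union> Rt)"
      using fin' card_Un_disjoint[of "Rel t" Rt] unfolding D_def Rt_def by simp
    also have "\<dots> = card ((\<lambda>l. half l t) ` (Rel t \<union> Rt))"
    proof (rule card_image[symmetric], rule inj_onI)
      fix l l' assume "l \<in> Rel t \<union> Rt" "l' \<in> Rel t \<union> Rt" "half l t = half l' t"
      moreover have "t \<in> ends_of l" if "l \<in> Rel t \<union> Rt" for l
        using that N' unfolding Rel_def Rt_def Gg_def N_def by auto
      ultimately show "l = l'" using half(2) by metis
    qed
    also have "\<dots> \<le> card {h \<in> H. loc h = t \<and> h \<in> good \<and> \<psi> h = 0}"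
    proof (rule card_mono)
      show "(\<lambda>l. half l t) ` (Rel t \<union> Rt) \<subseteq> {h \<in> H. loc h = t \<and> h \<in> good \<and> \<psi> h = 0}"
      proof
        fix h assume "h \<in> (\<lambda>l. half l t) ` (Rel t \<union> Rt)"
        then obtain l where l: "l \<in> Rel t \<union> Rt" "h = half l t" by blast
        have te: "t \<in> ends_of l" "half l t \<in> good" using l(1) N' unfolding Rel_def Rt_def Gg_def N_def by auto
        have "\<psi> (half l t) = 0"
        proof (cases "l \<in> Rel t")
          case True
          then show ?thesis using half[OF te(1)] tv L_cases(2,3)[of \<phi>] unfolding Rel_def \<psi>_def by auto
        next
          case False
          then have lR: "l \<in> F (Inr t)" "l \<in> ?I" using l(1) unfolding Rt_def Gg_def by auto
          have "\<not> (\<exists>i<k. l \<in> F (Inl i))"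
            using disj[OF JI JT[OF t]] lR(1) by blast
          then have "col l = 0" unfolding col_def by auto
          then show ?thesis using half[OF te(1)] tv L_cases(2,3)[of \<phi>] lR(2) unfolding \<psi>_def by auto
        qed
        then show "h \<in> {h \<in> H. loc h = t \<and> h \<in> good \<and> \<psi> h = 0}" using half[OF te(1)] te(2) l(2) by simp
      qed
    qed simp
    finally show ?thesis .
  qed
  have "\<psi> h \<le> k" for h unfolding \<psi>_def using \<phi> col_le by simp
  moreover have "\<psi> h = \<phi> h" if "loc h = v" for h using that unfolding \<psi>_def by simp
  ultimately have "extends \<phi> good r \<psi>"
    unfolding extends_def using links conn unused by blast
  then show ?thesis by blast
qed

end

section \<open>The condition on the root colours\<close>

context link_system
begin

lemma half_v: "h \<in> H \<Longrightarrow> loc h = v \<Longrightarrow> half (lk h) v = h"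
  using half_eq by metis

lemma card_v_halves: "card {h \<in> H. loc h = v \<and> P (lk h)} = card {l \<in> Lv. P l}"
proof (rule bij_betw_same_card[of lk])
  show "bij_betw lk {h \<in> H. loc h = v \<and> P (lk h)} {l \<in> Lv. P l}"
  proof (rule bij_betw_byWitness[where f' = "\<lambda>l. half l v"])
    show "\<forall>h\<in>{h \<in> H. loc h = v \<and> P (lk h)}. half (lk h) v = h" using half_v by simp
    show "\<forall>l\<in>{l \<in> Lv. P l}. lk (half l v) = l" using half(2) unfolding Lv_def by simp
    show "lk ` {h \<in> H. loc h = v \<and> P (lk h)} \<subseteq> {l \<in> Lv. P l}"
      using loc_ends unfolding Lv_def by fastforce
    show "(\<lambda>l. half l v) ` {l \<in> Lv. P l} \<subseteq> {h \<in> H. loc h = v \<and> P (lk h)}"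
      using half unfolding Lv_def by fastforce
  qed
qed

text \<open>With \<open>gv\<close> the root half-edges of triples crossing \<open>Y\<close>,
  \<open>bipartition_bound\<close> becomes the bound for \<open>rv = k - e0 Y\<close>. Leaving that
  many of them uncoloured closes the gap at \<open>Y\<close>, and by \<open>weak_unique\<close> the
  only other weak set can be its complement, which is crossed by the same links.\<close>

lemma weak_root_set:
  assumes Y: "weak Y"
  defines "gv \<equiv> {h \<in> H. loc h = v \<and> lk h \<in> Y3 \<and> split Y (lk h)}"
  shows "2 * (k - e0 Y) + card {h \<in> H. loc h = v \<and> h \<notin> gv} \<le> 2 * k"
    and "\<And>\<phi> Z. k - e0 Y \<le> card {h \<in> H. loc h = v \<and> h \<in> gv \<and> \<phi> h = (0::nat)} \<Longrightarrow> weak Z \<Longrightarrow>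
      k \<le> e0 Z + card {l \<in> Y3. split Z l \<and> \<phi> (half l v) = 0}"
proof -
  have Y3Lv: "Y3 \<subseteq> Lv" unfolding Y3_def by auto
  have "{h \<in> H. loc h = v \<and> h \<notin> gv} = {h \<in> H. loc h = v \<and> \<not> (lk h \<in> Y3 \<and> split Y (lk h))}"
    unfolding gv_def by auto
  then have "card {h \<in> H. loc h = v \<and> h \<notin> gv} = card {l \<in> Lv. \<not> (l \<in> Y3 \<and> split Y l)}"
    using card_v_halves[of "\<lambda>l. \<not> (l \<in> Y3 \<and> split Y l)"] by simp
  also have "{l \<in> Lv. \<not> (l \<in> Y3 \<and> split Y l)} = Lv - {l \<in> Y3. split Y l}" by auto
  also have "card (Lv - {l \<in> Y3. split Y l}) = card Lv - card {l \<in> Y3. split Y l}"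
    using Y3Lv by (intro card_Diff_subset) auto
  finally show "2 * (k - e0 Y) + card {h \<in> H. loc h = v \<and> h \<notin> gv} \<le> 2 * k"
    using bipartition_bound[of Y] Y card_Lv unfolding weak_def by auto
  fix \<phi> :: "'h \<Rightarrow> nat" and Z
  assume le: "k - e0 Y \<le> card {h \<in> H. loc h = v \<and> h \<in> gv \<and> \<phi> h = 0}" and Z: "weak Z"
  have sp: "split Z l \<longleftrightarrow> split Y l" for l
    using weak_unique[OF Y Z] ends_T(2)[of l] unfolding split_def by blast
  have "{h \<in> H. loc h = v \<and> h \<in> gv \<and> \<phi> h = 0} = {h \<in> H. loc h = v \<and> (lk h \<in> Y3 \<and> split Y (lk h) \<and> \<phi> (half (lk h) v) = 0)}"
    unfolding gv_def using half_v by auto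
  also have "card \<dots> = card {l \<in> Lv. l \<in> Y3 \<and> split Y l \<and> \<phi> (half l v) = 0}" by (rule card_v_halves)
  also have "{l \<in> Lv. l \<in> Y3 \<and> split Y l \<and> \<phi> (half l v) = 0} = {l \<in> Y3. split Z l \<and> \<phi> (half l v) = 0}"
    using Y3Lv sp by auto
  finally show "k \<le> e0 Z + card {l \<in> Y3. split Z l \<and> \<phi> (half l v) = 0}"
    using le sp unfolding e0_def by simp
qed

theorem link_extension:
  assumes ne: "T' \<noteq> {}" and dem: "valid_demand good r"
  shows "\<exists>gv rv. 2 * rv + card {h \<in> H. loc h = v \<and> h \<notin> gv} \<le> 2 * k \<and>
    (\<forall>\<phi>. (\<forall>h. \<phi> h \<le> k) \<and> rv \<le> card {h \<in> H. loc h = v \<and> h \<in> gv \<and> \<phi> h = 0} \<longrightarrow> (\<exists>\<psi>. extends \<phi> good r \<psi>))"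
proof (cases "2 \<le> card T'")
  case True
  show ?thesis
  proof (cases "\<exists>Y. weak Y")
    case True
    then obtain Y where Y: "weak Y" by blast
    show ?thesis
      using weak_root_set[OF Y] extension_core[OF _ _ \<open>2 \<le> card T'\<close> dem]
      by (intro exI[of _ "{h \<in> H. loc h = v \<and> lk h \<in> Y3 \<and> split Y (lk h)}"] exI[of _ "k - e0 Y"]) blast
  next
    case False
    then show ?thesis
      using extension_core[OF _ _ \<open>2 \<le> card T'\<close> dem] by (intro exI[of _ UNIV] exI[of _ 0]) auto
  qed
next
  case False
  \<comment> \<open>With a single terminal \<open>s\<close> besides the root, every link joins
    \<open>v\<close> to \<open>s\<close>. Colours are copied across, and the demand at
    \<open>s\<close> is handed back as the condition at \<open>v\<close>.\<close>
  then have "card T' = 1" using ne by (metis One_nat_def Suc_leI card_gt_0_iff finite_sets(8) le_antisym not_less_eq_eq numeral_2_eq_2)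
  then obtain s where s: "T' = {s}" by (auto simp: card_1_singleton_iff)
  have sv: "s \<noteq> v" and sT: "s \<in> T" "T = {v, s}" using s vT unfolding T'_def by auto
  have ends: "ends_of l = {v, s}" if "l \<in> L" for l
    using card_ends[OF that] ends_T(1)[of l] sT card_mono[of "{v, s}" "ends_of l"] card_subset_eq[of "{v, s}" "ends_of l"] sv
    by auto
  define gv where "gv = {h \<in> H. half (lk h) s \<in> good}"
  have bij: "card {h \<in> H. loc h = v \<and> P (half (lk h) s)} = card {h \<in> H. loc h = s \<and> P h}" for P
  proof (rule bij_betw_same_card[of "\<lambda>h. half (lk h) s"], rule bij_betw_byWitness[where f' = "\<lambda>h. half (lk h) v"])
    have e: "v \<in> ends_of (lk h)" "s \<in> ends_of (lk h)" if "h \<in> H" for h using ends[OF loc_ends(2)[OF that]] by auto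
    show "\<forall>a\<in>{h \<in> H. loc h = v \<and> P (half (lk h) s)}. half (lk (half (lk a) s)) v = a"
      using half[OF e(2)] half_v by simp
    show "\<forall>a'\<in>{h \<in> H. loc h = s \<and> P h}. half (lk (half (lk a') v)) s = a'"
      using half[OF e(1)] half_eq by auto
    show "(\<lambda>h. half (lk h) s) ` {h \<in> H. loc h = v \<and> P (half (lk h) s)} \<subseteq> {h \<in> H. loc h = s \<and> P h}"
      using half[OF e(2)] by auto
    show "(\<lambda>h. half (lk h) v) ` {h \<in> H. loc h = s \<and> P h} \<subseteq> {h \<in> H. loc h = v \<and> P (half (lk h) s)}"
      using half[OF e(1)] half_eq by auto
  qed
  have ext: "extends \<phi> good r (\<lambda>h. \<phi> (half (lk h) v))"
    if \<phi>: "\<forall>h. \<phi> h \<le> k" "r s \<le> card {h \<in> H. loc h = v \<and> h \<in> gv \<and> \<phi> h = 0}" for \<phi>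
  proof -
    have "{h \<in> H. loc h = v \<and> h \<in> gv \<and> \<phi> h = 0} =
        {h \<in> H. loc h = v \<and> (half (lk h) s \<in> good \<and> \<phi> (half (lk (half (lk h) s)) v) = 0)}"
      unfolding gv_def using half(2)[of s] ends loc_ends(2) half_v by auto
    then have "r s \<le> card {h \<in> H. loc h = s \<and> h \<in> good \<and> \<phi> (half (lk h) v) = 0}"
      using \<phi>(2) bij[of "\<lambda>h. h \<in> good \<and> \<phi> (half (lk h) v) = 0"] by simp
    moreover have "(\<forall>h\<in>H. lk h = l \<longrightarrow> \<phi> (half (lk h) v) = 0) \<or> (\<exists>h1\<in>H. \<exists>h2\<in>H. h1 \<noteq> h2 \<and> lk h1 = l \<and> lk h2 = l \<and>
       \<phi> (half (lk h1) v) \<noteq> 0 \<and> \<phi> (half (lk h1) v) = \<phi> (half (lk h2) v) \<and>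
       (\<forall>h\<in>H. lk h = l \<and> h \<noteq> h1 \<and> h \<noteq> h2 \<longrightarrow> \<phi> (half (lk h) v) = 0))" if l: "l \<in> L" for l
    proof (cases "\<phi> (half l v) = 0")
      case False
      have e: "v \<in> ends_of l" "s \<in> ends_of l" using ends[OF l] by auto
      have "h = half l v \<or> h = half l s" if "h \<in> H" "lk h = l" for h
        using half_eq[OF that(1)] that loc_ends(1)[OF that(1)] ends[OF l] by auto
      moreover have "half l v \<noteq> half l s" using half(3)[OF e(1)] half(3)[OF e(2)] sv by metis
      ultimately show ?thesis
        using half[OF e(1)] half[OF e(2)] False
        by (intro disjI2 bexI[of _ "half l v"] bexI[of _ "half l s"]) auto
    qed simp
    ultimately show ?thesis
      unfolding extends_def using \<phi>(1) half_v s by auto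
  qed
  show ?thesis
  proof (cases "r s = 0")
    case True
    then show ?thesis using ext by (intro exI[of _ UNIV] exI[of _ 0]) auto
  next
    case False
    then have "2 * r s + card {h \<in> H. loc h = s \<and> h \<notin> good} \<le> 2 * k"
      using dem s unfolding valid_demand_def by auto
    moreover have "{h \<in> H. loc h = v \<and> h \<notin> gv} = {h \<in> H. loc h = v \<and> half (lk h) s \<notin> good}"
      unfolding gv_def by auto
    ultimately have "2 * r s + card {h \<in> H. loc h = v \<and> h \<notin> gv} \<le> 2 * k"
      using bij[of "\<lambda>h. h \<notin> good"] by simp
    then show ?thesis using ext by (intro exI[of _ gv] exI[of _ "r s"]) auto
  qed
qed

end

section \<open>Cuts and splittable pairs\<close>

text \<open>A graph is given by its edge set \<open>E\<close> and the map \<open>g\<close> sending the half-edge \<open>(e, b)\<close> to its vertex.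
  In the notation of the statement, \<open>dl E g X\<close> is \<open>\<delta>(X)\<close>.\<close>

definition dl :: "'e set \<Rightarrow> ('e \<times> bool \<Rightarrow> 'v) \<Rightarrow> 'v set \<Rightarrow> 'e set" where
  "dl E g X = {e \<in> E. (g (e, False) \<in> X) \<noteq> (g (e, True) \<in> X)}"

definition btw :: "'e set \<Rightarrow> ('e \<times> bool \<Rightarrow> 'v) \<Rightarrow> 'v set \<Rightarrow> 'v set \<Rightarrow> 'e set" where
  "btw E g A B = {e \<in> E. (g (e, False) \<in> A \<and> g (e, True) \<in> B) \<or> (g (e, False) \<in> B \<and> g (e, True) \<in> A)}"

lemma finite_dl [simp]: "finite E \<Longrightarrow> finite (dl E g X)" "finite E \<Longrightarrow> finite (btw E g X Y)"
  unfolding dl_def btw_def by auto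

text \<open>Submodularity of cuts with its error term; \<open>dl_Diff\<close> is the posimodular
  counterpart. Both are identities for each single edge, seen after writing cardinalities as sums
  over \<open>E\<close>.\<close>

lemma dl_Int_Un:
  assumes "finite E"
  shows "card (dl E g X) + card (dl E g Y) =
    card (dl E g (X \<inter> Y)) + card (dl E g (X \<union> Y)) + 2 * card (btw E g (X - Y) (Y - X))"
proof -
  have c: "card {e \<in> E. P e} = (\<Sum>e\<in>E. if P e then 1 else 0)" for P
    using assms by (simp add: sum.If_cases Int_def)
  show ?thesis unfolding dl_def btw_def c sum_distrib_left sum.distrib[symmetric]
    by (intro sum.cong refl) auto
qed

lemma dl_Diff:
  assumes "finite E"
  shows "card (dl E g X) + card (dl E g Y) =
    card (dl E g (X - Y)) + card (dl E g (Y - X)) + 2 * card (btw E g (X \<inter> Y) (- (X \<union> Y)))"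
proof -
  have c: "card {e \<in> E. P e} = (\<Sum>e\<in>E. if P e then 1 else 0)" for P
    using assms by (simp add: sum.If_cases Int_def)
  show ?thesis unfolding dl_def btw_def c sum_distrib_left sum.distrib[symmetric]
    by (intro sum.cong refl) auto
qed

text \<open>The vertex set is not part of the data. Taking terminals and ends of edges makes it
  finite and leaves room for a new vertex outside.\<close>

definition vts :: "'e set \<Rightarrow> ('e \<times> bool \<Rightarrow> 'v) \<Rightarrow> 'v set \<Rightarrow> 'v set" where
  "vts E g T = T \<union> g ` (E \<times> UNIV)"

lemma vts_mem: "e \<in> E \<Longrightarrow> g (e, b) \<in> vts E g T"
  unfolding vts_def by auto

lemma dl_Int_vts: "dl E g (X \<inter> vts E g T) = dl E g X"
  unfolding dl_def using vts_mem by fast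

text \<open>By \<open>cover\<close> no edge is a loop or joins two nonterminals, so all neighbours
  of a nonterminal are tight terminals. In \<open>trivial\<close> the complement is taken within
  \<open>vts\<close>.\<close>

locale reduced_graph =
  fixes E :: "'e set" and g :: "'e \<times> bool \<Rightarrow> 'v" and T :: "'v set" and K :: nat
  assumes finE: "finite E" and finT: "finite T" and K3: "3 \<le> K"
    and cuts: "\<And>X. X \<inter> T \<noteq> {} \<Longrightarrow> T - X \<noteq> {} \<Longrightarrow> K \<le> card (dl E g X)"
    and trivial: "\<And>X. X \<inter> T \<noteq> {} \<Longrightarrow> T - X \<noteq> {} \<Longrightarrow> X \<subseteq> vts E g T \<Longrightarrow> card (dl E g X) = K \<Longrightarrow>
      (\<exists>t. X = {t}) \<or> (\<exists>t. vts E g T - X = {t})"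
    and cover: "\<And>e. e \<in> E \<Longrightarrow> \<exists>t\<in>T. card (dl E g {t}) = K \<and> e \<in> dl E g {t}"
begin

abbreviation "VV \<equiv> vts E g T"

lemma finite_VV: "finite VV" unfolding vts_def using finE finT by auto

definition "nb w e = (if g (e, False) = w then g (e, True) else g (e, False))"

lemma nb:
  assumes "w \<notin> T" "e \<in> dl E g {w}"
  shows "nb w e \<in> T" "card (dl E g {nb w e}) = K" "g (e, False) = w \<and> g (e, True) = nb w e \<or> g (e, True) = w \<and> g (e, False) = nb w e"
proof -
  have e: "e \<in> E" using assms unfolding dl_def by auto
  obtain t where t: "t \<in> T" "card (dl E g {t}) = K" "e \<in> dl E g {t}" using cover[OF e] by blast
  have "nb w e = t" using t assms unfolding dl_def nb_def by auto
  then show "nb w e \<in> T" "card (dl E g {nb w e}) = K" using t by auto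
  show "g (e, False) = w \<and> g (e, True) = nb w e \<or> g (e, True) = w \<and> g (e, False) = nb w e"
    using assms unfolding dl_def nb_def by auto
qed

text \<open>The obstruction to detaching from \<open>w\<close> two edges whose other ends lie in
  \<open>X\<close>: the new vertex, placed with \<open>X\<close>, would give a cut two smaller,
  hence below \<open>K\<close>.\<close>

definition "dangerous w X \<longleftrightarrow> X \<subseteq> VV \<and> w \<notin> X \<and> X \<inter> T \<noteq> {} \<and> T - X \<noteq> {} \<and> card (dl E g X) \<le> K + 1"
definition "maxdan w X \<longleftrightarrow> dangerous w X \<and> (\<forall>Y. dangerous w Y \<longrightarrow> X \<subseteq> Y \<longrightarrow> Y = X)"

lemma maxdan_ex:
  assumes "dangerous w X"
  obtains Y where "maxdan w Y" "X \<subseteq> Y"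
proof -
  have "finite {Y. dangerous w Y \<and> X \<subseteq> Y}"
    by (rule finite_subset[of _ "Pow VV"]) (use finite_VV in \<open>auto simp: dangerous_def\<close>)
  moreover have "X \<in> {Y. dangerous w Y \<and> X \<subseteq> Y}" using assms by simp
  ultimately obtain Y where Y: "Y \<in> {Y. dangerous w Y \<and> X \<subseteq> Y}" "X \<subseteq> Y"
    and mx: "\<forall>Z\<in>{Y. dangerous w Y \<and> X \<subseteq> Y}. Y \<subseteq> Z \<longrightarrow> Y = Z"
    using finite_has_maximal2[of "{Y. dangerous w Y \<and> X \<subseteq> Y}" X] by metis
  have "maxdan w Y" unfolding maxdan_def
  proof (intro conjI allI impI)
    show "dangerous w Y" using Y by simp
    fix Z assume Z: "dangerous w Z" "Y \<subseteq> Z"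
    then have "Z \<in> {Y. dangerous w Y \<and> X \<subseteq> Y}" using Y by blast
    then show "Z = Y" using mx Z(2) by metis
  qed
  then show thesis using Y(2) by (rule that)
qed

lemma btw_nb:
  assumes "w \<notin> T" "w \<notin> X"
  shows "btw E g X {w} = {e \<in> dl E g {w}. nb w e \<in> X}"
  using nb[OF assms(1)] assms(2) unfolding btw_def dl_def by (auto simp: nb_def)

text \<open>Adding \<open>w\<close> to \<open>X\<close> keeps \<open>T\<close> separated and
  exchanges the edges from \<open>w\<close> into \<open>X\<close> for the other edges at
  \<open>w\<close>. The cut, at most \<open>K + 1\<close> before, may only drop to
  \<open>K\<close>.\<close>

lemma dangerous_share:
  assumes w: "w \<notin> T" and X: "dangerous w X"
  shows "2 * card {e \<in> dl E g {w}. nb w e \<in> X} \<le> card (dl E g {w}) + 1"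
proof -
  have wX: "w \<notin> X" using X unfolding dangerous_def by simp
  have "X - {w} = X" "{w} - X = {w}" "X \<inter> {w} = {}" using wX by auto
  then have "card (dl E g X) + card (dl E g {w}) =
      card (dl E g {}) + card (dl E g (X \<union> {w})) + 2 * card {e \<in> dl E g {w}. nb w e \<in> X}"
    using dl_Int_Un[OF finE, of g X "{w}"] btw_nb[OF w wX] by simp
  moreover have "dl E g {} = {}" unfolding dl_def by simp
  moreover have "K \<le> card (dl E g (X \<union> {w}))" using X w unfolding dangerous_def by (intro cuts) auto
  ultimately show ?thesis using X unfolding dangerous_def by simp
qed

text \<open>If both differences contain terminals, the edge \<open>e\<close> from
  \<open>X \<inter> Y\<close> to \<open>w\<close> makes posimodularity an equality,
  \<open>2 * (K + 1) = K + K + 2\<close>; the differences are then tight, and single vertices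
  because their complements contain \<open>w\<close> and \<open>nb w e\<close>. Otherwise
  \<open>X \<union> Y\<close> misses a terminal and has by maximality a cut of at least
  \<open>K + 2\<close>, so submodularity makes \<open>X \<inter> Y\<close> tight.\<close>

lemma maxdan_pair:
  assumes w: "w \<notin> T" and X: "maxdan w X" and Y: "maxdan w Y" and ne: "X \<noteq> Y"
    and e: "e \<in> dl E g {w}" "nb w e \<in> X \<inter> Y"
  shows "(X - Y) \<inter> T \<noteq> {} \<Longrightarrow> (Y - X) \<inter> T \<noteq> {} \<Longrightarrow>
      \<exists>x y. X - Y = {x} \<and> Y - X = {y} \<and> btw E g (X \<inter> Y) (- (X \<union> Y)) = {e} \<and> card (dl E g X) = K + 1"
    and "\<not> ((X - Y) \<inter> T \<noteq> {} \<and> (Y - X) \<inter> T \<noteq> {}) \<Longrightarrow>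
      X \<inter> Y = {nb w e} \<and> btw E g (X - Y) (Y - X) = {}"
proof -
  note nbe = nb[OF w e(1)]
  have dX: "dangerous w X" "dangerous w Y" using X Y unfolding maxdan_def by auto
  have XV: "X \<subseteq> VV" "Y \<subseteq> VV" "w \<notin> X" "w \<notin> Y" using dX unfolding dangerous_def by auto
  have eE: "e \<in> E" using e(1) unfolding dl_def by simp
  have wV: "w \<in> VV" using vts_mem[OF eE] nbe(3) by metis
  have nV: "nb w e \<in> VV" using nbe(1) unfolding vts_def by simp
  have nw: "nb w e \<noteq> w" using nbe(1) w by metis
  {
    assume T1: "(X - Y) \<inter> T \<noteq> {}" and T2: "(Y - X) \<inter> T \<noteq> {}"
    have k: "K \<le> card (dl E g (X - Y))" "K \<le> card (dl E g (Y - X))"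
      using T1 T2 nbe(1) e(2) by (intro cuts; auto)+
    have eb: "e \<in> btw E g (X \<inter> Y) (- (X \<union> Y))" using nbe(3) e(2) XV eE unfolding btw_def by auto
    then have "1 \<le> card (btw E g (X \<inter> Y) (- (X \<union> Y)))"
      using finE by (metis One_nat_def Suc_leI card_gt_0_iff empty_iff finite_dl(2))
    then have eqs: "card (dl E g X) = K + 1" "card (dl E g (X - Y)) = K" "card (dl E g (Y - X)) = K"
      "card (btw E g (X \<inter> Y) (- (X \<union> Y))) = 1"
      using dl_Diff[OF finE, of g X Y] dX k unfolding dangerous_def by linarith+
    have be: "btw E g (X \<inter> Y) (- (X \<union> Y)) = {e}" using eqs(4) eb by (auto simp: card_1_singleton_iff)
    have nt: "\<not> (\<exists>t. VV - Z = {t})" if "w \<notin> Z" "nb w e \<notin> Z" for Z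
      using that wV nV nw by (metis Diff_iff singletonD)
    have "\<exists>x. X - Y = {x}"
      using trivial[of "X - Y"] T1 nbe(1) e(2) XV eqs nt[of "X - Y"] by fast
    moreover have "\<exists>y. Y - X = {y}"
      using trivial[of "Y - X"] T2 nbe(1) e(2) XV eqs nt[of "Y - X"] by fast
    ultimately show "\<exists>x y. X - Y = {x} \<and> Y - X = {y} \<and> btw E g (X \<inter> Y) (- (X \<union> Y)) = {e} \<and> card (dl E g X) = K + 1"
      using be eqs(1) by blast
  next
    assume nT: "\<not> ((X - Y) \<inter> T \<noteq> {} \<and> (Y - X) \<inter> T \<noteq> {})"
    then have out: "T - (X \<union> Y) \<noteq> {}" using dX unfolding dangerous_def by blast
    have i: "K \<le> card (dl E g (X \<inter> Y))" using nbe(1) e(2) out by (intro cuts) auto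
    have "\<not> dangerous w (X \<union> Y)"
      using X Y ne unfolding maxdan_def by blast
    then have u: "K + 2 \<le> card (dl E g (X \<union> Y))"
      using XV out dX unfolding dangerous_def by auto
    have eqs: "card (dl E g (X \<inter> Y)) = K" "card (btw E g (X - Y) (Y - X)) = 0"
      using dl_Int_Un[OF finE, of g X Y] dX i u unfolding dangerous_def by linarith+
    obtain u where u: "u \<in> T" "u \<notin> X \<union> Y" using out by blast
    have "\<not> (\<exists>t. VV - (X \<inter> Y) = {t})"
    proof -
      have "u \<in> VV" using u(1) unfolding vts_def by simp
      moreover have "u \<noteq> w" using u(1) w by metis
      ultimately show ?thesis using wV u(2) XV by (metis Diff_iff IntD1 UnCI singletonD)
    qed
    then have "\<exists>t. X \<inter> Y = {t}"
      using trivial[of "X \<inter> Y"] nbe(1) e(2) out XV eqs(1) by blast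
    then have "X \<inter> Y = {nb w e}" using e(2) by (metis singletonD)
    moreover have "btw E g (X - Y) (Y - X) = {}" using eqs(2) finE by simp
    ultimately show "X \<inter> Y = {nb w e} \<and> btw E g (X - Y) (Y - X) = {}" by blast
  }
qed

text \<open>In the first case of \<open>maxdan_pair\<close> only one edge leads from
  \<open>X \<inter> Y\<close> out of \<open>X \<union> Y\<close>, but both \<open>e\<close> and
  \<open>f\<close> lead to \<open>w\<close>. So the second case holds.\<close>

lemma maxdan_common:
  assumes w: "w \<notin> T" and X: "maxdan w X" and Y: "maxdan w Y" and ne: "X \<noteq> Y"
    and e: "e \<in> dl E g {w}" "nb w e \<in> X \<inter> Y" and f: "f \<in> dl E g {w}" "nb w f \<in> X \<inter> Y" and "e \<noteq> f"
  shows "nb w e = nb w f" "X \<inter> Y = {nb w e} \<and> btw E g (X - Y) (Y - X) = {}"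
proof -
  have wX: "w \<notin> X" "w \<notin> Y" using X Y unfolding maxdan_def dangerous_def by auto
  have "f \<in> btw E g (X \<inter> Y) (- (X \<union> Y))" "e \<in> btw E g (X \<inter> Y) (- (X \<union> Y))"
    using nb(3)[OF w f(1)] nb(3)[OF w e(1)] e f wX unfolding btw_def dl_def by auto
  then have "\<not> ((X - Y) \<inter> T \<noteq> {} \<and> (Y - X) \<inter> T \<noteq> {})"
    using maxdan_pair(1)[OF w X Y ne e] \<open>e \<noteq> f\<close> by (metis singletonD)
  then show *: "X \<inter> Y = {nb w e} \<and> btw E g (X - Y) (Y - X) = {}"
    using maxdan_pair(2)[OF w X Y ne e] by blast
  then show "nb w e = nb w f" using f(2) by (metis singletonD)
qed

theorem splittable_pair:
  assumes w: "w \<notin> T" and deg: "4 \<le> card (dl E g {w})"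
  shows "\<exists>e\<in>dl E g {w}. \<exists>f\<in>dl E g {w}. e \<noteq> f \<and> (\<forall>X. w \<notin> X \<and> T - X \<noteq> {} \<and> nb w e \<in> X \<and> nb w f \<in> X \<longrightarrow> K + 2 \<le> card (dl E g X))"
proof (rule ccontr)
  assume neg: "\<not> ?thesis"
  let ?D = "dl E g {w}"
  have finD: "finite ?D" using finE by simp
  have dan: "\<exists>X. maxdan w X \<and> nb w e \<in> X \<and> nb w f \<in> X" if ef: "e \<in> ?D" "f \<in> ?D" "e \<noteq> f" for e f
  proof -
    obtain X where X: "w \<notin> X" "T - X \<noteq> {}" "nb w e \<in> X" "nb w f \<in> X" "card (dl E g X) \<le> K + 1"
      using neg ef by (metis Suc_eq_plus1 add_2_eq_Suc' not_less_eq_eq)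
    have n: "nb w e \<in> T" "nb w f \<in> T" using nb(1)[OF w] ef by auto
    then have "dangerous w (X \<inter> VV)"
      using X dl_Int_vts[of E g X T] unfolding dangerous_def vts_def by auto
    then obtain Y where "maxdan w Y" "X \<inter> VV \<subseteq> Y" by (rule maxdan_ex)
    then show ?thesis using X n unfolding vts_def by blast
  qed
  have share: "2 * card {e \<in> ?D. nb w e \<in> X} \<le> card ?D + 1" if "maxdan w X" for X
    using dangerous_share[OF w] that unfolding maxdan_def by blast
  have outside: "\<exists>f\<in>?D. nb w f \<notin> X" if "maxdan w X" for X
  proof (rule ccontr)
    assume "\<not> ?thesis"
    then have "{e \<in> ?D. nb w e \<in> X} = ?D" by blast
    then show False using share[OF that] deg by simp
  qed
  have "?D \<noteq> {}" "card ?D \<noteq> 1" using deg by auto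
  then obtain u where u1: "u \<in> ?D" by blast
  have "?D \<noteq> {u}" using \<open>card ?D \<noteq> 1\<close> by (metis card_1_singleton_iff One_nat_def)
  then obtain u' where u': "u' \<in> ?D" "u \<noteq> u'" using u1 by blast
  note u = u1 u'
  \<comment> \<open>The aim is a triple of edges \<open>u\<close>, \<open>x\<close>,
    \<open>z\<close> at \<open>w\<close> with maximal dangerous sets \<open>X\<close> for
    \<open>u\<close>, \<open>x\<close> and \<open>Y\<close> for \<open>u\<close>, \<open>z\<close>,
    each missing the third neighbour. Then \<open>X\<close> and \<open>Y\<close> differ by one
    vertex on each side, and \<open>u\<close> is the only edge that leaves
    \<open>X \<inter> Y\<close> for a vertex outside \<open>X \<union> Y\<close>.\<close>
  obtain X0 where X0: "maxdan w X0" "nb w u \<in> X0" using dan[OF u] by blast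
  obtain z where z: "z \<in> ?D" "nb w z \<notin> X0" using outside[OF X0(1)] by blast
  have uz: "nb w u \<noteq> nb w z" "u \<noteq> z" using X0 z by auto
  obtain Y where Y: "maxdan w Y" "nb w u \<in> Y" "nb w z \<in> Y" using dan[OF u(1) z(1) uz(2)] by blast
  obtain x where x: "x \<in> ?D" "nb w x \<notin> Y" using outside[OF Y(1)] by blast
  have xu: "nb w x \<noteq> nb w u" "x \<noteq> u" "x \<noteq> z" using x Y by auto
  obtain X where X: "maxdan w X" "nb w u \<in> X" "nb w x \<in> X" using dan[OF u(1) x(1)] xu by blast
  have XY: "X \<noteq> Y" using X x by blast
  have zX: "nb w z \<notin> X" using maxdan_common(1)[OF w X(1) Y(1) XY u(1) _ z(1)] X Y uz by blast
  note nT = nb(1)[OF w]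
  have "(X - Y) \<inter> T \<noteq> {}" "(Y - X) \<inter> T \<noteq> {}" "nb w u \<in> X \<inter> Y"
    using X Y x z zX nT[OF x(1)] nT[OF z(1)] by auto
  then obtain x0 z0 where B: "X - Y = {x0}" "Y - X = {z0}" "btw E g (X \<inter> Y) (- (X \<union> Y)) = {u}" "card (dl E g X) = K + 1"
    using maxdan_pair(1)[OF w X(1) Y(1) XY u(1)] by metis
  have x0: "x0 = nb w x" and z0: "z0 = nb w z" using B X Y x zX by auto
  define I where "I = X \<inter> Y"
  have XI: "X = insert (nb w x) I" "nb w x \<notin> I" "nb w z \<notin> I" using B x0 zX x unfolding I_def by auto
  have wX: "w \<notin> X" "w \<notin> Y" using X Y unfolding maxdan_def dangerous_def by auto
  \<comment> \<open>Without such an edge, let \<open>b\<close> be the number of edges from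
    \<open>I\<close> to \<open>nb w x\<close> and \<open>d\<close> the size of the cut around
    \<open>I\<close>. Then \<open>d \<le> b + 1\<close>, while
    \<open>d + K = (K + 1) + 2 * b\<close>; so \<open>d = 1\<close>, which is less than
    \<open>K\<close>.\<close>
  have Iz: "btw E g I {nb w z} \<noteq> {}"
  proof
    assume none: "btw E g I {nb w z} = {}"
    have "nb w u \<in> I" using X Y unfolding I_def by simp
    then have KI: "K \<le> card (dl E g I)" using nT[OF u(1)] nT[OF x(1)] XI by (intro cuts) auto
    have id: "card (dl E g I) + card (dl E g {nb w x}) =
       card (dl E g {}) + card (dl E g X) + 2 * card (btw E g I {nb w x})"
    proof -
      have "I \<inter> {nb w x} = {}" "I - {nb w x} = I" "{nb w x} - I = {nb w x}" "I \<union> {nb w x} = X" using XI by auto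
      then show ?thesis using dl_Int_Un[OF finE, of g I "{nb w x}"] by simp
    qed
    have "dl E g I \<subseteq> btw E g I {nb w x} \<union> {u}"
    proof
      fix e assume e: "e \<in> dl E g I"
      then have "e \<in> btw E g I (- I)" unfolding dl_def btw_def by auto
      moreover have "- I = {nb w x} \<union> {nb w z} \<union> - (X \<union> Y)" using B x0 z0 XI unfolding I_def by blast
      ultimately have "e \<in> btw E g I {nb w x} \<union> btw E g I {nb w z} \<union> btw E g I (- (X \<union> Y))"
        unfolding btw_def by auto
      then show "e \<in> btw E g I {nb w x} \<union> {u}" using none B(3) unfolding I_def by auto
    qed
    then have "card (dl E g I) \<le> card (btw E g I {nb w x} \<union> {u})"
      using finE by (intro card_mono) auto
    also have "\<dots> \<le> card (btw E g I {nb w x}) + 1" using card_Un_le[of "btw E g I {nb w x}" "{u}"] by simp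
    finally have "card (dl E g I) \<le> card (btw E g I {nb w x}) + 1" .
    moreover have "dl E g {} = {}" unfolding dl_def by simp
    ultimately show False using id KI B(4) nb(2)[OF w x(1)] K3 by simp
  qed
  then obtain f where f: "f \<in> btw E g I {nb w z}" by blast
  \<comment> \<open>For a further neighbour, a set \<open>Z\<close> for \<open>u\<close> and
    \<open>y\<close> plays the part of \<open>Y\<close>: again \<open>X \<inter> Z = I\<close>, with
    \<open>u\<close> the only edge from \<open>I\<close> out of \<open>X \<union> Z\<close>. But the
    edge \<open>f\<close> from \<open>I\<close> to \<open>nb w z\<close> is another one.\<close>
  have all: "nb w y \<in> X \<union> Y" if y: "y \<in> ?D" for y
  proof (rule ccontr)
    assume yn: "nb w y \<notin> X \<union> Y"
    then have "u \<noteq> y" using X by blast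
    then obtain Z where Z: "maxdan w Z" "nb w u \<in> Z" "nb w y \<in> Z" using dan[OF u(1) y] by blast
    have XZ: "X \<noteq> Z" "Y \<noteq> Z" using Z yn by auto
    have xZ: "nb w x \<notin> Z" using maxdan_common(1)[OF w X(1) Z(1) XZ(1) u(1) _ x(1)] X Z xu by (metis IntI)
    have zZ: "nb w z \<notin> Z" using maxdan_common(1)[OF w Y(1) Z(1) XZ(2) u(1) _ z(1)] Y Z uz by (metis IntI)
    have "(X - Z) \<inter> T \<noteq> {}" "(Z - X) \<inter> T \<noteq> {}" "nb w u \<in> X \<inter> Z"
      using X Z xZ yn nT[OF x(1)] nT[OF y] by auto
    then obtain x1 where B2: "X - Z = {x1}" "btw E g (X \<inter> Z) (- (X \<union> Z)) = {u}"
      using maxdan_pair(1)[OF w X(1) Z(1) XZ(1) u(1)] by metis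
    have "X - Z = {nb w x}" using B2(1) X xZ by (metis DiffI singletonD)
    moreover have "X \<inter> Z = X - (X - Z)" by blast
    ultimately have "X \<inter> Z = I" using XI by simp
    then have "f \<in> btw E g (X \<inter> Z) (- (X \<union> Z))" using f zX zZ unfolding btw_def by auto
    then have "f = u" using B2(2) by simp
    moreover have "g (u, False) = w \<or> g (u, True) = w" using nb(3)[OF w u(1)] by auto
    ultimately show False using f wX nT[OF z(1)] w unfolding btw_def I_def by auto
  qed
  have inI: "y = u" if "y \<in> ?D" "nb w y \<in> I" for y
  proof -
    have "y \<in> btw E g (X \<inter> Y) (- (X \<union> Y))"
      using nb(3)[OF w that(1)] that wX unfolding btw_def dl_def I_def by auto
    then show ?thesis using B(3) by blast
  qed
  define bx bz where "bx = {e \<in> ?D. nb w e = nb w x}" and "bz = {e \<in> ?D. nb w e = nb w z}"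
  have fb: "finite bx" "finite bz" "u \<notin> bx" "u \<notin> bz" "bx \<inter> bz = {}" using finD xu uz zX X unfolding bx_def bz_def by auto
  have YI: "Y = insert (nb w z) I" using B z0 unfolding I_def by blast
  have "?D = insert u (bx \<union> bz)"
    using all inI u(1) unfolding bx_def bz_def XI(1) YI by auto
  then have cD: "card ?D = Suc (card bx + card bz)" using fb by (metis card_Un_disjoint card_insert_disjoint finite_Un Un_iff)
  have "{e \<in> ?D. nb w e \<in> X} = insert u bx" using inI u(1) X unfolding bx_def XI(1) by auto
  then have sx: "2 * Suc (card bx) \<le> card ?D + 1" using share[OF X(1)] fb by simp
  have "{e \<in> ?D. nb w e \<in> Y} = insert u bz" using inI u(1) Y unfolding bz_def YI by auto
  then have sz: "2 * Suc (card bz) \<le> card ?D + 1" using share[OF Y(1)] fb by simp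
  \<comment> \<open>The degree is \<open>1 + card bx + card bz\<close>, and the two bounds from
    \<open>share\<close> force \<open>card bx = card bz\<close>; degree at least four then leaves at
    least two in each. An edge \<open>x'\<close> parallel to \<open>x\<close> brings in
    \<open>maxdan_common\<close> for \<open>X\<close> and a set containing the neighbours of
    \<open>x\<close> and \<open>z\<close>, which forbids the edge \<open>f\<close>.\<close>
  have "2 \<le> card bx" using cD sx sz deg by presburger
  then have "bx \<noteq> {x}" by auto
  moreover have "x \<in> bx" using x unfolding bx_def by simp
  ultimately obtain x' where x': "x' \<in> ?D" "nb w x' = nb w x" "x' \<noteq> x" unfolding bx_def by blast
  obtain Z where Z: "maxdan w Z" "nb w x \<in> Z" "nb w z \<in> Z" using dan[OF x(1) z(1) xu(3)] by blast
  have XZ: "X \<noteq> Z" using Z zX by blast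
  have A: "X \<inter> Z = {nb w x}" "btw E g (X - Z) (Z - X) = {}"
    using maxdan_common(2)[OF w X(1) Z(1) XZ x(1) _ x'(1)] X Z x' by auto
  have "X - Z = X - (X \<inter> Z)" by blast
  then have "X - Z = I" using A(1) XI by simp
  then have "f \<in> btw E g (X - Z) (Z - X)" using f Z zX unfolding btw_def by auto
  then show False using A(2) by blast
qed

end

section \<open>Routings with a precoloured root\<close>

definition flip :: "'e \<times> bool \<Rightarrow> 'e \<times> bool" where
  "flip h = (fst h, \<not> snd h)"

lemma flip_simps [simp]: "fst (flip h) = fst h" "flip (flip h) = h" "flip h \<noteq> h"
  unfolding flip_def by (auto simp: prod_eq_iff)

lemma same_edge: "fst h = fst h' \<Longrightarrow> h' = h \<or> h' = flip h"
  unfolding flip_def by (auto simp: prod_eq_iff)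

text \<open>Trails of colour \<open>i\<close> follow an edge, the pairing at a nonterminal, or change edges freely at a
  terminal other than the root.\<close>

definition hop where
  "hop E g T v c \<mu> i = {(h, h'). fst h \<in> E \<and> fst h' \<in> E \<and> c (fst h) = i \<and> c (fst h') = i \<and>
     (h' = flip h \<or> (g h \<notin> T \<and> h' = \<mu> h) \<or> (g h \<in> T - {v} \<and> g h' = g h))}"

lemma hopI:
  assumes "fst h \<in> E" "fst h' \<in> E" "c (fst h) = i" "c (fst h') = i"
  shows "h' = flip h \<Longrightarrow> (h, h') \<in> hop E g T v c \<mu> i"
    "g h \<notin> T \<Longrightarrow> h' = \<mu> h \<Longrightarrow> (h, h') \<in> hop E g T v c \<mu> i"
    "g h \<in> T - {v} \<Longrightarrow> g h' = g h \<Longrightarrow> (h, h') \<in> hop E g T v c \<mu> i"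
  using assms unfolding hop_def by blast+

text \<open>Reaching \<open>s\<close> from itself would require an edge of colour \<open>i\<close>
  at \<open>s\<close>, which need not exist when \<open>s\<close> is the only terminal besides the
  root; hence \<open>s \<noteq> t\<close> in \<open>routing\<close>.\<close>

definition reach where
  "reach E g T v c \<mu> i s t \<longleftrightarrow> (\<exists>h h'. fst h \<in> E \<and> fst h' \<in> E \<and> c (fst h) = i \<and> c (fst h') = i \<and>
     g h = s \<and> g h' = t \<and> (h, h') \<in> lnk (hop E g T v c \<mu> i))"

definition paired where
  "paired E g T c \<mu> \<longleftrightarrow> (\<forall>h. fst h \<in> E \<and> c (fst h) \<noteq> (0::nat) \<and> g h \<notin> T \<longrightarrow>
     fst (\<mu> h) \<in> E \<and> \<mu> h \<noteq> h \<and> \<mu> (\<mu> h) = h \<and> g (\<mu> h) = g h \<and> c (fst (\<mu> h)) = c (fst h))"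

text \<open>The last clause is for gluing: when the root stands for the contracted outside of a
  tight set, it makes trails that come in over the cut end at terminals inside.\<close>

definition routing where
  "routing E g T v k c \<mu> \<longleftrightarrow> (\<forall>e\<in>E. c e \<le> k) \<and> paired E g T c \<mu> \<and>
     (\<forall>i\<in>{1..k}. \<forall>s\<in>T - {v}. \<forall>t\<in>T - {v}. s \<noteq> t \<longrightarrow> reach E g T v c \<mu> i s t) \<and>
     (\<forall>h. fst h \<in> E \<and> c (fst h) \<noteq> 0 \<and> g h = v \<longrightarrow>
        (\<exists>h'. fst h' \<in> E \<and> g h' \<in> T - {v} \<and> c (fst h') = c (fst h) \<and> (h, h') \<in> lnk (hop E g T v c \<mu> (c (fst h)))))"

definition demand where
  "demand E g T v k good r \<longleftrightarrow> (\<forall>t\<in>T - {v}. r t = (0::nat) \<or>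
     (card (dl E g {t}) = 6 * k + 6 \<and> 2 * r t + card (dl E g {t} - good t) \<le> 2 * k))"

definition served where
  "served E g T v good r c \<longleftrightarrow> (\<forall>t\<in>T - {v}. r t \<le> card {e \<in> dl E g {t} \<inter> good t. c e = (0::nat)})"

definition rooted where
  "rooted E g T v k \<longleftrightarrow> finite E \<and> finite T \<and> v \<in> T \<and> T - {v} \<noteq> {} \<and> card (dl E g {v}) = 6 * k + 6 \<and>
     (\<forall>X. X \<inter> T \<noteq> {} \<longrightarrow> T - X \<noteq> {} \<longrightarrow> 6 * k + 6 \<le> card (dl E g X))"

text \<open>The pair \<open>(gv, rv)\<close> is chosen before the colouring \<open>\<phi>\<close> of the root edges. The bound on it has the
  same form as \<open>demand\<close>, so that it can be passed on as a demand at a contracted vertex.\<close>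

definition solvable where
  "solvable E g T v k \<longleftrightarrow> (\<forall>good r. demand E g T v k good r \<longrightarrow>
     (\<exists>gv rv. 2 * rv + card (dl E g {v} - gv) \<le> 2 * k \<and>
       (\<forall>\<phi>. (\<forall>e. \<phi> e \<le> k) \<and> rv \<le> card {e \<in> dl E g {v} \<inter> gv. \<phi> e = 0} \<longrightarrow>
         (\<exists>c \<mu>. routing E g T v k c \<mu> \<and> served E g T v good r c \<and> (\<forall>e\<in>dl E g {v}. c e = \<phi> e)))))"

lemma (in link_system) extends_partner:
  assumes "extends \<phi> good r \<psi>" "h \<in> H" "\<psi> h \<noteq> 0"
  shows "\<exists>h2\<in>H. h2 \<noteq> h \<and> lk h2 = lk h \<and> \<psi> h2 = \<psi> h \<and> (\<forall>h'\<in>H. lk h' = lk h \<and> \<psi> h' \<noteq> 0 \<longrightarrow> h' = h \<or> h' = h2)"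
proof -
  have "lk h \<in> L" using assms unfolding L_def by blast
  then have "(\<forall>h'\<in>H. lk h' = lk h \<longrightarrow> \<psi> h' = 0) \<or> (\<exists>h1\<in>H. \<exists>h2\<in>H. h1 \<noteq> h2 \<and> lk h1 = lk h \<and> lk h2 = lk h \<and>
       \<psi> h1 \<noteq> 0 \<and> \<psi> h1 = \<psi> h2 \<and> (\<forall>h'\<in>H. lk h' = lk h \<and> h' \<noteq> h1 \<and> h' \<noteq> h2 \<longrightarrow> \<psi> h' = 0))"
    using assms(1) unfolding extends_def by blast
  moreover have "\<not> (\<forall>h'\<in>H. lk h' = lk h \<longrightarrow> \<psi> h' = 0)" using assms(2,3) by auto
  ultimately obtain h1 h2 where a: "h1 \<in> H" "h2 \<in> H" "h1 \<noteq> h2" "lk h1 = lk h" "lk h2 = lk h" "\<psi> h1 = \<psi> h2"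
      and only: "\<forall>h'\<in>H. lk h' = lk h \<and> h' \<noteq> h1 \<and> h' \<noteq> h2 \<longrightarrow> \<psi> h' = 0"
    by (elim disjE bexE conjE) simp_all
  have "h = h1 \<or> h = h2" using bspec[OF only assms(2)] assms(3) by auto
  then show ?thesis
  proof
    assume e: "h = h1"
    have "h' = h \<or> h' = h2" if "h' \<in> H" "lk h' = lk h \<and> \<psi> h' \<noteq> 0" for h'
      using bspec[OF only that(1)] that(2) e by blast
    moreover have "h2 \<noteq> h" "\<psi> h2 = \<psi> h" using a(3,6) e by simp_all
    ultimately show ?thesis using a(2,5) by blast
  next
    assume e: "h = h2"
    have "h' = h \<or> h' = h1" if "h' \<in> H" "lk h' = lk h \<and> \<psi> h' \<noteq> 0" for h'
      using bspec[OF only that(1)] that(2) e by blast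
    moreover have "h1 \<noteq> h" "\<psi> h1 = \<psi> h" using a(3,6) e by simp_all
    ultimately show ?thesis using a(1,4) by blast
  qed
qed

section \<open>Graphs with nonterminals of degree at most three as link systems\<close>

locale star_graph = reduced_graph E g T "6 * k + 6"
  for E :: "'e set" and g :: "'e \<times> bool \<Rightarrow> 'v" and T :: "'v set" and k :: nat +
  fixes v :: 'v
  assumes vT: "v \<in> T" and T2: "T - {v} \<noteq> {}" and degv: "card (dl E g {v}) = 6 * k + 6"
    and deg3: "\<And>w. w \<notin> T \<Longrightarrow> card (dl E g {w}) \<le> 3"
begin

abbreviation "H \<equiv> {h. fst h \<in> E \<and> g h \<in> T}"

text \<open>A link is named by its nonterminal, or by the edge itself if both ends are terminals;
  edges have at most one nonterminal end by \<open>cover\<close>.\<close>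

definition "lab e = (if g (e, False) \<notin> T then Inl (g (e, False)) else if g (e, True) \<notin> T then Inl (g (e, True)) else Inr e)"

abbreviation "lk h \<equiv> lab (fst h)"

lemma edge_ends:
  assumes "e \<in> E"
  shows "g (e, False) \<noteq> g (e, True)" "g (e, False) \<in> T \<or> g (e, True) \<in> T"
  using cover[OF assms] unfolding dl_def by auto

lemma half_ends: "fst h \<in> E \<Longrightarrow> g (flip h) \<noteq> g h" "fst h \<in> E \<Longrightarrow> g h \<in> T \<or> g (flip h) \<in> T"
proof -
  assume "fst h \<in> E"
  note e = edge_ends[OF this]
  show "g (flip h) \<noteq> g h" "g h \<in> T \<or> g (flip h) \<in> T"
    using e unfolding flip_def by (cases h; cases "snd h"; auto)+
qed

lemma dl_single: "e \<in> dl E g {u} \<longleftrightarrow> (\<exists>h. fst h = e \<and> e \<in> E \<and> g h = u)"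
proof -
  have "(\<exists>h. fst h = e \<and> g h = u) \<longleftrightarrow> g (e, False) = u \<or> g (e, True) = u"
    by (metis (full_types) fst_conv prod.collapse)
  then show ?thesis using edge_ends(1)[of e] unfolding dl_def by auto
qed

lemma inj_fst: "inj_on fst {h. fst h \<in> E \<and> g h = u}"
proof (rule inj_onI)
  fix h h' assume a: "h \<in> {h. fst h \<in> E \<and> g h = u}" "h' \<in> {h. fst h \<in> E \<and> g h = u}" "fst h = fst h'"
  then have "h' \<noteq> flip h" using half_ends(1)[of h] by auto
  then show "h = h'" using same_edge[OF a(3)] by simp
qed

lemma card_at:
  "card {h. fst h \<in> E \<and> g h = u \<and> P (fst h)} = card {e \<in> dl E g {u}. P e}"
proof -
  have "{e \<in> dl E g {u}. P e} = fst ` {h. fst h \<in> E \<and> g h = u \<and> P (fst h)}"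
    unfolding dl_single image_def by blast
  moreover have "inj_on fst {h. fst h \<in> E \<and> g h = u \<and> P (fst h)}"
    by (rule inj_on_subset[OF inj_fst[of u]]) auto
  ultimately show ?thesis by (simp add: card_image)
qed

lemma lab_Inl:
  assumes "e \<in> E"
  shows "lab e = Inl w \<longleftrightarrow> w \<notin> T \<and> e \<in> dl E g {w}"
  using edge_ends[OF assms] assms unfolding lab_def dl_def by auto

lemma lab_Inr: "lab e = Inr e' \<longleftrightarrow> e' = e \<and> g (e, False) \<in> T \<and> g (e, True) \<in> T"
  unfolding lab_def by auto

lemma finite_H: "finite H"
  by (rule finite_subset[of _ "E \<times> UNIV"]) (use finE in auto)

lemma H_dl: 
  assumes "w \<notin> T"
  shows "{h \<in> H. lk h = Inl w} = {h. fst h \<in> E \<and> g (flip h) = w}"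
proof (intro set_eqI iffI)
  fix h assume "h \<in> {h \<in> H. lk h = Inl w}"
  then have h: "fst h \<in> E" "g h \<in> T" "lk h = Inl w" by auto
  then obtain h' where h': "fst h' = fst h" "g h' = w" using lab_Inl[of "fst h" w] dl_single[of "fst h" w] by auto
  have "h' \<noteq> h" using h h' assms by auto
  then have "h' = flip h" using same_edge[of h h'] h'(1) by simp
  then show "h \<in> {h. fst h \<in> E \<and> g (flip h) = w}" using h h' by simp
next
  fix h assume "h \<in> {h. fst h \<in> E \<and> g (flip h) = w}"
  then have h: "fst h \<in> E" "g (flip h) = w" by auto
  have "fst h \<in> dl E g {w}" unfolding dl_single using h by (intro exI[of _ "flip h"]) simp
  then have "lk h = Inl w" using lab_Inl[OF h(1)] assms by simp
  moreover have "g h \<in> T" using half_ends(2)[OF h(1)] h(2) assms by simp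
  ultimately show "h \<in> {h \<in> H. lk h = Inl w}" using h(1) by simp
qed

lemma card_w:
  assumes w: "w \<notin> T"
  shows "card {h \<in> H. lk h = Inl w} = card (dl E g {w})"
proof -
  have "{h \<in> H. lk h = Inl w} = flip ` {h. fst h \<in> E \<and> g h = w}"
    unfolding H_dl[OF w]
  proof (intro set_eqI iffI)
    fix h assume "h \<in> {h. fst h \<in> E \<and> g (flip h) = w}"
    then show "h \<in> flip ` {h. fst h \<in> E \<and> g h = w}" by (intro image_eqI[of _ _ "flip h"]) auto
  qed auto
  moreover have "inj_on flip A" for A :: "('e \<times> bool) set" by (rule inj_onI) (metis flip_simps(2))
  ultimately have "card {h \<in> H. lk h = Inl w} = card {h. fst h \<in> E \<and> g h = w}" by (simp add: card_image)
  then show ?thesis using card_at[of w "\<lambda>_. True"] by simp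
qed

text \<open>Adding \<open>w\<close> to the tight terminal \<open>nb w e\<close> keeps
  \<open>T\<close> separated, so the cut cannot shrink, and parallel edges make up at most half of
  the degree. With degree at most three there are none, and a nonterminal with an edge has degree at
  least two.\<close>

lemma btw_half:
  assumes w: "w \<notin> T" and e: "e \<in> dl E g {w}"
  shows "2 * card {f \<in> dl E g {w}. nb w f = nb w e} \<le> card (dl E g {w})"
proof -
  let ?t = "nb w e"
  note n = nb[OF w e]
  have tw: "?t \<noteq> w" using n(1) w by metis
  have "T - {?t} \<noteq> {}" using T2 vT by blast
  then have "6 * k + 6 \<le> card (dl E g ({?t} \<union> {w}))"
    using n(1) w by (intro cuts) auto
  moreover have "btw E g {?t} {w} = {f \<in> dl E g {w}. nb w f = ?t}"
    using btw_nb[OF w, of "{?t}"] tw by simp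
  moreover have "dl E g {} = {}" unfolding dl_def by simp
  moreover have "{?t} \<inter> {w} = {}" "{?t} - {w} = {?t}" "{w} - {?t} = {w}" using tw by auto
  ultimately show ?thesis using dl_Int_Un[OF finE, of g "{?t}" "{w}"] n(2) by simp
qed

lemma nb_flip:
  assumes "w \<notin> T" "fst h \<in> E" "g (flip h) = w"
  shows "nb w (fst h) = g h"
proof -
  have "g h \<noteq> w" using half_ends(1)[of h] assms by auto
  then show ?thesis using assms unfolding nb_def flip_def by (cases h; cases "snd h"; auto)
qed

lemma unique_nb:
  assumes w: "w \<notin> T" and e: "e \<in> dl E g {w}" and f: "f \<in> dl E g {w}" and eq: "nb w e = nb w f"
  shows "e = f"
proof (rule ccontr)
  assume "e \<noteq> f"
  then have "card {e, f} \<le> card {f \<in> dl E g {w}. nb w f = nb w e}"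
    using e f eq finE by (intro card_mono) auto
  then show False using btw_half[OF w e] deg3[OF w] \<open>e \<noteq> f\<close> by simp
qed

lemma deg2:
  assumes w: "w \<notin> T" and e: "e \<in> dl E g {w}"
  shows "2 \<le> card (dl E g {w})"
proof -
  have "card {e} \<le> card {f \<in> dl E g {w}. nb w f = nb w e}"
    using e finE by (intro card_mono) auto
  then show ?thesis using btw_half[OF w e] by simp
qed

lemma lk_inj:
  assumes "h \<in> H" "h' \<in> H" "lk h = lk h'" "g h = g h'"
  shows "h = h'"
proof (cases "lk h")
  case (Inl w)
  then have w: "w \<notin> T" using lab_Inl[of "fst h"] assms(1) by blast
  have m: "g (flip h) = w" "g (flip h') = w"
    using H_dl[OF w] assms(1,2,3) Inl by auto
  have "fst h = fst h'"
  proof (rule unique_nb[OF w])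
    show "fst h \<in> dl E g {w}" "fst h' \<in> dl E g {w}"
      using lab_Inl[of "fst h" w] lab_Inl[of "fst h'" w] assms Inl by auto
    show "nb w (fst h) = nb w (fst h')"
      using nb_flip[OF w _ m(1)] nb_flip[OF w _ m(2)] assms by simp
  qed
  then show ?thesis using inj_onD[OF inj_fst[of "g h"], of h h'] assms by simp
next
  case (Inr a)
  then have "fst h = fst h'" using assms(3) lab_Inr by metis
  then show ?thesis using inj_onD[OF inj_fst[of "g h"], of h h'] assms by simp
qed

lemma lk_size:
  assumes h: "h \<in> H"
  shows "card {h' \<in> H. lk h' = lk h} = 2 \<or> card {h' \<in> H. lk h' = lk h} = 3"
proof (cases "lk h")
  case (Inl w)
  then have w: "w \<notin> T" "fst h \<in> dl E g {w}" using lab_Inl[of "fst h"] h by blast+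
  then show ?thesis using card_w[OF w(1)] deg2[OF w] deg3[OF w(1)] Inl by auto
next
  case (Inr a)
  have "{h' \<in> H. lk h' = lk h} = {(a, False), (a, True)}"
  proof -
    have a: "a = fst h" "g (a, False) \<in> T" "g (a, True) \<in> T" using Inr lab_Inr by metis+
    then have "{h' \<in> H. lk h' = lk h} = {h' \<in> H. fst h' = a}" using Inr lab_Inr by metis
    also have "\<dots> = {(a, False), (a, True)}" using a h by (auto simp: prod_eq_iff)
    finally show ?thesis .
  qed
  then show ?thesis by simp
qed

text \<open>A nonterminal with at least two neighbours in \<open>X\<close> is put on the side of
  \<open>X\<close>. As its degree is at most three, at most one of its edges then crosses, so the
  crossing edges have distinct labels, all of them links in the cut. Thus the edge-cut condition
  carries over to links.\<close>

lemma lk_cut: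
  assumes X: "X \<subseteq> T" "X \<noteq> {}" "X \<noteq> T"
  shows "6 * k + 6 \<le> card (link_cut H g lk X)"
proof -
  define M where "M = {w. w \<notin> T \<and> 2 \<le> card {h \<in> H. lk h = Inl w \<and> g h \<in> X}}"
  define A where "A w = {h \<in> H. lk h = Inl w \<and> g h \<in> X}" for w
  define B where "B w = {h \<in> H. lk h = Inl w \<and> g h \<notin> X}" for w
  have finAB: "finite (A w)" "finite (B w)" for w
    unfolding A_def B_def by (rule finite_subset[OF _ finite_H], blast)+
  have AB: "card (A w) + card (B w) = card (dl E g {w})" if "w \<notin> T" for w
  proof -
    have "A w \<union> B w = {h \<in> H. lk h = Inl w}" "A w \<inter> B w = {}" unfolding A_def B_def by auto
    then show ?thesis using card_w[OF that] finAB by (metis card_Un_disjoint)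
  qed
  have "X \<inter> T = X" "T - (X \<union> M) = T - X" using X unfolding M_def by auto
  then have K: "6 * k + 6 \<le> card (dl E g (X \<union> M))" using X by (intro cuts) auto
  have ex: "\<exists>h. fst h = e \<and> h \<in> H \<and> ((g h \<in> X) \<noteq> (g (flip h) \<in> X \<union> M))" if e: "e \<in> dl E g (X \<union> M)" for e
  proof -
    have eE: "e \<in> E" using e unfolding dl_def by simp
    have MT: "M \<inter> T = {}" unfolding M_def by blast
    show ?thesis
    proof (cases "g (e, False) \<in> T")
      case True
      then show ?thesis using e eE MT by (intro exI[of _ "(e, False)"]) (auto simp: dl_def flip_def)
    next
      case False
      then have "g (e, True) \<in> T" using edge_ends[OF eE] by simp
      then show ?thesis using e eE MT by (intro exI[of _ "(e, True)"]) (auto simp: dl_def flip_def)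
    qed
  qed
  have w_side: "(h \<in> A w \<and> card (A w) \<le> 1) \<or> (h \<in> B w \<and> 2 \<le> card (A w))"
    if h: "h \<in> H" "(g h \<in> X) \<noteq> (g (flip h) \<in> X \<union> M)" and l: "lk h = Inl w" for h w
  proof -
    have w: "w \<notin> T" using lab_Inl[of "fst h"] h l by blast
    have fw: "g (flip h) = w" using H_dl[OF w] h l by blast
    have "w \<notin> X" using w X by blast
    then show ?thesis using h l w fw unfolding A_def B_def M_def by auto
  qed
  have "lab ` dl E g (X \<union> M) \<subseteq> link_cut H g lk X"
  proof
    fix l assume "l \<in> lab ` dl E g (X \<union> M)"
    then obtain e where e: "e \<in> dl E g (X \<union> M)" "l = lab e" by blast
    obtain h where h: "fst h = e" "h \<in> H" "(g h \<in> X) \<noteq> (g (flip h) \<in> X \<union> M)" using ex[OF e(1)] by blast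
    have "\<exists>h'\<in>H. lk h' = l \<and> (g h' \<in> X) \<noteq> (g h \<in> X)"
    proof (cases l)
      case (Inl w)
      then have lw: "lk h = Inl w" using e h by simp
      have w: "w \<notin> T" "fst h \<in> dl E g {w}" using lab_Inl[of "fst h"] h lw by blast+
      have d: "2 \<le> card (A w) + card (B w)" using AB[OF w(1)] deg2[OF w] by simp
      from w_side[OF h(2,3) lw] show ?thesis
      proof
        assume a: "h \<in> A w \<and> card (A w) \<le> 1"
        then have "B w \<noteq> {}" using d by auto
        then show ?thesis using a Inl unfolding A_def B_def by blast
      next
        assume a: "h \<in> B w \<and> 2 \<le> card (A w)"
        then have "A w \<noteq> {}" by auto
        then show ?thesis using a Inl unfolding A_def B_def by blast
      qed
    next
      case (Inr a)
      then have a: "a = e" "g (e, False) \<in> T" "g (e, True) \<in> T" using e(2) lab_Inr by metis+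
      then have fT: "g (flip h) \<in> T" using h(1) unfolding flip_def by (cases "snd h") auto
      then have "g (flip h) \<notin> M" unfolding M_def by blast
      then show ?thesis using h fT e(2) by (intro bexI[of _ "flip h"]) auto
    qed
    moreover have "lk h = l" using h(1) e(2) by simp
    ultimately show "l \<in> link_cut H g lk X" using h(2) unfolding link_cut_def by blast
  qed
  moreover have "inj_on lab (dl E g (X \<union> M))"
  proof (rule inj_onI, rule ccontr)
    fix e f assume e: "e \<in> dl E g (X \<union> M)" and f: "f \<in> dl E g (X \<union> M)" and eq: "lab e = lab f" and ne: "e \<noteq> f"
    obtain h where h: "fst h = e" "h \<in> H" "(g h \<in> X) \<noteq> (g (flip h) \<in> X \<union> M)" using ex[OF e] by blast
    obtain h' where h': "fst h' = f" "h' \<in> H" "(g h' \<in> X) \<noteq> (g (flip h') \<in> X \<union> M)" using ex[OF f] by blast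
    have hne: "h \<noteq> h'" using ne h h' by auto
    show False
    proof (cases "lab e")
      case (Inl w)
      then have lw: "lk h = Inl w" "lk h' = Inl w" using h h' eq by simp_all
      have w: "w \<notin> T" using lab_Inl[of "fst h"] h lw by blast
      have two: "2 \<le> card S" if "h \<in> S" "h' \<in> S" "finite S" for S
        using card_mono[OF that(3), of "{h, h'}"] that hne by simp
      consider "h \<in> A w" "h' \<in> A w" "card (A w) \<le> 1" | "h \<in> B w" "h' \<in> B w" "2 \<le> card (A w)"
        using w_side[OF h(2,3) lw(1)] w_side[OF h'(2,3) lw(2)] by linarith
      then show False
      proof cases
        case 1
        then show False using two[of "A w"] finAB by simp
      next
        case 2
        then show False using two[of "B w"] finAB AB[OF w] deg3[OF w] by simp
      qed
    next
      case (Inr a)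
      then show False using eq ne lab_Inr by metis
    qed
  qed
  moreover have "finite (link_cut H g lk X)"
  proof (rule finite_subset)
    show "link_cut H g lk X \<subseteq> lk ` H" unfolding link_cut_def by blast
    show "finite (lk ` H)" using finite_H by (rule finite_imageI)
  qed
  ultimately have "card (dl E g (X \<union> M)) \<le> card (link_cut H g lk X)"
    using card_inj_on_le by blast
  then show ?thesis using K by simp
qed

sublocale ls: link_system H g lk T v k
proof
  show "card {h \<in> H. g h = v} = 6 * k + 6"
  proof -
    have "{h \<in> H. g h = v} = {h. fst h \<in> E \<and> g h = v \<and> True}" using vT by auto
    then show ?thesis using card_at[of v "\<lambda>_. True"] degv by simp
  qed
  show "finite H" "finite T" "v \<in> T" by (fact finite_H finT vT)+
  show "g h \<in> T" if "h \<in> H" for h using that by simp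
  show "card {h' \<in> H. lk h' = lk h} = 2 \<or> card {h' \<in> H. lk h' = lk h} = 3" if "h \<in> H" for h
    using that by (rule lk_size)
  show "h = h'" if "h \<in> H" "h' \<in> H" "lk h = lk h'" "g h = g h'" for h h'
    using that by (rule lk_inj)
  show "6 * k + 6 \<le> card (link_cut H g lk X)" if "X \<subseteq> T" "X \<noteq> {}" "X \<noteq> T" for X
    using that by (rule lk_cut)
qed

lemma card_good: "t \<in> T \<Longrightarrow> card {h \<in> H. g h = t \<and> P (fst h)} = card {e \<in> dl E g {t}. P e}"
proof -
  assume "t \<in> T"
  then have "{h \<in> H. g h = t \<and> P (fst h)} = {h. fst h \<in> E \<and> g h = t \<and> P (fst h)}" by auto
  then show ?thesis using card_at[of t P] by simp
qed

text \<open>An edge between two terminals is a link by itself, so both of its halves have one colour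
  and \<open>c\<close> is well defined on edges. At a nonterminal \<open>extends_partner\<close>
  leaves at most two coloured edges, and \<open>\<mu>\<close> pairs them.\<close>

lemma link_routing:
  assumes ext: "ls.extends \<phi>' good' r \<psi>" and \<phi>': "\<phi>' = (\<lambda>h. \<phi> (fst h))"
    and good': "good' = {h. fst h \<in> good (g h)}"
  shows "\<exists>c \<mu>. routing E g T v k c \<mu> \<and> served E g T v good r c \<and> (\<forall>e\<in>dl E g {v}. c e = \<phi> e)"
proof -
  have le: "\<And>h. h \<in> H \<Longrightarrow> \<psi> h \<le> k" and atv: "\<And>h. h \<in> H \<Longrightarrow> g h = v \<Longrightarrow> \<psi> h = \<phi>' h"
    and con: "\<And>i s t. i \<in> {1..k} \<Longrightarrow> s \<in> T - {v} \<Longrightarrow> t \<in> T - {v} \<Longrightarrow> (s, t) \<in> lnk (ls.joined \<psi> i)"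
    and dem: "\<And>t. t \<in> T - {v} \<Longrightarrow> r t \<le> card {h \<in> H. g h = t \<and> h \<in> good' \<and> \<psi> h = 0}"
    using ext unfolding ls.extends_def ls.T'_def by blast+
  note two = ls.extends_partner[OF ext]
  have direct: "\<psi> (flip h) = \<psi> h" if h: "h \<in> H" "flip h \<in> H" for h
  proof -
    have l: "lk (flip h) = lk h" by simp
    have r: "lab (fst h) = Inr (fst h)" using h lab_Inr[of "fst h" "fst h"] unfolding flip_def by (cases h; cases "snd h"; auto)
    have only: "h' = h \<or> h' = flip h" if "lk h' = lk h" for h'
      using that r lab_Inr[of "fst h'" "fst h"] same_edge by metis
    show ?thesis using two[OF h(1)] two[OF h(2)] only l by (metis flip_simps(2))
  qed
  define c where "c e = \<psi> (if g (e, False) \<in> T then (e, False) else (e, True))" for e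
  have c: "c (fst h) = \<psi> h" if h: "h \<in> H" for h
  proof (cases "snd h")
    case False
    then have "h = (fst h, False)" by (simp add: prod_eq_iff)
    then show ?thesis using h unfolding c_def by (metis (mono_tags, lifting) mem_Collect_eq)
  next
    case True
    then have hh: "h = (fst h, True)" "flip h = (fst h, False)" unfolding flip_def by (simp_all add: prod_eq_iff)
    show ?thesis
    proof (cases "g (fst h, False) \<in> T")
      case True
      then have "flip h \<in> H" using h hh(2) by simp
      then show ?thesis using direct[OF h] hh(2) True unfolding c_def by simp
    next
      case False
      then show ?thesis using hh(1) unfolding c_def by simp
    qed
  qed
  define \<mu> where "\<mu> h = (SOME h'. fst h' \<in> E \<and> h' \<noteq> h \<and> g h' = g h \<and> c (fst h') \<noteq> 0)" for h
  have wH: "flip h \<in> H" "lk (flip h) = Inl (g h)" if "fst h \<in> E" "g h \<notin> T" for h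
  proof -
    have "flip h \<in> {h' \<in> H. lk h' = Inl (g h)}" unfolding H_dl[OF that(2)] using that by simp
    then show "flip h \<in> H" "lk (flip h) = Inl (g h)" by auto
  qed
  have mu: "fst (\<mu> h) \<in> E \<and> \<mu> h \<noteq> h \<and> g (\<mu> h) = g h \<and> c (fst (\<mu> h)) = c (fst h) \<and>
      (\<forall>h'. fst h' \<in> E \<and> g h' = g h \<and> c (fst h') \<noteq> 0 \<longrightarrow> h' = h \<or> h' = \<mu> h)"
    if h: "fst h \<in> E" "c (fst h) \<noteq> 0" "g h \<notin> T" for h
  proof -
    note f = wH[OF h(1,3)]
    have "\<psi> (flip h) \<noteq> 0" using c[OF f(1)] h(2) by simp
    from two[OF f(1) this] obtain h2 where h2: "h2 \<in> H" "h2 \<noteq> flip h" "lk h2 = lk (flip h)" "\<psi> h2 = \<psi> (flip h)"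
      "\<forall>h'\<in>H. lk h' = lk (flip h) \<and> \<psi> h' \<noteq> 0 \<longrightarrow> h' = flip h \<or> h' = h2" by blast
    have "h2 \<in> {h' \<in> H. lk h' = Inl (g h)}" using h2(1,3) f(2) by simp
    then have g2: "g (flip h2) = g h" unfolding H_dl[OF h(3)] by simp
    have all: "h' = h \<or> h' = flip h2" if h': "fst h' \<in> E" "g h' = g h" "c (fst h') \<noteq> 0" for h'
    proof -
      have g': "g h' \<notin> T" using h' h by simp
      note f' = wH[OF h'(1) g']
      have "\<psi> (flip h') \<noteq> 0" using c[OF f'(1)] h'(3) by simp
      moreover have "lk (flip h') = lk (flip h)" using f' f h' by simp
      ultimately have "flip h' = flip h \<or> flip h' = h2" using h2(5) f'(1) by blast
      then show ?thesis by (metis flip_simps(2))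
    qed
    have c2: "c (fst (flip h2)) = c (fst h)" using c[OF h2(1)] c[OF f(1)] h2(4) by simp
    have P2: "fst (flip h2) \<in> E \<and> flip h2 \<noteq> h \<and> g (flip h2) = g h \<and> c (fst (flip h2)) \<noteq> 0"
      using h2 g2 c2 h by auto
    have m: "\<mu> h = flip h2" unfolding \<mu>_def
      by (rule some_equality) (use P2 all in blast)+
    have "\<forall>h'. fst h' \<in> E \<and> g h' = g h \<and> c (fst h') \<noteq> 0 \<longrightarrow> h' = h \<or> h' = \<mu> h"
      unfolding m using all by blast
    moreover have "fst (\<mu> h) \<in> E \<and> \<mu> h \<noteq> h \<and> g (\<mu> h) = g h \<and> c (fst (\<mu> h)) = c (fst h)"
      unfolding m using P2 c2 by simp
    ultimately show ?thesis by blast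
  qed
  have pair: "paired E g T c \<mu>" unfolding paired_def
  proof (intro allI impI)
    fix h assume h: "fst h \<in> E \<and> c (fst h) \<noteq> 0 \<and> g h \<notin> T"
    then have m: "fst (\<mu> h) \<in> E" "\<mu> h \<noteq> h" "g (\<mu> h) = g h" "c (fst (\<mu> h)) = c (fst h)" 
      "\<forall>h'. fst h' \<in> E \<and> g h' = g h \<and> c (fst h') \<noteq> 0 \<longrightarrow> h' = h \<or> h' = \<mu> h" using mu[of h] by blast+
    have "fst (\<mu> (\<mu> h)) \<in> E" "\<mu> (\<mu> h) \<noteq> \<mu> h" "g (\<mu> (\<mu> h)) = g h" "c (fst (\<mu> (\<mu> h))) = c (fst h)"
      using mu[of "\<mu> h"] m h by auto
    then have "\<mu> (\<mu> h) = h" using m(5) h by metis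
    then show "fst (\<mu> h) \<in> E \<and> \<mu> h \<noteq> h \<and> \<mu> (\<mu> h) = h \<and> g (\<mu> h) = g h \<and> c (fst (\<mu> h)) = c (fst h)"
      using m by blast
  qed
  let ?hop = "hop E g T v c \<mu>"
  have flipped: "(h, flip h) \<in> lnk (?hop (c (fst h)))" if "fst h \<in> E" for h
    by (rule lnk_base) (use that in \<open>simp add: hop_def\<close>)
  have link: "(h, h') \<in> lnk (?hop (\<psi> h))" if h: "h \<in> H" "h' \<in> H" "lk h = lk h'" "\<psi> h \<noteq> 0" "\<psi> h' = \<psi> h" for h h'
  proof (cases "lk h")
    case (Inr e)
    then have "fst h = fst h'" using h(3) lab_Inr by metis
    then have "h' = h \<or> h' = flip h" by (rule same_edge)
    then show ?thesis using flipped[of h] c[OF h(1)] h by auto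
  next
    case (Inl w)
    then have w: "w \<notin> T" using lab_Inl[of "fst h"] h by blast
    have fw: "g (flip h) = w" "g (flip h') = w" using H_dl[OF w] h Inl by auto
    have cc: "c (fst h) = \<psi> h" "c (fst h') = \<psi> h" using c h by auto
    have fE: "fst h \<in> E" "fst h' \<in> E" using h by auto
    have m: "\<forall>h''. fst h'' \<in> E \<and> g h'' = w \<and> c (fst h'') \<noteq> 0 \<longrightarrow> h'' = flip h \<or> h'' = \<mu> (flip h)"
      using mu[of "flip h"] fE cc fw w h(4) by simp
    have "fst (flip h') \<in> E \<and> g (flip h') = w \<and> c (fst (flip h')) \<noteq> 0"
      using fE cc fw h(4) by simp
    then have "flip h' = flip h \<or> flip h' = \<mu> (flip h)" using m by blast
    then show ?thesis
    proof
      assume "flip h' = flip h"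
      then have "h' = h" by (metis flip_simps(2))
      then show ?thesis by simp
    next
      assume fm: "flip h' = \<mu> (flip h)"
      have "(flip h, flip h') \<in> ?hop (\<psi> h)"
        by (rule hopI(2)) (fact fm | use fE cc fw(1) w in \<open>simp; fail\<close>)+
      then have "(flip h, flip h') \<in> lnk (?hop (\<psi> h))" by (rule lnk_base)
      moreover have "(h, flip h) \<in> lnk (?hop (\<psi> h))" "(flip h', h') \<in> lnk (?hop (\<psi> h))"
        using flipped[OF fE(1)] flipped[of "flip h'"] fE cc by simp_all
      ultimately show ?thesis using lnk_trans by metis
    qed
  qed
  have conn: "reach E g T v c \<mu> i s t" if i: "i \<in> {1..k}" and s: "s \<in> T - {v}" and t: "t \<in> T - {v}" and st: "s \<noteq> t" for i s t
  proof -
    define M where "M = {(s, t). s = t \<or> (s \<in> T - {v} \<and> t \<in> T - {v} \<and> reach E g T v c \<mu> i s t)}"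
    have sym: "reach E g T v c \<mu> i t s" if "reach E g T v c \<mu> i s t" for s t
      using that unfolding reach_def by (metis lnk_sym)
    have trans: "reach E g T v c \<mu> i s u" if st: "reach E g T v c \<mu> i s t" and tu: "reach E g T v c \<mu> i t u" and t: "t \<in> T - {v}" for s t u
    proof -
      obtain h1 h2 where a: "fst h1 \<in> E" "fst h2 \<in> E" "c (fst h1) = i" "c (fst h2) = i" "g h1 = s" "g h2 = t" "(h1, h2) \<in> lnk (?hop i)"
        using st unfolding reach_def by blast
      obtain h3 h4 where b: "fst h3 \<in> E" "fst h4 \<in> E" "c (fst h3) = i" "c (fst h4) = i" "g h3 = t" "g h4 = u" "(h3, h4) \<in> lnk (?hop i)"
        using tu unfolding reach_def by blast
      have "(h2, h3) \<in> ?hop i" by (rule hopI(3)) (use a b t in simp_all)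
      then have "(h1, h4) \<in> lnk (?hop i)" using a(7) b(7) lnk_trans lnk_base by metis
      then show ?thesis using a b unfolding reach_def by blast
    qed
    have "lnk (ls.joined \<psi> i) \<subseteq> M"
    proof (rule lnk_least)
      show "ls.joined \<psi> i \<subseteq> M"
      proof
        fix p assume "p \<in> ls.joined \<psi> i"
        then obtain h h' where h: "p = (g h, g h')" "h \<in> H" "h' \<in> H" "lk h = lk h'" "\<psi> h = i" "\<psi> h' = i" "g h \<noteq> v" "g h' \<noteq> v"
          unfolding ls.joined_def by blast
        have "(h, h') \<in> lnk (?hop i)" using link[OF h(2-4)] h(5,6) i by simp
        moreover have "c (fst h) = i" "c (fst h') = i" using c h by simp_all
        ultimately have "reach E g T v c \<mu> i (g h) (g h')" using h unfolding reach_def by blast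
        then show "p \<in> M" using h unfolding M_def by simp
      qed
      show "(x, y) \<in> M \<Longrightarrow> (y, x) \<in> M" for x y using sym[of x y] unfolding M_def by auto
      show "(x, z) \<in> M" if "(x, y) \<in> M" "(y, z) \<in> M" for x y z
        using that trans[of x y z] unfolding M_def by auto
    qed (simp add: M_def)
    then have "(s, t) \<in> M" using con[OF i s t] by blast
    then show ?thesis using st unfolding M_def by simp
  qed
  have attach: "\<exists>h'. fst h' \<in> E \<and> g h' \<in> T - {v} \<and> c (fst h') = c (fst h) \<and> (h, h') \<in> lnk (?hop (c (fst h)))"
    if h: "fst h \<in> E" "c (fst h) \<noteq> 0" "g h = v" for h
  proof -
    have hH: "h \<in> H" using h vT by simp
    have ch: "c (fst h) = \<psi> h" by (rule c[OF hH])
    have "\<psi> h \<noteq> 0" using h ch by simp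
    from two[OF hH this] obtain h2 where h2H: "h2 \<in> H" and h2': "h2 \<noteq> h \<and> lk h2 = lk h \<and> \<psi> h2 = \<psi> h \<and>
      (\<forall>h'\<in>H. lk h' = lk h \<and> \<psi> h' \<noteq> 0 \<longrightarrow> h' = h \<or> h' = h2)" by (rule bexE)
    note h2 = h2H h2'[THEN conjunct1] h2'[THEN conjunct2, THEN conjunct1] h2'[THEN conjunct2, THEN conjunct2, THEN conjunct1]
    have "g h2 \<noteq> v" using lk_inj[OF h2(1) hH h2(3)] h2(2) h(3) by metis
    moreover have "(h, h2) \<in> lnk (?hop (\<psi> h))" using link[OF hH h2(1)] h2 h ch by simp
    ultimately show ?thesis using h2(1,4) ch c[OF h2(1)] by (intro exI[of _ h2]) simp
  qed
  have cle: "c e \<le> k" if "e \<in> E" for e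
  proof -
    have "\<exists>h. fst h = e \<and> h \<in> H"
    proof (cases "g (e, False) \<in> T")
      case True
      then show ?thesis using that by (intro exI[of _ "(e, False)"]) simp
    next
      case False
      then show ?thesis using that edge_ends(2)[OF that] by (intro exI[of _ "(e, True)"]) simp
    qed
    then show ?thesis using c le by metis
  qed
  have "routing E g T v k c \<mu>" unfolding routing_def using cle pair conn attach by blast
  moreover have "served E g T v good r c" unfolding served_def
  proof
    fix t assume t: "t \<in> T - {v}"
    have "{h \<in> H. g h = t \<and> h \<in> good' \<and> \<psi> h = 0} = {h \<in> H. g h = t \<and> (fst h \<in> good t \<and> c (fst h) = 0)}"
      using c unfolding good' by auto
    then have "card {h \<in> H. g h = t \<and> h \<in> good' \<and> \<psi> h = 0} = card {e \<in> dl E g {t}. e \<in> good t \<and> c e = 0}"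
      using card_good[of t "\<lambda>e. e \<in> good t \<and> c e = 0"] t by simp
    moreover have "{e \<in> dl E g {t}. e \<in> good t \<and> c e = 0} = {e \<in> dl E g {t} \<inter> good t. c e = 0}" by blast
    ultimately show "r t \<le> card {e \<in> dl E g {t} \<inter> good t. c e = 0}" using dem[OF t] by (simp only:)
  qed
  moreover have "\<forall>e\<in>dl E g {v}. c e = \<phi> e"
  proof
    fix e assume e: "e \<in> dl E g {v}"
    then obtain h where h: "fst h = e" "e \<in> E" "g h = v" unfolding dl_single by blast
    then have "h \<in> H" using vT by simp
    then show "c e = \<phi> e" using c[of h] atv[of h] \<phi>' h by simp
  qed
  ultimately show ?thesis by blast
qed

theorem star_solvable: "solvable E g T v k"
  unfolding solvable_def
proof (intro allI impI)
  fix good :: "'v \<Rightarrow> 'e set" and r :: "'v \<Rightarrow> nat"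
  assume dem: "demand E g T v k good r"
  define good' where "good' = {h. fst h \<in> good (g h)}"
  have "ls.valid_demand good' r" unfolding ls.valid_demand_def ls.T'_def
  proof
    fix t assume t: "t \<in> T - {v}"
    have "{h \<in> H. g h = t \<and> h \<notin> good'} = {h \<in> H. g h = t \<and> fst h \<notin> good t}" unfolding good'_def by auto
    then have "card {h \<in> H. g h = t \<and> h \<notin> good'} = card {e \<in> dl E g {t}. e \<notin> good t}"
      using card_good[of t "\<lambda>e. e \<notin> good t"] t by simp
    moreover have "{e \<in> dl E g {t}. e \<notin> good t} = dl E g {t} - good t" by blast
    moreover have "card {h \<in> H. g h = t} = card (dl E g {t})" using card_good[of t "\<lambda>_. True"] t by simp
    ultimately show "r t = 0 \<or> (card {h \<in> H. g h = t} = 6 * k + 6 \<and> 2 * r t + card {h \<in> H. g h = t \<and> h \<notin> good'} \<le> 2 * k)"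
      using dem t unfolding demand_def by auto
  qed
  then obtain gv rv where gv: "2 * rv + card {h \<in> H. g h = v \<and> h \<notin> gv} \<le> 2 * k"
    and ext: "\<And>\<phi>. (\<forall>h. \<phi> h \<le> k) \<Longrightarrow> rv \<le> card {h \<in> H. g h = v \<and> h \<in> gv \<and> \<phi> h = 0} \<Longrightarrow> \<exists>\<psi>. ls.extends \<phi> good' r \<psi>"
    using ls.link_extension[of good' r] T2 unfolding ls.T'_def by blast
  define gE where "gE = {e. \<exists>h. fst h = e \<and> g h = v \<and> h \<in> gv}"
  have gE: "fst h \<in> gE \<longleftrightarrow> h \<in> gv" if "h \<in> H" "g h = v" for h
  proof
    assume "fst h \<in> gE"
    then obtain h' where h': "fst h' = fst h" "g h' = v" "h' \<in> gv" unfolding gE_def by blast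
    then have "h' = h" using inj_onD[OF inj_fst[of v], of h' h] that by simp
    then show "h \<in> gv" using h' by simp
  qed (use that in \<open>unfold gE_def, blast\<close>)
  show "\<exists>gv rv. 2 * rv + card (dl E g {v} - gv) \<le> 2 * k \<and>
       (\<forall>\<phi>. (\<forall>e. \<phi> e \<le> k) \<and> rv \<le> card {e \<in> dl E g {v} \<inter> gv. \<phi> e = 0} \<longrightarrow>
         (\<exists>c \<mu>. routing E g T v k c \<mu> \<and> served E g T v good r c \<and> (\<forall>e\<in>dl E g {v}. c e = \<phi> e)))"
  proof (intro exI[of _ gE] exI[of _ rv] conjI allI impI)
    have "{h \<in> H. g h = v \<and> h \<notin> gv} = {h \<in> H. g h = v \<and> fst h \<notin> gE}" using gE by blast
    moreover have "{e \<in> dl E g {v}. e \<notin> gE} = dl E g {v} - gE" by blast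
    ultimately show "2 * rv + card (dl E g {v} - gE) \<le> 2 * k"
      using gv card_good[OF vT, of "\<lambda>e. e \<notin> gE"] by simp
  next
    fix \<phi> :: "'e \<Rightarrow> nat"
    assume \<phi>: "(\<forall>e. \<phi> e \<le> k) \<and> rv \<le> card {e \<in> dl E g {v} \<inter> gE. \<phi> e = 0}"
    have "{h \<in> H. g h = v \<and> h \<in> gv \<and> \<phi> (fst h) = 0} = {h \<in> H. g h = v \<and> (fst h \<in> gE \<and> \<phi> (fst h) = 0)}"
      using gE by blast
    moreover have "{e \<in> dl E g {v}. e \<in> gE \<and> \<phi> e = 0} = {e \<in> dl E g {v} \<inter> gE. \<phi> e = 0}" by blast
    ultimately have "rv \<le> card {h \<in> H. g h = v \<and> h \<in> gv \<and> \<phi> (fst h) = 0}"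
      using \<phi> card_good[OF vT, of "\<lambda>e. e \<in> gE \<and> \<phi> e = 0"] by simp
    then obtain \<psi> where "ls.extends (\<lambda>h. \<phi> (fst h)) good' r \<psi>" using ext[of "\<lambda>h. \<phi> (fst h)"] \<phi> by blast
    then show "\<exists>c \<mu>. routing E g T v k c \<mu> \<and> served E g T v good r c \<and> (\<forall>e\<in>dl E g {v}. c e = \<phi> e)"
      by (rule link_routing) (auto simp: good'_def)
  qed
qed

end

lemma pairedD:
  assumes "paired E g T c \<mu>" "fst h \<in> E" "c (fst h) \<noteq> 0" "g h \<notin> T"
  shows "fst (\<mu> h) \<in> E" "\<mu> h \<noteq> h" "\<mu> (\<mu> h) = h" "g (\<mu> h) = g h" "c (fst (\<mu> h)) = c (fst h)"
  using assms unfolding paired_def by blast+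

lemma reachI:
  assumes "fst h \<in> E" "fst h' \<in> E" "c (fst h) = i" "c (fst h') = i" "g h = s" "g h' = t"
    "(h, h') \<in> lnk (hop E g T v c \<mu> i)"
  shows "reach E g T v c \<mu> i s t"
  using assms unfolding reach_def by blast

lemma reach_sym: "reach E g T v c \<mu> i s t \<Longrightarrow> reach E g T v c \<mu> i t s"
  unfolding reach_def by (elim exE conjE) (drule lnk_sym, blast)

section \<open>Reductions\<close>

definition contract_edges where "contract_edges E g X = {e \<in> E. g (e, False) \<in> X \<or> g (e, True) \<in> X}"

text \<open>The outside of \<open>X\<close> goes to a terminal \<open>t\<close> that already exists
  there. Types and edge labels stay the same, so cuts and colourings of the two sides can be
  compared directly.\<close>

definition contract_map where "contract_map g X t h = (if g h \<in> X then g h else t)"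

lemma dl_compl: "dl E g (- X) = dl E g X"
  unfolding dl_def by auto

lemma dl_half: "fst h \<in> dl E g X \<longleftrightarrow> fst h \<in> E \<and> (g h \<in> X) \<noteq> (g (flip h) \<in> X)"
  unfolding dl_def flip_def by (cases h; cases "snd h") auto

lemma contract_edges_half: "fst h \<in> contract_edges E g X \<longleftrightarrow> fst h \<in> E \<and> (g h \<in> X \<or> g (flip h) \<in> X)"
  unfolding contract_edges_def flip_def by (cases h; cases "snd h") auto

lemma dl_con:
  assumes "t \<notin> X"
  shows "dl (contract_edges E g X) (contract_map g X t) Z = dl E g (if t \<in> Z then (Z \<inter> X) \<union> - X else Z \<inter> X)"
  using assms unfolding dl_def contract_edges_def contract_map_def by auto

lemma dl_con_root:
  assumes "t \<notin> X"
  shows "dl (contract_edges E g X) (contract_map g X t) {t} = dl E g X"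
proof -
  have "{t} \<inter> X \<union> - X = - X" using assms by blast
  then show ?thesis using dl_con[OF assms, of E g "{t}"] dl_compl[of E g X] by simp
qed

lemma dl_con_in:
  assumes "t \<notin> X" "s \<in> X"
  shows "dl (contract_edges E g X) (contract_map g X t) {s} = dl E g {s}"
proof -
  have "{s} \<inter> X = {s}" "t \<noteq> s" using assms by auto
  then show ?thesis using dl_con[OF assms(1), of E g "{s}"] by simp
qed

lemma con_cuts:
  assumes cuts: "\<And>X. X \<inter> T \<noteq> {} \<Longrightarrow> T - X \<noteq> {} \<Longrightarrow> K \<le> card (dl E g X)"
    and t: "t \<in> T" "t \<notin> X"
    and Z: "Z \<inter> insert t (T \<inter> X) \<noteq> {}" "insert t (T \<inter> X) - Z \<noteq> {}"
  shows "K \<le> card (dl (contract_edges E g X) (contract_map g X t) Z)"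
proof (cases "t \<in> Z")
  case True
  then obtain u where u: "u \<in> T" "u \<in> X" "u \<notin> Z" using Z(2) by blast
  have "((Z \<inter> X) \<union> - X) \<inter> T \<noteq> {}" "T - ((Z \<inter> X) \<union> - X) \<noteq> {}" using t u by blast+
  then have "K \<le> card (dl E g ((Z \<inter> X) \<union> - X))" by (rule cuts)
  then show ?thesis using dl_con[OF t(2), of E g Z] True by simp
next
  case False
  then obtain u where u: "u \<in> T" "u \<in> X" "u \<in> Z" using Z(1) by blast
  have "(Z \<inter> X) \<inter> T \<noteq> {}" "T - (Z \<inter> X) \<noteq> {}" using t u by blast+
  then have "K \<le> card (dl E g (Z \<inter> X))" by (rule cuts)
  then show ?thesis using dl_con[OF t(2), of E g Z] False by simp
qed

text \<open>The squares pay for detaching: a degree \<open>d \<ge> 4\<close> gives way to at most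
  \<open>d - 2\<close> and 2, which lowers the sum of squares by at least 8, against one new vertex.
  Deletion lowers the edge count, contraction the vertex count.\<close>

definition graph_measure where
  "graph_measure E g T = card E + (\<Sum>w\<in>vts E g T - T. (card (dl E g {w}))\<^sup>2) + card (vts E g T)"

lemma finite_vts: "finite E \<Longrightarrow> finite T \<Longrightarrow> finite (vts E g T)"
  unfolding vts_def by auto

lemma vts_half: "fst h \<in> E \<Longrightarrow> g h \<in> vts E g T"
  unfolding vts_def by (cases h) auto

lemma vts_cases:
  assumes "u \<in> vts E g T"
  obtains "u \<in> T" | h where "fst h \<in> E" "g h = u"
  using assms unfolding vts_def by auto

lemma graph_measure_con:
  assumes fin: "finite E" "finite T" and t: "t \<in> T" "t \<notin> X" and two: "2 \<le> card (vts E g T - X)"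
  shows "graph_measure (contract_edges E g X) (contract_map g X t) (insert t (T \<inter> X)) < graph_measure E g T"
proof -
  let ?E = "contract_edges E g X" and ?g = "contract_map g X t" and ?T = "insert t (T \<inter> X)"
  have fV: "finite (vts E g T)" using fin by (rule finite_vts)
  have E: "card ?E \<le> card E" by (rule card_mono[OF fin(1)]) (auto simp: contract_edges_def)
  have sub: "vts ?E ?g ?T \<subseteq> insert t (vts E g T \<inter> X)"
  proof
    fix u assume "u \<in> vts ?E ?g ?T"
    then show "u \<in> insert t (vts E g T \<inter> X)"
    proof (rule vts_cases)
      assume "u \<in> ?T"
      then show ?thesis unfolding vts_def by blast
    next
      fix h assume h: "fst h \<in> ?E" "?g h = u"
      have "fst h \<in> E" using h(1) unfolding contract_edges_def by simp
      then have "g h \<in> vts E g T" by (rule vts_half)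
      then show ?thesis using h(2) unfolding contract_map_def by (auto split: if_splits)
    qed
  qed
  have "card (vts ?E ?g ?T) \<le> card (insert t (vts E g T \<inter> X))" using sub fV by (intro card_mono) auto
  also have "\<dots> \<le> card (vts E g T \<inter> X) + 1" by (simp add: card_insert_le_m1 card_insert_if fV)
  also have "\<dots> < card (vts E g T \<inter> X) + card (vts E g T - X)" using two by simp
  also have "\<dots> = card (vts E g T)" using fV by (metis card_Int_Diff)
  finally have V: "card (vts ?E ?g ?T) < card (vts E g T)" .
  have "(\<Sum>w\<in>vts ?E ?g ?T - ?T. (card (dl ?E ?g {w}))\<^sup>2) = (\<Sum>w\<in>vts ?E ?g ?T - ?T. (card (dl E g {w}))\<^sup>2)"
  proof (rule sum.cong)
    fix w assume "w \<in> vts ?E ?g ?T - ?T"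
    then have "w \<in> X" using sub by blast
    then show "(card (dl ?E ?g {w}))\<^sup>2 = (card (dl E g {w}))\<^sup>2" using dl_con_in[OF t(2), of w E g] by simp
  qed simp
  also have "\<dots> \<le> (\<Sum>w\<in>vts E g T - T. (card (dl E g {w}))\<^sup>2)"
    by (rule sum_mono2) (use fV sub in auto)
  finally show ?thesis using E V unfolding graph_measure_def by linarith
qed

text \<open>On the side of \<open>X\<close> no trail passes through the contracted vertex, because
  it is the root there; so its hops remain hops. On the other side trails may turn at
  \<open>s0\<close>. Such a turn is replaced by a detour through \<open>X\<close>: by the last
  clause of \<open>routing\<close> both cut edges lead to terminals in \<open>X\<close>, and these
  are linked in the same colour.\<close>

lemma glue_routings:
  assumes v: "v \<in> T" "v \<notin> X" and s0: "s0 \<in> T" "s0 \<in> X"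
    and R1: "routing (contract_edges E g X) (contract_map g X v) (insert v (T \<inter> X)) v k c1 \<mu>1"
    and R2: "routing (contract_edges E g (- X)) (contract_map g (- X) s0) (insert s0 (T - X)) v k c2 \<mu>2"
    and agree: "\<And>e. e \<in> dl E g X \<Longrightarrow> c1 e = c2 e"
  shows "routing E g T v k (\<lambda>e. if e \<in> contract_edges E g X then c1 e else c2 e) (\<lambda>h. if g h \<in> X then \<mu>1 h else \<mu>2 h)"
proof -
  define E1 g1 T1 where "E1 = contract_edges E g X" and "g1 = contract_map g X v" and "T1 = insert v (T \<inter> X)"
  define E2 g2 T2 where "E2 = contract_edges E g (- X)" and "g2 = contract_map g (- X) s0" and "T2 = insert s0 (T - X)"
  note R1 = R1[folded E1_def g1_def T1_def] and R2 = R2[folded E2_def g2_def T2_def]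
  define c where "c = (\<lambda>e. if e \<in> E1 then c1 e else c2 e)"
  define \<mu> where "\<mu> = (\<lambda>h. if g h \<in> X then \<mu>1 h else \<mu>2 h)"
  have E1: "fst h \<in> E1 \<longleftrightarrow> fst h \<in> E \<and> (g h \<in> X \<or> g (flip h) \<in> X)" for h
    unfolding E1_def by (rule contract_edges_half)
  have E2: "fst h \<in> E2 \<longleftrightarrow> fst h \<in> E \<and> (g h \<notin> X \<or> g (flip h) \<notin> X)" for h
    using contract_edges_half[of h E g "- X"] unfolding E2_def by simp
  have c1: "c (fst h) = c1 (fst h)" if "fst h \<in> E1" for h :: "_ \<times> bool" using that unfolding c_def by simp
  have c2: "c (fst h) = c2 (fst h)" if "fst h \<in> E2" for h :: "_ \<times> bool"
  proof (cases "fst h \<in> E1")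
    case True
    then have "fst h \<in> dl E g X" using that E1[of h] E2[of h] dl_half[of h E g X] by auto
    then show ?thesis using agree True unfolding c_def by simp
  qed (simp add: c_def)
  have g1: "g h \<in> X \<Longrightarrow> g1 h = g h" "g h \<notin> X \<Longrightarrow> g1 h = v" for h unfolding g1_def contract_map_def by auto
  have g2: "g h \<in> X \<Longrightarrow> g2 h = s0" "g h \<notin> X \<Longrightarrow> g2 h = g h" for h unfolding g2_def contract_map_def by auto
  have g1X: "g h = u" if "g1 h = u" "u \<in> X" for h u using that g1[of h] v by (metis)
  have g2X: "g h = u" if "g2 h = u" "u \<notin> X" for h u using that g2[of h] s0 by (metis)
  have g2s: "g h \<in> X" if "g2 h = s0" for h using that g2[of h] s0 by (metis)
  have le1: "\<And>e. e \<in> E1 \<Longrightarrow> c1 e \<le> k" and P1: "paired E1 g1 T1 c1 \<mu>1"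
    and C1: "\<And>i s t. i \<in> {1..k} \<Longrightarrow> s \<in> T1 - {v} \<Longrightarrow> t \<in> T1 - {v} \<Longrightarrow> s \<noteq> t \<Longrightarrow> reach E1 g1 T1 v c1 \<mu>1 i s t"
    and A1: "\<And>h. fst h \<in> E1 \<Longrightarrow> c1 (fst h) \<noteq> 0 \<Longrightarrow> g1 h = v \<Longrightarrow>
      \<exists>h'. fst h' \<in> E1 \<and> g1 h' \<in> T1 - {v} \<and> c1 (fst h') = c1 (fst h) \<and> (h, h') \<in> lnk (hop E1 g1 T1 v c1 \<mu>1 (c1 (fst h)))"
    using R1 unfolding routing_def by blast+
  have le2: "\<And>e. e \<in> E2 \<Longrightarrow> c2 e \<le> k" and P2: "paired E2 g2 T2 c2 \<mu>2"
    and C2: "\<And>i s t. i \<in> {1..k} \<Longrightarrow> s \<in> T2 - {v} \<Longrightarrow> t \<in> T2 - {v} \<Longrightarrow> s \<noteq> t \<Longrightarrow> reach E2 g2 T2 v c2 \<mu>2 i s t"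
    and A2: "\<And>h. fst h \<in> E2 \<Longrightarrow> c2 (fst h) \<noteq> 0 \<Longrightarrow> g2 h = v \<Longrightarrow>
      \<exists>h'. fst h' \<in> E2 \<and> g2 h' \<in> T2 - {v} \<and> c2 (fst h') = c2 (fst h) \<and> (h, h') \<in> lnk (hop E2 g2 T2 v c2 \<mu>2 (c2 (fst h)))"
    using R2 unfolding routing_def by blast+
  have T1v: "T1 - {v} = T \<inter> X" using v unfolding T1_def by blast
  have T2v: "T2 - {v} = insert s0 (T - X - {v})" using v s0 unfolding T2_def by auto
  have sub: "fst h \<in> E1 \<Longrightarrow> fst h \<in> E" "fst h \<in> E2 \<Longrightarrow> fst h \<in> E" for h :: "_ \<times> bool" using E1[of h] E2[of h] by simp_all
  let ?hop = "hop E g T v c \<mu>"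
  have hop1: "hop E1 g1 T1 v c1 \<mu>1 i \<subseteq> ?hop i" for i
  proof
    fix p assume "p \<in> hop E1 g1 T1 v c1 \<mu>1 i"
    then obtain h h' where p: "p = (h, h')" and h: "fst h \<in> E1" "fst h' \<in> E1" "c1 (fst h) = i" "c1 (fst h') = i"
      and or: "h' = flip h \<or> (g1 h \<notin> T1 \<and> h' = \<mu>1 h) \<or> (g1 h \<in> T1 - {v} \<and> g1 h' = g1 h)"
      unfolding hop_def by blast
    have hE: "fst h \<in> E" "fst h' \<in> E" "c (fst h) = i" "c (fst h') = i" using h sub c1 by auto
    from or show "p \<in> ?hop i" unfolding p
    proof (elim disjE conjE)
      assume "h' = flip h"
      then show "(h, h') \<in> ?hop i" by (rule hopI(1)[OF hE])
    next
      assume a: "g1 h \<notin> T1" "h' = \<mu>1 h"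
      then have "g h \<in> X" using g1(2)[of h] unfolding T1_def by blast
      then have "g h \<notin> T" "\<mu> h = \<mu>1 h" using a(1) g1(1)[of h] unfolding T1_def \<mu>_def by auto
      then show "(h, h') \<in> ?hop i" using a(2) by (intro hopI(2)[OF hE]) simp_all
    next
      assume a: "g1 h \<in> T1 - {v}" "g1 h' = g1 h"
      then have u: "g1 h \<in> T" "g1 h \<in> X" using T1v by blast+
      have "g h = g1 h" "g h' = g1 h" using g1X[OF refl u(2)] g1X[OF a(2) u(2)] by auto
      then show "(h, h') \<in> ?hop i" using u v by (intro hopI(3)[OF hE]) auto
    qed
  qed
  then have lnk1: "lnk (hop E1 g1 T1 v c1 \<mu>1 i) \<subseteq> lnk (?hop i)" for i by (rule lnk_mono)
  have turn: "(p, q) \<in> lnk (?hop i)" if "fst p \<in> E" "fst q \<in> E" "c (fst p) = i" "c (fst q) = i" "g p \<in> T - {v}" "g q = g p" for p q i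
    by (rule lnk_base, rule hopI(3)) (use that in simp_all)
  have fl: "(p, flip p) \<in> lnk (?hop i)" "(flip p, p) \<in> lnk (?hop i)" if "fst p \<in> E" "c (fst p) = i" for p i
    by (rule lnk_base, rule hopI(1); use that in simp)+
  have exit1: "\<exists>h'. fst h' \<in> E1 \<and> g h' \<in> T \<inter> X \<and> c (fst h') = i \<and> (h, h') \<in> lnk (?hop i)"
    if h: "fst h \<in> E1" "g h \<notin> X" "c (fst h) = i" "i \<noteq> 0" for h i
  proof -
    have i: "c1 (fst h) = i" using c1[OF h(1)] h(3) by simp
    obtain h' where h': "fst h' \<in> E1" "g1 h' \<in> T1 - {v}" "c1 (fst h') = i" "(h, h') \<in> lnk (hop E1 g1 T1 v c1 \<mu>1 i)"
      using A1[OF h(1)] g1(2)[OF h(2)] i h(4) by auto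
    have "g h' = g1 h'" using g1X[OF refl] h'(2) T1v by blast
    then show ?thesis using h' T1v c1[OF h'(1)] lnk1[of i] by (intro exI[of _ h']) auto
  qed
  have inner: "(p, q) \<in> lnk (?hop i)"
    if p: "fst p \<in> E1" "g p \<in> T \<inter> X" "c (fst p) = i" and q: "fst q \<in> E1" "g q \<in> T \<inter> X" "c (fst q) = i" and i: "i \<noteq> 0" for p q i
  proof (cases "g p = g q")
    case True
    then show ?thesis using p q v sub by (intro turn) auto
  next
    case False
    have ik: "i \<in> {1..k}" using i p(3) c1[OF p(1)] le1[OF p(1)] by simp
    then obtain p' q' where pq: "fst p' \<in> E1" "fst q' \<in> E1" "c1 (fst p') = i" "c1 (fst q') = i" "g1 p' = g p" "g1 q' = g q"
      "(p', q') \<in> lnk (hop E1 g1 T1 v c1 \<mu>1 i)"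
      using C1[OF ik _ _ False] p(2) q(2) T1v unfolding reach_def by blast
    have "g p' = g p" "g q' = g q" using g1X[OF pq(5)] g1X[OF pq(6)] p(2) q(2) by auto
    then have "(p, p') \<in> lnk (?hop i)" "(q', q) \<in> lnk (?hop i)"
      using p q v sub pq c1 by (intro turn; auto)+
    moreover have "(p', q') \<in> lnk (?hop i)" using pq(7) lnk1 by blast
    ultimately show ?thesis using lnk_trans by metis
  qed
  have outer: "(p, q) \<in> lnk (?hop i)"
    if p: "fst p \<in> E1" "g p \<notin> X" "c (fst p) = i" and q: "fst q \<in> E1" "g q \<notin> X" "c (fst q) = i" and i: "i \<noteq> 0" for p q i
  proof -
    obtain p' where p': "fst p' \<in> E1" "g p' \<in> T \<inter> X" "c (fst p') = i" "(p, p') \<in> lnk (?hop i)" using exit1[OF p i] by blast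
    obtain q' where q': "fst q' \<in> E1" "g q' \<in> T \<inter> X" "c (fst q') = i" "(q, q') \<in> lnk (?hop i)" using exit1[OF q i] by blast
    have "(p', q') \<in> lnk (?hop i)" by (rule inner[OF p'(1-3) q'(1-3) i])
    then show ?thesis using p'(4) lnk_sym[OF q'(4)] lnk_trans by metis
  qed
  have cross: "fst (flip h) \<in> E1" "g (flip h) \<notin> X" if "fst h \<in> E2" "g h \<in> X" for h
    using that E1[of "flip h"] E2[of h] by auto
  have hop2: "hop E2 g2 T2 v c2 \<mu>2 i \<subseteq> lnk (?hop i)" if i: "i \<noteq> 0" for i
  proof
    fix p assume "p \<in> hop E2 g2 T2 v c2 \<mu>2 i"
    then obtain h h' where p: "p = (h, h')" and h: "fst h \<in> E2" "fst h' \<in> E2" "c2 (fst h) = i" "c2 (fst h') = i"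
      and or: "h' = flip h \<or> (g2 h \<notin> T2 \<and> h' = \<mu>2 h) \<or> (g2 h \<in> T2 - {v} \<and> g2 h' = g2 h)"
      unfolding hop_def by blast
    have hE: "fst h \<in> E" "fst h' \<in> E" "c (fst h) = i" "c (fst h') = i" using h sub c2 by auto
    from or show "p \<in> lnk (?hop i)" unfolding p
    proof (elim disjE conjE)
      assume "h' = flip h"
      then show "(h, h') \<in> lnk (?hop i)" using fl(1)[OF hE(1,3)] by simp
    next
      assume a: "g2 h \<notin> T2" "h' = \<mu>2 h"
      then have "g h \<notin> X" using g2(1)[of h] unfolding T2_def by blast
      then have "g h \<notin> T" "\<mu> h = \<mu>2 h" using a(1) g2(2)[of h] unfolding T2_def \<mu>_def by auto
      then show "(h, h') \<in> lnk (?hop i)" using a(2) by (intro lnk_base hopI(2)[OF hE]) simp_all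
    next
      assume a: "g2 h \<in> T2 - {v}" "g2 h' = g2 h"
      show "(h, h') \<in> lnk (?hop i)"
      proof (cases "g2 h = s0")
        case True
        then have X: "g h \<in> X" "g h' \<in> X" using g2s a(2) by auto
        have "(flip h, flip h') \<in> lnk (?hop i)"
          by (rule outer) (use cross[OF h(1) X(1)] cross[OF h(2) X(2)] hE i in simp_all)
        then show ?thesis using fl(1)[OF hE(1,3)] fl(2)[OF hE(2,4)] lnk_trans by metis
      next
        case False
        then have u: "g2 h \<in> T" "g2 h \<notin> X" "g2 h \<noteq> v" using a(1) unfolding T2_def by blast+
        have "g h = g2 h" "g h' = g2 h" using g2X[OF refl u(2)] g2X[OF a(2) u(2)] by auto
        then show ?thesis using u by (intro turn hE) auto
      qed
    qed
  qed
  then have lnk2: "lnk (hop E2 g2 T2 v c2 \<mu>2 i) \<subseteq> lnk (?hop i)" if "i \<noteq> 0" for i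
    using that by (intro lnk_lnk_subset) blast
  have "routing E g T v k c \<mu>" unfolding routing_def
  proof (intro conjI ballI impI allI)
    fix e assume e: "e \<in> E"
    show "c e \<le> k"
    proof (cases "e \<in> E1")
      case True
      then show ?thesis using le1 unfolding c_def by simp
    next
      case False
      then have "e \<in> E2" using e E1[of "(e, True)"] E2[of "(e, True)"] by simp
      then show ?thesis using le2 False unfolding c_def by simp
    qed
  next
    show "paired E g T c \<mu>" unfolding paired_def
    proof (intro allI impI)
      fix h assume "fst h \<in> E \<and> c (fst h) \<noteq> 0 \<and> g h \<notin> T"
      then have h: "fst h \<in> E" "c (fst h) \<noteq> 0" "g h \<notin> T" by auto
      show "fst (\<mu> h) \<in> E \<and> \<mu> h \<noteq> h \<and> \<mu> (\<mu> h) = h \<and> g (\<mu> h) = g h \<and> c (fst (\<mu> h)) = c (fst h)"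
      proof (cases "g h \<in> X")
        case True
        have h1: "fst h \<in> E1" using E1[of h] h True by simp
        have "g1 h \<notin> T1" using g1(1)[OF True] h(3) v True unfolding T1_def by auto
        then have m: "fst (\<mu>1 h) \<in> E1" "\<mu>1 h \<noteq> h" "\<mu>1 (\<mu>1 h) = h" "g1 (\<mu>1 h) = g h" "c1 (fst (\<mu>1 h)) = c1 (fst h)"
          using pairedD[OF P1 h1] h(2) c1[OF h1] g1(1)[OF True] by simp_all
        have gm: "g (\<mu>1 h) = g h" by (rule g1X[OF m(4) True])
        then have "\<mu> (\<mu>1 h) = h" using True m(3) unfolding \<mu>_def by simp
        moreover have "\<mu> h = \<mu>1 h" using True unfolding \<mu>_def by simp
        ultimately show ?thesis using m gm sub c1[OF h1] c1[OF m(1)] by simp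
      next
        case False
        have h1: "fst h \<in> E2" using E2[of h] h False by simp
        have "g2 h \<notin> T2" using g2(2)[OF False] h(3) s0 False unfolding T2_def by auto
        then have m: "fst (\<mu>2 h) \<in> E2" "\<mu>2 h \<noteq> h" "\<mu>2 (\<mu>2 h) = h" "g2 (\<mu>2 h) = g h" "c2 (fst (\<mu>2 h)) = c2 (fst h)"
          using pairedD[OF P2 h1] h(2) c2[OF h1] g2(2)[OF False] by simp_all
        have gm: "g (\<mu>2 h) = g h" by (rule g2X[OF m(4) False])
        then have "\<mu> (\<mu>2 h) = h" using False m(3) unfolding \<mu>_def by simp
        moreover have "\<mu> h = \<mu>2 h" using False unfolding \<mu>_def by simp
        ultimately show ?thesis using m gm sub c2[OF h1] c2[OF m(1)] by simp
      qed
    qed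
  next
    fix i s t assume i: "i \<in> {1..k}" and s: "s \<in> T - {v}" and t: "t \<in> T - {v}" and st: "s \<noteq> t"
    have i0: "i \<noteq> 0" using i by simp
    \<comment> \<open>A trail from \<open>s0\<close> to \<open>u\<close> on the other side starts on
      a cut edge. Inside \<open>X\<close> this edge leads to some terminal, which is linked to
      \<open>s\<close> in the same colour.\<close>
    have mixed: "reach E g T v c \<mu> i s u" if s: "s \<in> T" "s \<in> X" and u: "u \<in> T - {v}" "u \<notin> X" for s u
    proof -
      have "s0 \<noteq> u" using u s0 by blast
      moreover have "s0 \<in> T2 - {v}" "u \<in> T2 - {v}" using T2v u by auto
      ultimately obtain p q where pq: "fst p \<in> E2" "fst q \<in> E2" "c2 (fst p) = i" "c2 (fst q) = i" "g2 p = s0" "g2 q = u"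
        "(p, q) \<in> lnk (hop E2 g2 T2 v c2 \<mu>2 i)"
        using C2[OF i] unfolding reach_def by blast
      have pX: "g p \<in> X" by (rule g2s[OF pq(5)])
      have gq: "g q = u" by (rule g2X[OF pq(6) u(2)])
      have cp: "c (fst p) = i" using c2 pq by simp
      obtain h where h: "fst h \<in> E1" "g h \<in> T \<inter> X" "c (fst h) = i" "(flip p, h) \<in> lnk (?hop i)"
        using exit1[OF cross[OF pq(1) pX]] cp i0 by auto
      have "(h, flip p) \<in> lnk (?hop i)" by (rule lnk_sym[OF h(4)])
      moreover have "(flip p, p) \<in> lnk (?hop i)" using fl(2)[of p i] sub(2)[OF pq(1)] cp by simp
      moreover have "(p, q) \<in> lnk (?hop i)" using pq(7) lnk2[OF i0] by blast
      ultimately have hq: "(h, q) \<in> lnk (?hop i)" using lnk_trans by metis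
      obtain h0 where h0: "fst h0 \<in> E1" "g h0 = s" "c (fst h0) = i"
      proof (cases "g h = s")
        case True
        then show ?thesis using h that by blast
      next
        case False
        then have "reach E1 g1 T1 v c1 \<mu>1 i s (g h)" using s h(2) T1v by (intro C1[OF i]) auto
        then obtain h0 where "fst h0 \<in> E1" "c1 (fst h0) = i" "g1 h0 = s" unfolding reach_def by blast
        then show ?thesis using g1X[of h0 s] s c1[of h0] that by auto
      qed
      have "(h0, h) \<in> lnk (?hop i)" by (rule inner) (use h0 h s i0 in auto)
      then have h0q: "(h0, q) \<in> lnk (?hop i)" using hq lnk_trans by metis
      show ?thesis by (rule reachI[OF _ _ _ _ _ _ h0q]) (use h0 sub gq pq c2 in simp_all)
    qed
    consider "s \<in> X" "t \<in> X" | "s \<notin> X" "t \<notin> X" | "s \<in> X" "t \<notin> X" | "s \<notin> X" "t \<in> X" by blast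
    then show "reach E g T v c \<mu> i s t"
    proof cases
      case 1
      then obtain p q where pq: "fst p \<in> E1" "fst q \<in> E1" "c1 (fst p) = i" "c1 (fst q) = i" "g1 p = s" "g1 q = t"
        "(p, q) \<in> lnk (hop E1 g1 T1 v c1 \<mu>1 i)"
        using C1[OF i _ _ st] s t T1v unfolding reach_def by blast
      have "g p = s" "g q = t" using g1X pq 1 by blast+
      moreover have pq': "(p, q) \<in> lnk (?hop i)" using pq(7) lnk1 by blast
      ultimately show ?thesis by (intro reachI[OF _ _ _ _ _ _ pq']) (use pq sub c1 in simp_all)
    next
      case 2
      have "s \<in> T2 - {v}" "t \<in> T2 - {v}" using s t 2 T2v by auto
      then obtain p q where pq: "fst p \<in> E2" "fst q \<in> E2" "c2 (fst p) = i" "c2 (fst q) = i" "g2 p = s" "g2 q = t"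
        "(p, q) \<in> lnk (hop E2 g2 T2 v c2 \<mu>2 i)"
        using C2[OF i _ _ st] unfolding reach_def by blast
      have "g p = s" "g q = t" using g2X pq 2 by blast+
      moreover have pq': "(p, q) \<in> lnk (?hop i)" using pq(7) lnk2[OF i0] by blast
      ultimately show ?thesis by (intro reachI[OF _ _ _ _ _ _ pq']) (use pq sub c2 in simp_all)
    next
      case 3
      then show ?thesis using mixed s t by blast
    next
      case 4
      then have "reach E g T v c \<mu> i t s" using mixed s t by blast
      then show ?thesis by (rule reach_sym)
    qed
  next
    fix h assume "fst h \<in> E \<and> c (fst h) \<noteq> 0 \<and> g h = v"
    then have h: "fst h \<in> E" "c (fst h) \<noteq> 0" "g h = v" by auto
    let ?i = "c (fst h)"
    have hX: "g h \<notin> X" using h(3) v by simp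
    have h2: "fst h \<in> E2" using E2[of h] h hX by simp
    obtain h' where h': "fst h' \<in> E2" "g2 h' \<in> T2 - {v}" "c2 (fst h') = ?i" "(h, h') \<in> lnk (hop E2 g2 T2 v c2 \<mu>2 ?i)"
      using A2[OF h2] c2[OF h2] g2(2)[OF hX] h by auto
    have hh': "(h, h') \<in> lnk (?hop ?i)" using h'(4) lnk2[OF h(2)] by blast
    have c': "c (fst h') = ?i" using c2[OF h'(1)] h'(3) by simp
    show "\<exists>h'. fst h' \<in> E \<and> g h' \<in> T - {v} \<and> c (fst h') = ?i \<and> (h, h') \<in> lnk (?hop ?i)"
    proof (cases "g2 h' = s0")
      case False
      then have u: "g2 h' \<in> T - {v}" "g2 h' \<notin> X" using h'(2) T2v by auto
      then have "g h' = g2 h'" using g2X[OF refl] by blast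
      then show ?thesis using u(1) hh' c' sub(2)[OF h'(1)] by (intro exI[of _ h']) simp
    next
      case True
      have X: "g h' \<in> X" by (rule g2s[OF True])
      obtain h'' where h'': "fst h'' \<in> E1" "g h'' \<in> T \<inter> X" "c (fst h'') = ?i" "(flip h', h'') \<in> lnk (?hop ?i)"
        using exit1[OF cross[OF h'(1) X]] c' h(2) by auto
      have "(h', flip h') \<in> lnk (?hop ?i)" by (rule fl(1)[OF sub(2)[OF h'(1)] c'])
      then have "(h, h'') \<in> lnk (?hop ?i)" using hh' h''(4) lnk_trans by metis
      then show ?thesis using h'' sub(1)[OF h''(1)] v by (intro exI[of _ h'']) auto
    qed
  qed
  then show ?thesis unfolding c_def \<mu>_def E1_def .
qed

text \<open>The quantifier order in \<open>solvable\<close> makes this work: the pair for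
  \<open>X\<close> is known before any colour, the root side respects it as a demand at
  \<open>s0\<close>, and its colours on the cut are then admissible root colours for
  \<open>X\<close>. Tightness of \<open>X\<close> makes the demand at \<open>s0\<close>
  legitimate.\<close>

lemma solvable_glue:
  fixes E :: "'e set" and g :: "'e \<times> bool \<Rightarrow> 'v"
  assumes v: "v \<in> T" "v \<notin> X" and s0: "s0 \<in> T" "s0 \<in> X" and tight: "card (dl E g X) = 6 * k + 6"
    and S1: "solvable (contract_edges E g X) (contract_map g X v) (insert v (T \<inter> X)) v k"
    and S2: "solvable (contract_edges E g (- X)) (contract_map g (- X) s0) (insert s0 (T - X)) v k"
  shows "solvable E g T v k"
  unfolding solvable_def
proof (intro allI impI)
  fix good :: "'v \<Rightarrow> 'e set" and r :: "'v \<Rightarrow> nat"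
  assume dem: "demand E g T v k good r"
  let ?E1 = "contract_edges E g X" and ?g1 = "contract_map g X v" and ?T1 = "insert v (T \<inter> X)"
  let ?E2 = "contract_edges E g (- X)" and ?g2 = "contract_map g (- X) s0" and ?T2 = "insert s0 (T - X)"
  have sX: "s0 \<notin> - X" using s0 by simp
  have dl1: "dl ?E1 ?g1 {v} = dl E g X" by (rule dl_con_root[OF v(2)])
  have dl1': "dl ?E1 ?g1 {t} = dl E g {t}" if "t \<in> X" for t by (rule dl_con_in[OF v(2) that])
  have dl2: "dl ?E2 ?g2 {s0} = dl E g X" using dl_con_root[OF sX, of E g] dl_compl[of E g X] by simp
  have dl2': "dl ?E2 ?g2 {t} = dl E g {t}" if "t \<notin> X" for t by (rule dl_con_in[OF sX]) (use that in simp)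
  have d: "r t = 0 \<or> (card (dl E g {t}) = 6 * k + 6 \<and> 2 * r t + card (dl E g {t} - good t) \<le> 2 * k)" if "t \<in> T - {v}" for t
    using dem that unfolding demand_def by blast
  have "demand ?E1 ?g1 ?T1 v k good r" unfolding demand_def
  proof
    fix t assume "t \<in> ?T1 - {v}"
    then have t: "t \<in> X" "t \<in> T - {v}" by auto
    show "r t = 0 \<or> (card (dl ?E1 ?g1 {t}) = 6 * k + 6 \<and> 2 * r t + card (dl ?E1 ?g1 {t} - good t) \<le> 2 * k)"
      unfolding dl1'[OF t(1)] by (rule d[OF t(2)])
  qed
  then obtain g1 r1 where gr1: "2 * r1 + card (dl E g X - g1) \<le> 2 * k"
    and ext1: "\<And>\<phi>. (\<forall>e. \<phi> e \<le> k) \<and> r1 \<le> card {e \<in> dl E g X \<inter> g1. \<phi> e = 0} \<Longrightarrow>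
      \<exists>c \<mu>. routing ?E1 ?g1 ?T1 v k c \<mu> \<and> served ?E1 ?g1 ?T1 v good r c \<and> (\<forall>e\<in>dl E g X. c e = \<phi> e)"
    using S1 unfolding solvable_def dl1 by blast
  define good2 r2 where "good2 = good(s0 := g1)" and "r2 = r(s0 := r1)"
  have "demand ?E2 ?g2 ?T2 v k good2 r2" unfolding demand_def
  proof
    fix t assume t: "t \<in> ?T2 - {v}"
    show "r2 t = 0 \<or> (card (dl ?E2 ?g2 {t}) = 6 * k + 6 \<and> 2 * r2 t + card (dl ?E2 ?g2 {t} - good2 t) \<le> 2 * k)"
    proof (cases "t = s0")
      case True
      then show ?thesis using gr1 tight dl2 unfolding good2_def r2_def by simp
    next
      case False
      then have t': "t \<notin> X" "t \<in> T - {v}" using t by auto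
      show ?thesis unfolding dl2'[OF t'(1)] using d[OF t'(2)] False unfolding good2_def r2_def by simp
    qed
  qed
  then obtain gv rv where gv: "2 * rv + card (dl E g {v} - gv) \<le> 2 * k"
    and ext2: "\<And>\<phi>. (\<forall>e. \<phi> e \<le> k) \<and> rv \<le> card {e \<in> dl E g {v} \<inter> gv. \<phi> e = 0} \<Longrightarrow>
      \<exists>c \<mu>. routing ?E2 ?g2 ?T2 v k c \<mu> \<and> served ?E2 ?g2 ?T2 v good2 r2 c \<and> (\<forall>e\<in>dl E g {v}. c e = \<phi> e)"
    using S2 unfolding solvable_def dl2'[OF v(2)] by blast
  show "\<exists>gv rv. 2 * rv + card (dl E g {v} - gv) \<le> 2 * k \<and>
       (\<forall>\<phi>. (\<forall>e. \<phi> e \<le> k) \<and> rv \<le> card {e \<in> dl E g {v} \<inter> gv. \<phi> e = 0} \<longrightarrow>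
         (\<exists>c \<mu>. routing E g T v k c \<mu> \<and> served E g T v good r c \<and> (\<forall>e\<in>dl E g {v}. c e = \<phi> e)))"
  proof (intro exI[of _ gv] exI[of _ rv] conjI allI impI gv)
    fix \<phi> :: "'e \<Rightarrow> nat" assume "(\<forall>e. \<phi> e \<le> k) \<and> rv \<le> card {e \<in> dl E g {v} \<inter> gv. \<phi> e = 0}"
    then obtain c2 \<mu>2 where R2: "routing ?E2 ?g2 ?T2 v k c2 \<mu>2" and D2: "served ?E2 ?g2 ?T2 v good2 r2 c2"
      and \<phi>2: "\<forall>e\<in>dl E g {v}. c2 e = \<phi> e" using ext2 by blast
    define \<phi>1 where "\<phi>1 e = (if e \<in> dl E g X then c2 e else 0)" for e
    have XE2: "dl E g X \<subseteq> ?E2" unfolding dl_def contract_edges_def by auto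
    then have "\<forall>e. \<phi>1 e \<le> k" using R2 unfolding \<phi>1_def routing_def by auto
    moreover have "r1 \<le> card {e \<in> dl E g X \<inter> g1. \<phi>1 e = 0}"
    proof -
      have "s0 \<in> ?T2 - {v}" using s0 v by auto
      then have "r2 s0 \<le> card {e \<in> dl ?E2 ?g2 {s0} \<inter> good2 s0. c2 e = 0}" using D2 unfolding served_def by blast
      moreover have "{e \<in> dl E g X \<inter> g1. \<phi>1 e = 0} = {e \<in> dl E g X \<inter> g1. c2 e = 0}" unfolding \<phi>1_def by auto
      ultimately show ?thesis unfolding dl2 good2_def r2_def by simp
    qed
    ultimately obtain c1 \<mu>1 where R1: "routing ?E1 ?g1 ?T1 v k c1 \<mu>1" and D1: "served ?E1 ?g1 ?T1 v good r c1"
      and \<phi>1: "\<forall>e\<in>dl E g X. c1 e = \<phi>1 e" using ext1[of \<phi>1] by blast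
    have agree: "c1 e = c2 e" if "e \<in> dl E g X" for e using \<phi>1 that unfolding \<phi>1_def by simp
    let ?c = "\<lambda>e. if e \<in> ?E1 then c1 e else c2 e"
    have c2: "?c e = c2 e" if "e \<in> ?E2" for e
    proof (cases "e \<in> ?E1")
      case True
      then have "e \<in> dl E g X" using that unfolding contract_edges_def dl_def by auto
      then show ?thesis using agree True by simp
    qed simp
    have "routing E g T v k ?c (\<lambda>h. if g h \<in> X then \<mu>1 h else \<mu>2 h)"
      by (rule glue_routings[OF v s0 R1 R2 agree])
    moreover have "served E g T v good r ?c" unfolding served_def
    proof
      fix t assume t: "t \<in> T - {v}"
      show "r t \<le> card {e \<in> dl E g {t} \<inter> good t. ?c e = 0}"
      proof (cases "t \<in> X")
        case True
        then have "dl E g {t} \<subseteq> ?E1" unfolding dl_def contract_edges_def by auto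
        then have "{e \<in> dl E g {t} \<inter> good t. ?c e = 0} = {e \<in> dl E g {t} \<inter> good t. c1 e = 0}" by auto
        moreover have "t \<in> ?T1 - {v}" using t True by simp
        then have "r t \<le> card {e \<in> dl ?E1 ?g1 {t} \<inter> good t. c1 e = 0}" using D1 unfolding served_def by blast
        ultimately show ?thesis unfolding dl1'[OF True] by simp
      next
        case False
        then have "dl E g {t} \<subseteq> ?E2" unfolding dl_def contract_edges_def by auto
        then have "?c e = c2 e" if "e \<in> dl E g {t} \<inter> good t" for e using c2[of e] that by blast
        then have "{e \<in> dl E g {t} \<inter> good t. ?c e = 0} = {e \<in> dl E g {t} \<inter> good t. c2 e = 0}"
          by (intro Collect_cong conj_cong refl) presburger
        moreover have "t \<in> ?T2 - {v}" using t False by simp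
        then have "r2 t \<le> card {e \<in> dl ?E2 ?g2 {t} \<inter> good2 t. c2 e = 0}" using D2 unfolding served_def by blast
        moreover have "t \<noteq> s0" using False s0 by blast
        ultimately show ?thesis unfolding dl2'[OF False] r2_def good2_def by simp
      qed
    qed
    moreover have "\<forall>e\<in>dl E g {v}. ?c e = \<phi> e"
    proof
      fix e assume e: "e \<in> dl E g {v}"
      then have "e \<in> ?E2" using v unfolding dl_def contract_edges_def by auto
      then show "?c e = \<phi> e" using c2 \<phi>2 e by simp
    qed
    ultimately show "\<exists>c \<mu>. routing E g T v k c \<mu> \<and> served E g T v good r c \<and> (\<forall>e\<in>dl E g {v}. c e = \<phi> e)"
      by blast
  qed
qed

text \<open>The hypotheses on \<open>g'\<close> and \<open>E'\<close> are met both by deleting an edge and by detaching two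
  half-edges from a nonterminal.\<close>

lemma routing_lift:
  fixes E :: "'e set" and g :: "'e \<times> bool \<Rightarrow> 'v"
  assumes R: "routing E' g' T v k c' \<mu>" and cc: "\<And>e. e \<in> E' \<Longrightarrow> c e = c' e"
    and E': "E' \<subseteq> E" "\<And>e. e \<in> E \<Longrightarrow> e \<notin> E' \<Longrightarrow> c e = 0"
    and gT: "\<And>h. fst h \<in> E' \<Longrightarrow> g' h \<in> T \<or> g h \<in> T \<Longrightarrow> g' h = g h"
    and gg: "\<And>h h'. fst h \<in> E' \<Longrightarrow> fst h' \<in> E' \<Longrightarrow> g' h = g' h' \<Longrightarrow> g h = g h'"
    and v: "v \<in> T"
  shows "routing E g T v k c \<mu>"
proof -
  have le: "\<And>e. e \<in> E' \<Longrightarrow> c' e \<le> k" and P: "paired E' g' T c' \<mu>"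
    and C: "\<And>i s t. i \<in> {1..k} \<Longrightarrow> s \<in> T - {v} \<Longrightarrow> t \<in> T - {v} \<Longrightarrow> s \<noteq> t \<Longrightarrow> reach E' g' T v c' \<mu> i s t"
    and A: "\<And>h. fst h \<in> E' \<Longrightarrow> c' (fst h) \<noteq> 0 \<Longrightarrow> g' h = v \<Longrightarrow>
      \<exists>h'. fst h' \<in> E' \<and> g' h' \<in> T - {v} \<and> c' (fst h') = c' (fst h) \<and> (h, h') \<in> lnk (hop E' g' T v c' \<mu> (c' (fst h)))"
    using R unfolding routing_def by blast+
  have hop: "hop E' g' T v c' \<mu> i \<subseteq> hop E g T v c \<mu> i" for i
  proof
    fix p assume "p \<in> hop E' g' T v c' \<mu> i"
    then obtain h h' where p: "p = (h, h')" and h': "fst h \<in> E'" "fst h' \<in> E'" "c' (fst h) = i" "c' (fst h') = i"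
      and or: "h' = flip h \<or> (g' h \<notin> T \<and> h' = \<mu> h) \<or> (g' h \<in> T - {v} \<and> g' h' = g' h)"
      unfolding hop_def by blast
    have h: "fst h \<in> E'" "fst h' \<in> E'" "c (fst h) = i" "c (fst h') = i" using h' cc by simp_all
    have hE: "fst h \<in> E" "fst h' \<in> E" using h E' by blast+
    from or show "p \<in> hop E g T v c \<mu> i" unfolding p
    proof (elim disjE conjE)
      assume "h' = flip h"
      then show "(h, h') \<in> hop E g T v c \<mu> i" by (rule hopI(1)[OF hE h(3,4)])
    next
      assume a: "g' h \<notin> T" "h' = \<mu> h"
      then have "g h \<notin> T" using gT[OF h(1)] by auto
      then show "(h, h') \<in> hop E g T v c \<mu> i" using a(2) by (rule hopI(2)[OF hE h(3,4)])
    next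
      assume a: "g' h \<in> T - {v}" "g' h' = g' h"
      then have "g' h = g h" "g' h' = g h'" using gT[OF h(1)] gT[OF h(2)] by auto
      then show "(h, h') \<in> hop E g T v c \<mu> i" using a by (intro hopI(3)[OF hE h(3,4)]) auto
    qed
  qed
  then have lnk: "lnk (hop E' g' T v c' \<mu> i) \<subseteq> lnk (hop E g T v c \<mu> i)" for i by (rule lnk_mono)
  show ?thesis unfolding routing_def
  proof (intro conjI ballI impI allI)
    fix e assume "e \<in> E"
    then show "c e \<le> k" using le[of e] cc[of e] E'(2)[of e] by (cases "e \<in> E'") auto
  next
    show "paired E g T c \<mu>" unfolding paired_def
    proof (intro allI impI)
      fix h assume "fst h \<in> E \<and> c (fst h) \<noteq> 0 \<and> g h \<notin> T"
      then have h: "fst h \<in> E'" "c (fst h) \<noteq> 0" "g h \<notin> T" using E'(2)[of "fst h"] by auto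
      have "g' h \<notin> T" using gT[OF h(1)] h(3) by auto
      then have m: "fst (\<mu> h) \<in> E'" "\<mu> h \<noteq> h" "\<mu> (\<mu> h) = h" "g' (\<mu> h) = g' h" "c' (fst (\<mu> h)) = c' (fst h)"
        using pairedD[OF P h(1)] h(2) cc[OF h(1)] by simp_all
      have "c (fst (\<mu> h)) = c (fst h)" using m(5) cc[OF m(1)] cc[OF h(1)] by simp
      moreover have "g (\<mu> h) = g h" by (rule gg[OF m(1) h(1) m(4)])
      ultimately show "fst (\<mu> h) \<in> E \<and> \<mu> h \<noteq> h \<and> \<mu> (\<mu> h) = h \<and> g (\<mu> h) = g h \<and> c (fst (\<mu> h)) = c (fst h)"
        using m E'(1) by blast
    qed
  next
    fix i s t assume i: "i \<in> {1..k}" and s: "s \<in> T - {v}" and t: "t \<in> T - {v}" and st: "s \<noteq> t"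
    obtain p q where pq: "fst p \<in> E'" "fst q \<in> E'" "c' (fst p) = i" "c' (fst q) = i" "g' p = s" "g' q = t"
      "(p, q) \<in> lnk (hop E' g' T v c' \<mu> i)" using C[OF i s t st] unfolding reach_def by blast
    have "g p = s" "g q = t" using gT[OF pq(1)] gT[OF pq(2)] pq s t by auto
    moreover have pq': "(p, q) \<in> lnk (hop E g T v c \<mu> i)" using pq(7) lnk by blast
    ultimately show "reach E g T v c \<mu> i s t"
      by (intro reachI[OF _ _ _ _ _ _ pq']) (use pq E'(1) cc in auto)
  next
    fix h assume "fst h \<in> E \<and> c (fst h) \<noteq> 0 \<and> g h = v"
    then have h: "fst h \<in> E'" "c (fst h) \<noteq> 0" "g h = v" using E'(2)[of "fst h"] by auto
    have ce: "c (fst h) = c' (fst h)" by (rule cc[OF h(1)])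
    have "g' h = v" using gT[OF h(1)] h(3) v by auto
    then obtain h' where h': "fst h' \<in> E'" "g' h' \<in> T - {v}" "c' (fst h') = c (fst h)"
      "(h, h') \<in> lnk (hop E' g' T v c' \<mu> (c (fst h)))" using A[OF h(1)] h(2) ce by auto
    have "g h' = g' h'" using gT[OF h'(1)] h'(2) by simp
    then show "\<exists>h'. fst h' \<in> E \<and> g h' \<in> T - {v} \<and> c (fst h') = c (fst h) \<and> (h, h') \<in> lnk (hop E g T v c \<mu> (c (fst h)))"
      using h' E'(1) cc[OF h'(1)] lnk by (intro exI[of _ h']) auto
  qed
qed

text \<open>Demands sit only at tight terminals, whose edge sets agree by \<open>same\<close>, so
  they transfer unchanged. Edges outside \<open>E'\<close> receive colour 0.\<close>

lemma solvable_lift: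
  fixes E :: "'e set" and g :: "'e \<times> bool \<Rightarrow> 'v"
  assumes S: "solvable E' g' T v k" and fin: "finite E"
    and E': "E' \<subseteq> E" and v: "v \<in> T"
    and gT: "\<And>h. fst h \<in> E' \<Longrightarrow> g' h \<in> T \<or> g h \<in> T \<Longrightarrow> g' h = g h"
    and gg: "\<And>h h'. fst h \<in> E' \<Longrightarrow> fst h' \<in> E' \<Longrightarrow> g' h = g' h' \<Longrightarrow> g h = g h'"
    and sub: "\<And>t. t \<in> T \<Longrightarrow> dl E' g' {t} \<subseteq> dl E g {t}"
    and same: "\<And>t. t \<in> T \<Longrightarrow> card (dl E g {t}) = 6 * k + 6 \<Longrightarrow> dl E' g' {t} = dl E g {t}"
    and tv: "card (dl E g {v}) = 6 * k + 6"
  shows "solvable E g T v k"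
  unfolding solvable_def
proof (intro allI impI)
  fix good :: "'v \<Rightarrow> 'e set" and r :: "'v \<Rightarrow> nat"
  assume dem: "demand E g T v k good r"
  have dv: "dl E' g' {v} = dl E g {v}" by (rule same[OF v tv])
  have "demand E' g' T v k good r" unfolding demand_def
  proof
    fix t assume t: "t \<in> T - {v}"
    then have "r t = 0 \<or> (card (dl E g {t}) = 6 * k + 6 \<and> 2 * r t + card (dl E g {t} - good t) \<le> 2 * k)"
      using dem unfolding demand_def by blast
    then show "r t = 0 \<or> (card (dl E' g' {t}) = 6 * k + 6 \<and> 2 * r t + card (dl E' g' {t} - good t) \<le> 2 * k)"
      using same[of t] t by auto
  qed
  then obtain gv rv where gv: "2 * rv + card (dl E g {v} - gv) \<le> 2 * k"
    and ext: "\<And>\<phi>. (\<forall>e. \<phi> e \<le> k) \<and> rv \<le> card {e \<in> dl E g {v} \<inter> gv. \<phi> e = 0} \<Longrightarrow>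
      \<exists>c \<mu>. routing E' g' T v k c \<mu> \<and> served E' g' T v good r c \<and> (\<forall>e\<in>dl E g {v}. c e = \<phi> e)"
    using S unfolding solvable_def dv by blast
  show "\<exists>gv rv. 2 * rv + card (dl E g {v} - gv) \<le> 2 * k \<and>
       (\<forall>\<phi>. (\<forall>e. \<phi> e \<le> k) \<and> rv \<le> card {e \<in> dl E g {v} \<inter> gv. \<phi> e = 0} \<longrightarrow>
         (\<exists>c \<mu>. routing E g T v k c \<mu> \<and> served E g T v good r c \<and> (\<forall>e\<in>dl E g {v}. c e = \<phi> e)))"
  proof (intro exI[of _ gv] exI[of _ rv] conjI allI impI gv)
    fix \<phi> :: "'e \<Rightarrow> nat" assume "(\<forall>e. \<phi> e \<le> k) \<and> rv \<le> card {e \<in> dl E g {v} \<inter> gv. \<phi> e = 0}"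
    then obtain c' \<mu> where R: "routing E' g' T v k c' \<mu>" and D: "served E' g' T v good r c'"
      and \<phi>: "\<forall>e\<in>dl E g {v}. c' e = \<phi> e" using ext by blast
    define c where "c e = (if e \<in> E' then c' e else 0)" for e
    have dE: "dl E' g' X \<subseteq> E'" for X unfolding dl_def by blast
    have "routing E g T v k c \<mu>"
      by (rule routing_lift[OF R _ E' _ gT gg v]) (simp_all add: c_def)
    moreover have "served E g T v good r c" unfolding served_def
    proof
      fix t assume t: "t \<in> T - {v}"
      then have "r t \<le> card {e \<in> dl E' g' {t} \<inter> good t. c' e = 0}" using D unfolding served_def by blast
      also have "\<dots> \<le> card {e \<in> dl E g {t} \<inter> good t. c e = 0}"
        by (rule card_mono) (use fin sub[of t] t dE[of "{t}"] in \<open>auto simp: c_def\<close>)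
      finally show "r t \<le> card {e \<in> dl E g {t} \<inter> good t. c e = 0}" .
    qed
    moreover have "\<forall>e\<in>dl E g {v}. c e = \<phi> e" using \<phi> dE[of "{v}"] unfolding dv c_def by auto
    ultimately show "\<exists>c \<mu>. routing E g T v k c \<mu> \<and> served E g T v good r c \<and> (\<forall>e\<in>dl E g {v}. c e = \<phi> e)"
      by blast
  qed
qed

section \<open>Detaching two half-edges from a nonterminal\<close>

locale detach =
  fixes E :: "'e set" and g :: "'e \<times> bool \<Rightarrow> 'v" and T :: "'v set" and w z :: 'v and h1 h2 :: "'e \<times> bool"
  assumes fin: "finite E" "finite T" and ne: "fst h1 \<noteq> fst h2" and inE: "fst h1 \<in> E" "fst h2 \<in> E"
    and at: "g h1 = w" "g h2 = w" and off: "g (flip h1) \<noteq> w" "g (flip h2) \<noteq> w"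
    and w: "w \<notin> T" and z: "z \<notin> vts E g T"
begin

text \<open>The two edges are not merged into one; they meet in a new nonterminal \<open>z\<close>
  instead. The edge set is unchanged, so good edges and root colours keep their meaning, and a
  pairing at \<open>z\<close> is also a pairing at \<open>w\<close>.\<close>

definition "g' = g(h1 := z, h2 := z)"

lemma g'_simps: "g' h1 = z" "g' h2 = z" "g' (flip h1) = g (flip h1)" "g' (flip h2) = g (flip h2)"
proof -
  have "flip h1 \<noteq> h2" "flip h2 \<noteq> h1" using ne by (metis flip_simps(1))+
  then show "g' h1 = z" "g' h2 = z" "g' (flip h1) = g (flip h1)" "g' (flip h2) = g (flip h2)"
    unfolding g'_def by auto
qed

lemma g'_other: "h \<noteq> h1 \<Longrightarrow> h \<noteq> h2 \<Longrightarrow> g' h = g h"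
  unfolding g'_def by simp

lemma g'_cases: "(h = h1 \<or> h = h2) \<and> g' h = z \<and> g h = w \<or> h \<noteq> h1 \<and> h \<noteq> h2 \<and> g' h = g h"
  using g'_simps g'_other[of h] at by auto

lemma not_z: "fst h \<in> E \<Longrightarrow> g h \<noteq> z" "z \<notin> T"
  using vts_half[of h E g T] z unfolding vts_def by auto

lemma wz: "w \<noteq> z"
  using not_z(1)[OF inE(1)] at by simp

lemma dl_same: "(w \<in> X \<longleftrightarrow> z \<in> X) \<Longrightarrow> dl E g' X = dl E g X"
proof -
  assume "w \<in> X \<longleftrightarrow> z \<in> X"
  then have "g' h \<in> X \<longleftrightarrow> g h \<in> X" for h using g'_cases[of h] by auto
  then show ?thesis unfolding dl_def by simp
qed

lemma dl_terminal: "t \<in> T \<Longrightarrow> dl E g' {t} = dl E g {t}"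
  by (rule dl_same) (use w not_z(2) in auto)

lemma dl_off: "e \<noteq> fst h1 \<Longrightarrow> e \<noteq> fst h2 \<Longrightarrow> e \<in> dl E g' X \<longleftrightarrow> e \<in> dl E g X"
  using g'_other[of "(e, True)"] g'_other[of "(e, False)"] unfolding dl_def by force

lemma dl_z:
  assumes "z \<in> X" "w \<notin> X"
  shows "fst h1 \<in> dl E g' X \<longleftrightarrow> g (flip h1) \<notin> X" "fst h2 \<in> dl E g' X \<longleftrightarrow> g (flip h2) \<notin> X"
    "fst h1 \<in> dl E g X \<longleftrightarrow> g (flip h1) \<in> X" "fst h2 \<in> dl E g X \<longleftrightarrow> g (flip h2) \<in> X"
  using assms inE at g'_simps unfolding dl_half by auto

text \<open>Only the two detached edges matter: each enters the cut if its other end is outside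
  \<open>X\<close> and leaves it otherwise. The cut shrinks only if both other ends are inside, and
  then by two, which is what \<open>dan\<close> allows for.\<close>

lemma cut_z:
  assumes X: "z \<in> X" "w \<notin> X" and K: "K \<le> card (dl E g X)"
    and dan: "g (flip h1) \<in> X \<Longrightarrow> g (flip h2) \<in> X \<Longrightarrow> K + 2 \<le> card (dl E g X)"
  shows "K \<le> card (dl E g' X)"
proof -
  have step: "K \<le> card (dl E g' X)" if "a \<in> dl E g' X" "a \<notin> dl E g X" "dl E g X - {b} \<subseteq> dl E g' X" for a b
  proof -
    have "card (insert a (dl E g X - {b})) \<le> card (dl E g' X)"
      using that fin by (intro card_mono) auto
    moreover have "card (insert a (dl E g X - {b})) = Suc (card (dl E g X - {b}))"
      using that fin by (intro card_insert_disjoint) auto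
    moreover have "card (dl E g X) \<le> Suc (card (dl E g X - {b}))"
      using card_Suc_Diff1[of "dl E g X" b] fin by (cases "b \<in> dl E g X") auto
    ultimately show ?thesis using K by linarith
  qed
  note d = dl_z[OF X]
  consider "g (flip h1) \<in> X" "g (flip h2) \<in> X" | "g (flip h1) \<notin> X" | "g (flip h2) \<notin> X" by blast
  then show ?thesis
  proof cases
    case 1
    have "dl E g X \<subseteq> dl E g' X \<union> {fst h1, fst h2}" using dl_off[of _ X] by blast
    then have "card (dl E g X) \<le> card (dl E g' X \<union> {fst h1, fst h2})" using fin by (intro card_mono) auto
    also have "\<dots> \<le> card (dl E g' X) + card {fst h1, fst h2}" by (rule card_Un_le)
    also have "card {fst h1, fst h2} = 2" using ne by simp
    finally show ?thesis using dan[OF 1] by linarith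
  next
    case 2
    have "dl E g X - {fst h2} \<subseteq> dl E g' X"
    proof
      fix e assume e: "e \<in> dl E g X - {fst h2}"
      then have "e \<noteq> fst h1" using d(3) 2 by auto
      then show "e \<in> dl E g' X" using dl_off[of e X] e by blast
    qed
    then show ?thesis using step[of "fst h1" "fst h2"] d 2 by blast
  next
    case 3
    have "dl E g X - {fst h1} \<subseteq> dl E g' X"
    proof
      fix e assume e: "e \<in> dl E g X - {fst h1}"
      then have "e \<noteq> fst h2" using d(4) 3 by auto
      then show "e \<in> dl E g' X" using dl_off[of e X] e by blast
    qed
    then show ?thesis using step[of "fst h2" "fst h1"] d 3 by blast
  qed
qed

lemma cuts_detach:
  assumes cuts: "\<And>X. X \<inter> T \<noteq> {} \<Longrightarrow> T - X \<noteq> {} \<Longrightarrow> K \<le> card (dl E g X)"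
    and dan: "\<And>X. w \<notin> X \<Longrightarrow> T - X \<noteq> {} \<Longrightarrow> g (flip h1) \<in> X \<Longrightarrow> g (flip h2) \<in> X \<Longrightarrow> K + 2 \<le> card (dl E g X)"
    and X: "X \<inter> T \<noteq> {}" "T - X \<noteq> {}"
  shows "K \<le> card (dl E g' X)"
proof -
  consider "w \<in> X \<longleftrightarrow> z \<in> X" | "z \<in> X" "w \<notin> X" | "z \<notin> X" "w \<in> X" by blast
  then show ?thesis
  proof cases
    case 1
    then show ?thesis using dl_same[of X] cuts[OF X] by simp
  next
    case 2
    then show ?thesis using cut_z[OF 2 cuts[OF X]] dan[of X] X by blast
  next
    case 3
    have n: "z \<in> - X" "w \<notin> - X" using 3 by auto
    have X': "(- X) \<inter> T \<noteq> {}" "T - (- X) \<noteq> {}" using X by auto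
    have "K \<le> card (dl E g' (- X))" using cut_z[OF n cuts[OF X']] dan[of "- X"] X' n by blast
    then show ?thesis using dl_compl[of E g' X] by simp
  qed
qed

lemma graph_measure_detach:
  assumes deg: "4 \<le> card (dl E g {w})"
  shows "graph_measure E g' T < graph_measure E g T"
proof -
  let ?V = "vts E g T" and ?V' = "vts E g' T"
  have fV: "finite ?V" using fin by (rule finite_vts)
  have sub: "?V' \<subseteq> insert z ?V"
  proof
    fix u assume "u \<in> ?V'"
    then show "u \<in> insert z ?V"
    proof (rule vts_cases)
      assume "u \<in> T"
      then show ?thesis unfolding vts_def by simp
    next
      fix h assume h: "fst h \<in> E" "g' h = u"
      then show ?thesis using g'_cases[of h] vts_half[OF h(1), of g T] by auto
    qed
  qed
  have wV: "w \<in> ?V - T" using vts_half[OF inE(1), of g T] at w by simp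
  have V: "card ?V' \<le> card ?V + 1"
    using card_mono[OF _ sub] fV z by simp
  let ?d = "\<lambda>u. (card (dl E g {u}))\<^sup>2" and ?d' = "\<lambda>u. (card (dl E g' {u}))\<^sup>2"
  have "dl E g' {z} \<subseteq> {fst h1, fst h2}"
  proof
    fix e assume e: "e \<in> dl E g' {z}"
    show "e \<in> {fst h1, fst h2}"
    proof (rule ccontr)
      assume "e \<notin> {fst h1, fst h2}"
      then have "e \<in> dl E g {z}" using dl_off[of e "{z}"] e by simp
      then show False using not_z(1)[of "(e, True)"] not_z(1)[of "(e, False)"] unfolding dl_def by auto
    qed
  qed
  then have "card (dl E g' {z}) \<le> card {fst h1, fst h2}" by (intro card_mono) auto
  then have dz: "card (dl E g' {z}) \<le> 2" using ne by simp
  have e12: "{fst h1, fst h2} \<subseteq> dl E g {w}" using inE at off unfolding dl_half[of h1] dl_half[of h2] insert_subset by (simp add: dl_half)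
  have "dl E g' {w} \<subseteq> dl E g {w} - {fst h1, fst h2}"
  proof
    fix e assume e: "e \<in> dl E g' {w}"
    have "fst h1 \<notin> dl E g' {w}" "fst h2 \<notin> dl E g' {w}" unfolding dl_half using g'_simps wz off by auto
    then have "e \<noteq> fst h1" "e \<noteq> fst h2" using e by auto
    then show "e \<in> dl E g {w} - {fst h1, fst h2}" using dl_off[of e "{w}"] e by simp
  qed
  then have "card (dl E g' {w}) \<le> card (dl E g {w} - {fst h1, fst h2})" using fin by (intro card_mono) auto
  also have "\<dots> = card (dl E g {w}) - 2" using card_Diff_subset[OF _ e12] ne by simp
  finally have le: "card (dl E g' {w}) \<le> card (dl E g {w}) - 2" .
  define m where "m = card (dl E g {w}) - 2"
  have m: "card (dl E g' {w}) \<le> m" "card (dl E g {w}) = m + 2" "2 \<le> m"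
    using le deg unfolding m_def by simp_all
  have "(\<Sum>u\<in>?V' - T. ?d' u) \<le> (\<Sum>u\<in>insert z (?V - T). ?d' u)"
    by (rule sum_mono2) (use fV sub in auto)
  also have "\<dots> = ?d' z + (\<Sum>u\<in>?V - T. ?d' u)" using fV z by simp
  also have "(\<Sum>u\<in>?V - T. ?d' u) = ?d' w + (\<Sum>u\<in>?V - T - {w}. ?d' u)" using fV wV by (intro sum.remove) auto
  also have "(\<Sum>u\<in>?V - T - {w}. ?d' u) = (\<Sum>u\<in>?V - T - {w}. ?d u)"
  proof (rule sum.cong)
    fix u assume u: "u \<in> ?V - T - {w}"
    then have "dl E g' {u} = dl E g {u}" by (intro dl_same) (use z in auto)
    then show "?d' u = ?d u" by simp
  qed simp
  finally have s': "(\<Sum>u\<in>?V' - T. ?d' u) \<le> ?d' z + (?d' w + (\<Sum>u\<in>?V - T - {w}. ?d u))" .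
  have s: "(\<Sum>u\<in>?V - T. ?d u) = ?d w + (\<Sum>u\<in>?V - T - {w}. ?d u)" using fV wV by (intro sum.remove) auto
  have "?d' z \<le> 2\<^sup>2" "?d' w \<le> m\<^sup>2" using dz m(1) by (intro power_mono; simp)+
  then have "?d' z \<le> 4" "?d' w \<le> m\<^sup>2" by simp_all
  moreover have "?d w = m\<^sup>2 + 4 * m + 4" unfolding m(2) by (simp add: power2_eq_square algebra_simps)
  ultimately have "(\<Sum>u\<in>?V' - T. ?d' u) + 8 \<le> (\<Sum>u\<in>?V - T. ?d u)" using s s' m(3) by linarith
  then show ?thesis using V unfolding graph_measure_def by linarith
qed

lemma solvable_detach:
  assumes S: "solvable E g' T v k" and v: "v \<in> T" and tv: "card (dl E g {v}) = 6 * k + 6"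
  shows "solvable E g T v k"
proof (rule solvable_lift[OF S fin(1) _ v _ _ _ _ tv])
  show "g' h = g h" if "g' h \<in> T \<or> g h \<in> T" for h
    using g'_cases[of h] that w not_z(2) by auto
  show "g h = g h'" if "fst h \<in> E" "fst h' \<in> E" "g' h = g' h'" for h h'
    using g'_cases[of h] g'_cases[of h'] that(3) not_z(1)[OF that(1)] not_z(1)[OF that(2)] by auto
qed (simp_all add: dl_terminal)

end

text \<open>Vertices are natural numbers, so that detaching finds a vertex outside the finite set
  \<open>vts E g T\<close>. The reductions are tried in a fixed order, since deletion relies on
  tight sets being trivial and splitting on every edge being at a tight terminal.\<close>

theorem rooted_solvable:
  fixes g :: "'e \<times> bool \<Rightarrow> nat"
  assumes "rooted E g T v k"
  shows "solvable E g T v k"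
  using assms
proof (induction "graph_measure E g T" arbitrary: E g T v rule: less_induct)
  case less
  have fin: "finite E" "finite T" and v: "v \<in> T" and T2: "T - {v} \<noteq> {}" and tv: "card (dl E g {v}) = 6 * k + 6"
    and cuts: "\<And>X. X \<inter> T \<noteq> {} \<Longrightarrow> T - X \<noteq> {} \<Longrightarrow> 6 * k + 6 \<le> card (dl E g X)"
    using less.prems unfolding rooted_def by blast+
  let ?V = "vts E g T"
  have fV: "finite ?V" using fin by (rule finite_vts)
  show ?case
  proof (cases "\<exists>X. X \<inter> T \<noteq> {} \<and> T - X \<noteq> {} \<and> card (dl E g X) = 6 * k + 6 \<and> 2 \<le> card (?V \<inter> X) \<and> 2 \<le> card (?V - X)")
    case True
    then obtain X0 where X0: "X0 \<inter> T \<noteq> {}" "T - X0 \<noteq> {}" "card (dl E g X0) = 6 * k + 6" "2 \<le> card (?V \<inter> X0)" "2 \<le> card (?V - X0)"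
      by blast
    \<comment> \<open>The root has to lie outside: it is the contracted vertex for the side
      \<open>X\<close> and an ordinary vertex of the other side, and is the root of both.\<close>
    define X where "X = (if v \<in> X0 then - X0 else X0)"
    have X: "X \<inter> T \<noteq> {}" "card (dl E g X) = 6 * k + 6" "2 \<le> card (?V \<inter> X)" "2 \<le> card (?V - X)"
      using X0 dl_compl[of E g X0] unfolding X_def by (auto simp: Diff_eq Int_commute)
    have vX: "v \<notin> X" unfolding X_def by simp
    obtain s0 where s0: "s0 \<in> T" "s0 \<in> X" using X(1) by blast
    have sX: "s0 \<notin> - X" using s0 by simp
    have "solvable (contract_edges E g X) (contract_map g X v) (insert v (T \<inter> X)) v k"
    proof (rule less.hyps)
      show "graph_measure (contract_edges E g X) (contract_map g X v) (insert v (T \<inter> X)) < graph_measure E g T" by (rule graph_measure_con[OF fin v vX X(4)])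
      show "rooted (contract_edges E g X) (contract_map g X v) (insert v (T \<inter> X)) v k" unfolding rooted_def
      proof (intro conjI allI impI)
        show "finite (contract_edges E g X)" using fin unfolding contract_edges_def by simp
        show "insert v (T \<inter> X) - {v} \<noteq> {}" using s0 vX by auto
        show "card (dl (contract_edges E g X) (contract_map g X v) {v}) = 6 * k + 6" using dl_con_root[OF vX, of E g] X(2) by simp
      qed (use fin in simp, simp, rule con_cuts[OF cuts v vX])
    qed
    moreover have "solvable (contract_edges E g (- X)) (contract_map g (- X) s0) (insert s0 (T - X)) v k"
    proof (rule less.hyps)
      have "2 \<le> card (?V - (- X))" using X(3) by (simp add: Diff_eq)
      from graph_measure_con[OF fin s0(1) sX this]
      show "graph_measure (contract_edges E g (- X)) (contract_map g (- X) s0) (insert s0 (T - X)) < graph_measure E g T" by (simp add: Diff_eq)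
      show "rooted (contract_edges E g (- X)) (contract_map g (- X) s0) (insert s0 (T - X)) v k" unfolding rooted_def
      proof (intro conjI allI impI)
        show "finite (contract_edges E g (- X))" using fin unfolding contract_edges_def by simp
        show "finite (insert s0 (T - X))" using fin by simp
        show "v \<in> insert s0 (T - X)" using v vX by simp
        show "insert s0 (T - X) - {v} \<noteq> {}" using s0 vX by auto
        show "card (dl (contract_edges E g (- X)) (contract_map g (- X) s0) {v}) = 6 * k + 6"
          using dl_con_in[OF sX, of v E g] vX tv by simp
        fix Z assume "Z \<inter> insert s0 (T - X) \<noteq> {}" "insert s0 (T - X) - Z \<noteq> {}"
        then show "6 * k + 6 \<le> card (dl (contract_edges E g (- X)) (contract_map g (- X) s0) Z)"
          using con_cuts[OF cuts s0(1) sX, of Z] by (simp add: Diff_eq)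
      qed
    qed
    ultimately show ?thesis by (rule solvable_glue[OF v vX s0 X(2)])
  next
    case no_tight: False
    have trivial: "(\<exists>t. X = {t}) \<or> (\<exists>t. ?V - X = {t})"
      if X: "X \<inter> T \<noteq> {}" "T - X \<noteq> {}" "X \<subseteq> ?V" "card (dl E g X) = 6 * k + 6" for X
    proof -
      have "card (?V \<inter> X) < 2 \<or> card (?V - X) < 2" using no_tight X by (meson not_le_imp_less)
      moreover have "?V \<inter> X = X" using X by blast
      moreover have "card X \<noteq> 0" using X(1,3) fV finite_subset by fastforce
      moreover have "card (?V - X) \<noteq> 0"
      proof -
        have "?V - X \<noteq> {}" using X(2) unfolding vts_def by blast
        then show ?thesis using fV by simp
      qed
      ultimately have "card X = 1 \<or> card (?V - X) = 1" by (auto simp: less_2_cases_iff)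
      then show ?thesis by (metis card_1_singletonE)
    qed
    show ?thesis
    proof (cases "\<exists>e0\<in>E. \<forall>t\<in>T. card (dl E g {t}) = 6 * k + 6 \<longrightarrow> e0 \<notin> dl E g {t}")
      case True
      then obtain e0 where e0: "e0 \<in> E" "\<And>t. t \<in> T \<Longrightarrow> card (dl E g {t}) = 6 * k + 6 \<Longrightarrow> e0 \<notin> dl E g {t}" by blast
      have del: "dl (E - {e0}) g X = dl E g X - {e0}" for X unfolding dl_def by blast
      \<comment> \<open>No tight cut contains \<open>e0\<close>: within \<open>?V\<close> a tight
        set is a single vertex or the complement of one, and since it separates \<open>T\<close>,
        that vertex is a tight terminal, whose cut avoids \<open>e0\<close>. So a cut through
        \<open>e0\<close> has an edge to spare.\<close>
      have cuts': "6 * k + 6 \<le> card (dl (E - {e0}) g X)" if X: "X \<inter> T \<noteq> {}" "T - X \<noteq> {}" for X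
      proof (cases "e0 \<in> dl E g X")
        case False
        then show ?thesis using cuts[OF X] del[of X] by simp
      next
        case e: True
        have "card (dl E g X) \<noteq> 6 * k + 6"
        proof
          assume tight: "card (dl E g X) = 6 * k + 6"
          define Y where "Y = X \<inter> ?V"
          have TV: "T \<subseteq> ?V" unfolding vts_def by simp
          have Y: "Y \<inter> T \<noteq> {}" "T - Y \<noteq> {}" "Y \<subseteq> ?V" "card (dl E g Y) = 6 * k + 6" "e0 \<in> dl E g Y"
            using X TV tight e dl_Int_vts[of E g X T] unfolding Y_def by auto
          from trivial[OF Y(1-4)] show False
          proof
            assume "\<exists>t. Y = {t}"
            then obtain t where t: "Y = {t}" by blast
            then have "t \<in> T" using Y(1) by auto
            then show False using e0(2)[of t] Y(4,5) t by simp
          next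
            assume "\<exists>t. ?V - Y = {t}"
            then obtain t where t: "?V - Y = {t}" by blast
            obtain u where u: "u \<in> T" "u \<notin> Y" using Y(2) by blast
            then have "u \<in> ?V - Y" using TV by blast
            then have "t \<in> T" using u(1) t by simp
            moreover have "dl E g {t} = dl E g Y"
              using dl_Int_vts[of E g "- Y" T] dl_compl[of E g Y] t by (metis Diff_eq inf_commute)
            ultimately show False using e0(2)[of t] Y(4,5) by simp
          qed
        qed
        then have "6 * k + 6 < card (dl E g X)" using cuts[OF X] by simp
        then show ?thesis unfolding del using e fin by simp
      qed
      have "solvable (E - {e0}) g T v k"
      proof (rule less.hyps)
        show "rooted (E - {e0}) g T v k" unfolding rooted_def
          using fin v T2 cuts' del[of "{v}"] e0(2)[OF v tv] tv by simp
        have V: "vts (E - {e0}) g T \<subseteq> ?V" unfolding vts_def by auto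
        have "(\<Sum>u\<in>vts (E - {e0}) g T - T. (card (dl (E - {e0}) g {u}))\<^sup>2) \<le> (\<Sum>u\<in>vts (E - {e0}) g T - T. (card (dl E g {u}))\<^sup>2)"
          using fin unfolding del by (intro sum_mono power_mono card_mono) auto
        also have "\<dots> \<le> (\<Sum>u\<in>?V - T. (card (dl E g {u}))\<^sup>2)" using V fV by (intro sum_mono2) auto
        finally have "(\<Sum>u\<in>vts (E - {e0}) g T - T. (card (dl (E - {e0}) g {u}))\<^sup>2) \<le> (\<Sum>u\<in>?V - T. (card (dl E g {u}))\<^sup>2)" .
        moreover have "card (vts (E - {e0}) g T) \<le> card ?V" using V fV by (intro card_mono)
        moreover have "card (E - {e0}) < card E" using e0(1) fin by (metis card_Diff1_less)
        ultimately show "graph_measure (E - {e0}) g T < graph_measure E g T" unfolding graph_measure_def by linarith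
      qed
      then show ?thesis
        by (rule solvable_lift[OF _ fin(1) _ v _ _ _ _ tv]) (use e0 del in auto)
    next
      case False
      have cover: "\<exists>t\<in>T. card (dl E g {t}) = 6 * k + 6 \<and> e \<in> dl E g {t}" if "e \<in> E" for e
        using False that by blast
      interpret reduced_graph E g T "6 * k + 6"
        by unfold_locales (use fin cuts trivial cover in simp_all)
      show ?thesis
      proof (cases "\<exists>w. w \<notin> T \<and> 4 \<le> card (dl E g {w})")
        case True
        then obtain w where w: "w \<notin> T" "4 \<le> card (dl E g {w})" by blast
        obtain e f where ef: "e \<in> dl E g {w}" "f \<in> dl E g {w}" "e \<noteq> f"
          and dan: "\<forall>X. w \<notin> X \<and> T - X \<noteq> {} \<and> nb w e \<in> X \<and> nb w f \<in> X \<longrightarrow> 6 * k + 6 + 2 \<le> card (dl E g X)"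
          using splittable_pair[OF w] by (elim bexE conjE)
        have half: "\<exists>h. fst h = e \<and> g h = w \<and> g (flip h) = nb w e \<and> nb w e \<noteq> w" if "e \<in> dl E g {w}" for e
        proof -
          have "nb w e \<noteq> w" using nb(1)[OF w(1) that] w(1) by metis
          then show ?thesis using nb(3)[OF w(1) that] unfolding flip_def by (metis (full_types) fst_conv snd_conv)
        qed
        obtain h1 where h1: "fst h1 = e" "g h1 = w" "g (flip h1) = nb w e" "nb w e \<noteq> w" using half[OF ef(1)] by blast
        obtain h2 where h2: "fst h2 = f" "g h2 = w" "g (flip h2) = nb w f" "nb w f \<noteq> w" using half[OF ef(2)] by blast
        obtain z where z: "z \<notin> ?V" using ex_new_if_finite[OF infinite_UNIV_nat fV] by blast
        have inE: "e \<in> E" "f \<in> E" using ef unfolding dl_def by auto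
        interpret dt: detach E g T w z h1 h2
          by unfold_locales (use fin ef inE h1 h2 w z in simp_all)
        have "solvable E dt.g' T v k"
        proof (rule less.hyps)
          show "graph_measure E dt.g' T < graph_measure E g T" by (rule dt.graph_measure_detach[OF w(2)])
          have "6 * k + 6 \<le> card (dl E dt.g' X)" if "X \<inter> T \<noteq> {}" "T - X \<noteq> {}" for X
          proof (rule dt.cuts_detach[OF cuts _ that])
            fix Y assume Y: "w \<notin> Y" "T - Y \<noteq> {}" "g (flip h1) \<in> Y" "g (flip h2) \<in> Y"
            show "6 * k + 6 + 2 \<le> card (dl E g Y)"
              by (rule dan[rule_format]) (intro conjI Y(1,2) Y(3)[unfolded h1(3)] Y(4)[unfolded h2(3)])
          qed
          then show "rooted E dt.g' T v k" unfolding rooted_def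
            using fin v T2 tv dt.dl_terminal[OF v] by simp
        qed
        then show ?thesis by (rule dt.solvable_detach[OF _ v tv])
      next
        case False
        then have deg3: "card (dl E g {w}) \<le> 3" if "w \<notin> T" for w using that by (metis not_less_eq_eq numeral_3_eq_3 numeral_eq_Suc pred_numeral_simps(2) semiring_norm(26) semiring_norm(27))
        interpret star_graph E g T k v
          by unfold_locales (use v T2 tv deg3 in simp_all)
        show ?thesis by (rule star_solvable)
      qed
    qed
  qed
qed

section \<open>From routings to connectors\<close>

lemma lnk_image:
  assumes R: "\<And>x y. (x, y) \<in> R \<Longrightarrow> (f x, f y) \<in> lnk S" and xy: "(x, y) \<in> lnk R"
  shows "(f x, f y) \<in> lnk S"
proof -
  have "lnk R \<subseteq> {(x, y). (f x, f y) \<in> lnk S}"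
  proof (rule lnk_least)
    show "R \<subseteq> {(x, y). (f x, f y) \<in> lnk S}" using R by blast
    show "(y, x) \<in> {(x, y). (f x, f y) \<in> lnk S}" if "(x, y) \<in> {(x, y). (f x, f y) \<in> lnk S}" for x y
      using that lnk_sym by simp
    show "(x, z) \<in> {(x, y). (f x, f y) \<in> lnk S}"
      if "(x, y) \<in> {(x, y). (f x, f y) \<in> lnk S}" "(y, z) \<in> {(x, y). (f x, f y) \<in> lnk S}" for x y z
      using that lnk_trans[of "f x" "f y" S "f z"] by simp
  qed simp
  then show ?thesis using xy by blast
qed

text \<open>The counterpart of \<open>hop\<close> for a single colour class without a root: trails
  may turn at every terminal.\<close>

definition trail_step where
  "trail_step F \<gamma> T m = {(h, h'). fst h \<in> F \<and> fst h' \<in> F \<and>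
     (h' = flip h \<or> (\<gamma> h \<notin> T \<and> h' = m h) \<or> (\<gamma> h \<in> T \<and> \<gamma> h' = \<gamma> h))}"

lemma trail_stepI:
  assumes "fst h \<in> F" "fst h' \<in> F"
  shows "h' = flip h \<Longrightarrow> (h, h') \<in> trail_step F \<gamma> T m"
    "\<gamma> h \<notin> T \<Longrightarrow> h' = m h \<Longrightarrow> (h, h') \<in> trail_step F \<gamma> T m"
    "\<gamma> h \<in> T \<Longrightarrow> \<gamma> h' = \<gamma> h \<Longrightarrow> (h, h') \<in> trail_step F \<gamma> T m"
  using assms unfolding trail_step_def by blast+

definition mated where
  "mated F \<gamma> T m \<longleftrightarrow> (\<forall>h. fst h \<in> F \<and> \<gamma> h \<notin> T \<longrightarrow> fst (m h) \<in> F \<and> m h \<noteq> h \<and> m (m h) = h \<and> \<gamma> (m h) = \<gamma> h)"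

lemma matedD:
  assumes "mated F \<gamma> T m" "fst h \<in> F" "\<gamma> h \<notin> T"
  shows "fst (m h) \<in> F" "m h \<noteq> h" "m (m h) = h" "\<gamma> (m h) = \<gamma> h"
  using assms unfolding mated_def by blast+

lemma adjacent_sym: "adjacent G u v \<Longrightarrow> adjacent G v u"
  unfolding adjacent_def by (metis insert_commute)

lemma connected_on_terminals:
  assumes ed: "edges H = F" and en: "\<And>h. fst h \<in> F \<Longrightarrow> ends H (fst h) = {\<gamma> h, \<gamma> (flip h)}" and TV: "T \<subseteq> vertices H"
    and inT: "\<And>h. fst h \<in> F \<Longrightarrow> \<gamma> h \<in> T"
    and conn: "\<And>s t. s \<in> T \<Longrightarrow> t \<in> T \<Longrightarrow> s \<noteq> t \<Longrightarrow>
      \<exists>h h'. fst h \<in> F \<and> fst h' \<in> F \<and> \<gamma> h = s \<and> \<gamma> h' = t \<and> (h, h') \<in> lnk (trail_step F \<gamma> T m)"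
  shows "vertices (discard_isolated T H) = T" "connected_graph (discard_isolated T H)"
proof -
  have "x \<in> T" if x: "\<not> isolated H x" for x
  proof -
    obtain e where e: "e \<in> F" "x \<in> ends H e" using x ed unfolding isolated_def by blast
    then show ?thesis using en[of "(e, True)"] inT[of "(e, True)"] inT[of "flip (e, True)"] by auto
  qed
  then show vT: "vertices (discard_isolated T H) = T" using TV unfolding discard_isolated_def by auto
  let ?D = "discard_isolated T H"
  have D: "edges ?D = F" "ends ?D = ends H" using ed unfolding discard_isolated_def by simp_all
  define A where "A = {(h, h'). (adjacent ?D)\<^sup>*\<^sup>* (\<gamma> h) (\<gamma> h')}"
  have sym: "(adjacent ?D)\<^sup>*\<^sup>* v u" if "(adjacent ?D)\<^sup>*\<^sup>* u v" for u v
    using that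
  proof (induction rule: rtranclp_induct)
    case (step y z)
    then show ?case using adjacent_sym converse_rtranclp_into_rtranclp by metis
  qed simp
  have "lnk (trail_step F \<gamma> T m) \<subseteq> A"
  proof (rule lnk_least)
    show "trail_step F \<gamma> T m \<subseteq> A"
    proof
      fix p assume "p \<in> trail_step F \<gamma> T m"
      then obtain h h' where p: "p = (h, h')" "fst h \<in> F" "h' = flip h \<or> \<gamma> h' = \<gamma> h"
        using inT unfolding trail_step_def by blast
      have "adjacent ?D (\<gamma> h) (\<gamma> (flip h))" using en[OF p(2)] p(2) D unfolding adjacent_def by auto
      then show "p \<in> A" using p unfolding A_def by auto
    qed
    show "(x, y) \<in> A \<Longrightarrow> (y, x) \<in> A" for x y using sym unfolding A_def by blast
    show "(x, z) \<in> A" if "(x, y) \<in> A" "(y, z) \<in> A" for x y z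
      using that unfolding A_def by (simp add: rtranclp_trans[of _ "\<gamma> x" "\<gamma> y" "\<gamma> z"])
  qed (simp add: A_def)
  show "connected_graph ?D" unfolding connected_graph_def vT
  proof (intro ballI)
    fix s t assume st: "s \<in> T" "t \<in> T"
    show "(adjacent ?D)\<^sup>*\<^sup>* s t"
    proof (cases "s = t")
      case False
      then obtain h h' where "\<gamma> h = s" "\<gamma> h' = t" "(h, h') \<in> A" using conn[OF st] \<open>lnk (trail_step F \<gamma> T m) \<subseteq> A\<close> by blast
      then show ?thesis unfolding A_def by simp
    qed simp
  qed
qed

text \<open>Splitting a mated pair \<open>h1\<close>, \<open>h2\<close> keeps the label of \<open>h1\<close>. If \<open>h2\<close> were the other half of the
  same edge, that edge would be a closed trail avoiding \<open>T\<close>, which reachability excludes.\<close>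

lemma split_off:
  assumes "finite F" "edges H = F" "\<And>h. fst h \<in> F \<Longrightarrow> ends H (fst h) = {\<gamma> h, \<gamma> (flip h)}" "T \<subseteq> vertices H"
    and "mated F \<gamma> T m"
    and "\<And>s t. s \<in> T \<Longrightarrow> t \<in> T \<Longrightarrow> s \<noteq> t \<Longrightarrow>
      \<exists>h h'. fst h \<in> F \<and> fst h' \<in> F \<and> \<gamma> h = s \<and> \<gamma> h' = t \<and> (h, h') \<in> lnk (trail_step F \<gamma> T m)"
    and "\<And>h. fst h \<in> F \<Longrightarrow> \<exists>h'. fst h' \<in> F \<and> \<gamma> h' \<in> T \<and> (h', h) \<in> lnk (trail_step F \<gamma> T m)"
  shows "\<exists>H'. split_step\<^sup>*\<^sup>* H H' \<and> vertices (discard_isolated T H') = T \<and> connected_graph (discard_isolated T H')"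
  using assms
proof (induction "card F" arbitrary: F H \<gamma> m rule: less_induct)
  case less
  note fin = less.prems(1) and ed = less.prems(2) and en = less.prems(3) and TV = less.prems(4) and mate = less.prems(5)
    and conn = less.prems(6) and reach = less.prems(7)
  show ?case
  proof (cases "\<exists>h. fst h \<in> F \<and> \<gamma> h \<notin> T")
    case False
    then have inT: "\<And>h. fst h \<in> F \<Longrightarrow> \<gamma> h \<in> T" by blast
    show ?thesis using connected_on_terminals[OF ed en TV inT conn] by blast
  next
    case True
    then obtain h1 where h1: "fst h1 \<in> F" "\<gamma> h1 \<notin> T" by blast
    define h2 where "h2 = m h1"
    have h2: "fst h2 \<in> F" "h2 \<noteq> h1" "m h2 = h1" "\<gamma> h2 = \<gamma> h1" using matedD[OF mate h1] unfolding h2_def by auto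
    have h2T: "\<gamma> h2 \<notin> T" using h2(4) h1(2) by simp
    have "h2 \<noteq> flip h1"
    proof
      assume fl: "h2 = flip h1"
      have "lnk (trail_step F \<gamma> T m) \<subseteq> {(x, y). x \<in> {h1, h2} \<longleftrightarrow> y \<in> {h1, h2}}"
      proof (rule lnk_least)
        show "trail_step F \<gamma> T m \<subseteq> {(x, y). x \<in> {h1, h2} \<longleftrightarrow> y \<in> {h1, h2}}"
        proof
          fix p assume "p \<in> trail_step F \<gamma> T m"
          then obtain x y where p: "p = (x, y)" and xy: "fst x \<in> F" "fst y \<in> F"
            and or: "y = flip x \<or> (\<gamma> x \<notin> T \<and> y = m x) \<or> (\<gamma> x \<in> T \<and> \<gamma> y = \<gamma> x)" unfolding trail_step_def by blast
          from or have "x \<in> {h1, h2} \<longleftrightarrow> y \<in> {h1, h2}"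
          proof (elim disjE conjE)
            assume "y = flip x"
            then show ?thesis using fl by (metis flip_simps(2) insert_iff singletonD)
          next
            assume a: "\<gamma> x \<notin> T" "y = m x"
            have "m y = x" using matedD(3)[OF mate xy(1) a(1)] a(2) by simp
            then show ?thesis using a(2) h2(3) h2_def by (metis insert_iff singletonD)
          next
            assume a: "\<gamma> x \<in> T" "\<gamma> y = \<gamma> x"
            then have "x \<noteq> h1" "x \<noteq> h2" "y \<noteq> h1" "y \<noteq> h2" using h1(2) h2T by auto
            then show ?thesis by simp
          qed
          then show "p \<in> {(x, y). x \<in> {h1, h2} \<longleftrightarrow> y \<in> {h1, h2}}" using p by simp
        qed
      qed auto
      moreover obtain h' where h': "\<gamma> h' \<in> T" "(h', h1) \<in> lnk (trail_step F \<gamma> T m)" using reach[OF h1(1)] by blast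
      ultimately have "h' \<in> {h1, h2}" by blast
      then show False using h'(1) h1(2) h2T by auto
    qed
    then have ne: "fst h1 \<noteq> fst h2" using same_edge[of h1 h2] h2(2) by auto
    define e where "e = fst h1"
    define e' where "e' = fst h2"
    define F1 where "F1 = F - {e'}"
    define H1 where "H1 = \<lparr>vertices = vertices H, edges = insert e (edges H - {e, e'}), ends = (ends H)(e := {\<gamma> (flip h1), \<gamma> (flip h2)})\<rparr>"
    have ee: "e \<in> F" "e' \<in> F" "e \<noteq> e'" using h1 h2 ne unfolding e_def e'_def by auto
    have "split_step H H1" unfolding split_step_def
    proof (intro exI conjI)
      show "e \<in> edges H" "e' \<in> edges H" "e \<noteq> e'" using ee ed by auto
      show "ends H e = {\<gamma> h1, \<gamma> (flip h1)}" using en[OF h1(1)] unfolding e_def .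
      show "ends H e' = {\<gamma> h1, \<gamma> (flip h2)}" using en[OF h2(1)] h2(4) unfolding e'_def by simp
      show "e \<notin> edges H - {e, e'}" by simp
      show "H1 = \<lparr>vertices = vertices H, edges = insert e (edges H - {e, e'}), ends = (ends H)(e := {\<gamma> (flip h1), \<gamma> (flip h2)})\<rparr>"
        by (rule H1_def)
    qed
    \<comment> \<open>\<open>\<beta>\<close> sends old half-edges to new ones: both halves of the
      old \<open>e\<close> become (e, False) and both halves of \<open>e'\<close> become (e, True).
      \<open>\<alpha>\<close> goes back to the surviving halves \<open>flip h1\<close> and
      \<open>flip h2\<close>, and the new vertex map and mating are obtained through it.\<close>
    define \<alpha> where "\<alpha> h = (if h = (e, False) then flip h1 else if h = (e, True) then flip h2 else h)" for h
    define \<beta> where "\<beta> h = (if fst h = e then (e, False) else if fst h = e' then (e, True) else h)" for h :: "'a \<times> bool"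
    define \<gamma>1 where "\<gamma>1 = \<gamma> \<circ> \<alpha>"
    define m1 where "m1 = \<beta> \<circ> m \<circ> \<alpha>"
    have fsts: "fst h1 = e" "fst h2 = e'" unfolding e_def e'_def by auto
    have F1: "fst h \<in> F1 \<longleftrightarrow> fst h \<in> F \<and> fst h \<noteq> e'" for h :: "'a \<times> bool" unfolding F1_def by auto
    have \<beta>F: "fst (\<beta> h) \<in> F1" if "fst h \<in> F" for h
      using that ee unfolding \<beta>_def F1_def by auto
    have \<alpha>F: "fst (\<alpha> h) \<in> F" "\<alpha> h \<noteq> h1" "\<alpha> h \<noteq> h2" if "fst h \<in> F1" for h
    proof -
      have f: "fst h \<in> F" "fst h \<noteq> e'" using that F1 by auto
      have "h = (e, False) \<or> h = (e, True) \<or> fst h \<noteq> e" by (cases h; cases "snd h") auto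
      then have "(\<alpha> h = flip h1) \<or> (\<alpha> h = flip h2) \<or> (\<alpha> h = h \<and> fst h \<noteq> e)" unfolding \<alpha>_def by auto
      then show "fst (\<alpha> h) \<in> F" "\<alpha> h \<noteq> h1" "\<alpha> h \<noteq> h2"
        using f h1 h2 ne fsts by (metis flip_simps(1,3))+
    qed
    have \<beta>\<alpha>: "\<beta> (\<alpha> h) = h" if "fst h \<in> F1" for h
    proof -
      have f: "fst h \<noteq> e'" using that F1 by auto
      consider "h = (e, False)" | "h = (e, True)" | "fst h \<noteq> e" by (cases h; cases "snd h") auto
      then show ?thesis
      proof cases
        case 1
        then show ?thesis unfolding \<alpha>_def \<beta>_def using fsts by simp
      next
        case 2
        then show ?thesis unfolding \<alpha>_def \<beta>_def using fsts ee by simp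
      next
        case 3
        then have "\<alpha> h = h" unfolding \<alpha>_def by auto
        then show ?thesis using 3 f unfolding \<beta>_def by simp
      qed
    qed
    have \<alpha>\<beta>: "\<alpha> (\<beta> h) = h" if "h \<noteq> h1" "h \<noteq> h2" for h
    proof -
      consider "fst h = e" | "fst h = e'" | "fst h \<noteq> e" "fst h \<noteq> e'" by blast
      then show ?thesis
      proof cases
        case 1
        then have "h = flip h1" using same_edge[of h1 h] fsts that by auto
        then show ?thesis using 1 unfolding \<alpha>_def \<beta>_def by simp
      next
        case 2
        then have "h = flip h2" using same_edge[of h2 h] fsts that by auto
        then show ?thesis using 2 ee unfolding \<alpha>_def \<beta>_def by simp
      next
        case 3
        then show ?thesis unfolding \<alpha>_def \<beta>_def by auto
      qed
    qed
    have \<gamma>\<beta>: "\<gamma>1 (\<beta> h) = \<gamma> h" if "h \<noteq> h1" "h \<noteq> h2" for h using \<alpha>\<beta>[OF that] unfolding \<gamma>1_def by simp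
    have mne: "m h \<noteq> h1" "m h \<noteq> h2" if "h \<noteq> h1" "h \<noteq> h2" "fst h \<in> F" "\<gamma> h \<notin> T" for h
      using matedD(3)[OF mate that(3,4)] that(1,2) h2(3) h2_def by auto
    have m\<beta>: "m1 (\<beta> h) = \<beta> (m h)" if "h \<noteq> h1" "h \<noteq> h2" for h using \<alpha>\<beta>[OF that] unfolding m1_def by simp
    have e_halves: "\<beta> h1 = (e, False)" "\<beta> (flip h1) = (e, False)" "\<beta> h2 = (e, True)" "\<beta> (flip h2) = (e, True)"
      unfolding \<beta>_def using fsts ee by simp_all
    let ?S = "trail_step F \<gamma> T m" and ?S1 = "trail_step F1 \<gamma>1 T m1"
    \<comment> \<open>A flip of \<open>e\<close> or of \<open>e'\<close> becomes the identity, the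
      passage between \<open>h1\<close> and \<open>h2\<close> becomes the flip of the new edge, and
      all other steps persist.\<close>
    have step: "(\<beta> x, \<beta> y) \<in> lnk ?S1" if "(x, y) \<in> ?S" for x y
    proof -
      have xy: "fst x \<in> F" "fst y \<in> F"
        and or: "y = flip x \<or> (\<gamma> x \<notin> T \<and> y = m x) \<or> (\<gamma> x \<in> T \<and> \<gamma> y = \<gamma> x)" using that unfolding trail_step_def by blast+
      note b = \<beta>F[OF xy(1)] \<beta>F[OF xy(2)]
      from or show ?thesis
      proof (elim disjE conjE)
        assume y: "y = flip x"
        show ?thesis
        proof (cases "fst x = e \<or> fst x = e'")
          case True
          then have "\<beta> x = \<beta> y" using y unfolding \<beta>_def by auto
          then show ?thesis by simp
        next
          case False
          then have "\<beta> x = x" "\<beta> y = flip x" using y unfolding \<beta>_def by simp_all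
          then have "\<beta> y = flip (\<beta> x)" by simp
          then show ?thesis by (intro lnk_base trail_stepI(1) b)
        qed
      next
        assume a: "\<gamma> x \<notin> T" "y = m x"
        show ?thesis
        proof (cases "x = h1 \<or> x = h2")
          case True
          then have "\<beta> y = flip (\<beta> x)" using a(2) e_halves h2(3) h2_def[symmetric] unfolding flip_def by auto
          then show ?thesis by (intro lnk_base trail_stepI(1) b)
        next
          case False
          then have "\<gamma>1 (\<beta> x) \<notin> T" "\<beta> y = m1 (\<beta> x)" using \<gamma>\<beta>[of x] m\<beta>[of x] a by auto
          then show ?thesis by (intro lnk_base trail_stepI(2) b)
        qed
      next
        assume a: "\<gamma> x \<in> T" "\<gamma> y = \<gamma> x"
        then have "x \<noteq> h1" "x \<noteq> h2" "y \<noteq> h1" "y \<noteq> h2" using h1(2) h2T by auto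
        then have "\<gamma>1 (\<beta> x) \<in> T" "\<gamma>1 (\<beta> y) = \<gamma>1 (\<beta> x)" using \<gamma>\<beta> a by simp_all
        then show ?thesis by (intro lnk_base trail_stepI(3) b)
      qed
    qed
    have lift: "(\<beta> x, \<beta> y) \<in> lnk ?S1" if "(x, y) \<in> lnk ?S" for x y
      by (rule lnk_image[OF step that])
    have atT: "\<gamma>1 (\<beta> h) = \<gamma> h" if "\<gamma> h \<in> T" for h
      by (rule \<gamma>\<beta>) (use that h1(2) h2T in auto)
    have "\<exists>H'. split_step\<^sup>*\<^sup>* H1 H' \<and> vertices (discard_isolated T H') = T \<and> connected_graph (discard_isolated T H')"
    proof (rule less.hyps)
      show "card F1 < card F" using ee(2) fin unfolding F1_def by (metis card_Diff1_less)
      show "finite F1" using fin unfolding F1_def by simp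
      show "edges H1 = F1" using ed ee unfolding H1_def F1_def by auto
      show "T \<subseteq> vertices H1" using TV unfolding H1_def by simp
      show "ends H1 (fst h) = {\<gamma>1 h, \<gamma>1 (flip h)}" if h: "fst h \<in> F1" for h
      proof (cases "fst h = e")
        case True
        then have "h = (e, False) \<or> h = (e, True)" by (cases h; cases "snd h") auto
        then show ?thesis unfolding H1_def \<gamma>1_def \<alpha>_def flip_def by auto
      next
        case False
        then have "\<alpha> h = h" "\<alpha> (flip h) = flip h" unfolding \<alpha>_def flip_def by auto
        then show ?thesis using False en[of h] h F1 unfolding H1_def \<gamma>1_def by simp
      qed
      show "mated F1 \<gamma>1 T m1" unfolding mated_def
      proof (intro allI impI)
        fix h assume "fst h \<in> F1 \<and> \<gamma>1 h \<notin> T"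
        then have h: "fst h \<in> F1" "\<gamma> (\<alpha> h) \<notin> T" unfolding \<gamma>1_def by auto
        note a = \<alpha>F[OF h(1)]
        note d = matedD[OF mate a(1) h(2)] and q = mne[OF a(2,3,1) h(2)]
        have m1h: "m1 h = \<beta> (m (\<alpha> h))" unfolding m1_def by simp
        have am: "\<alpha> (m1 h) = m (\<alpha> h)" unfolding m1h by (rule \<alpha>\<beta>[OF q])
        have "m1 (m1 h) = \<beta> (m (m (\<alpha> h)))" using am unfolding m1_def by simp
        then have "m1 (m1 h) = h" using d(3) \<beta>\<alpha>[OF h(1)] by simp
        moreover have "m1 h \<noteq> h" using am d(2) by auto
        moreover have "\<gamma>1 (m1 h) = \<gamma>1 h" using am d(4) unfolding \<gamma>1_def by simp
        moreover have "fst (m1 h) \<in> F1" using \<beta>F[OF d(1)] m1h by simp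
        ultimately show "fst (m1 h) \<in> F1 \<and> m1 h \<noteq> h \<and> m1 (m1 h) = h \<and> \<gamma>1 (m1 h) = \<gamma>1 h" by blast
      qed
      show "\<exists>h h'. fst h \<in> F1 \<and> fst h' \<in> F1 \<and> \<gamma>1 h = s \<and> \<gamma>1 h' = t \<and> (h, h') \<in> lnk ?S1"
        if st: "s \<in> T" "t \<in> T" "s \<noteq> t" for s t
      proof -
        obtain h h' where h: "fst h \<in> F" "fst h' \<in> F" "\<gamma> h = s" "\<gamma> h' = t" "(h, h') \<in> lnk ?S" using conn[OF st] by blast
        then show ?thesis using \<beta>F atT lift st by (intro exI[of _ "\<beta> h"] exI[of _ "\<beta> h'"]) simp
      qed
      show "\<exists>h'. fst h' \<in> F1 \<and> \<gamma>1 h' \<in> T \<and> (h', h) \<in> lnk ?S1" if h: "fst h \<in> F1" for h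
      proof -
        obtain h' where h': "fst h' \<in> F" "\<gamma> h' \<in> T" "(h', \<alpha> h) \<in> lnk ?S" using reach[OF \<alpha>F(1)[OF h]] by blast
        have "(\<beta> h', h) \<in> lnk ?S1" using lift[OF h'(3)] \<beta>\<alpha>[OF h] by simp
        then show ?thesis using \<beta>F[OF h'(1)] atT[OF h'(2)] h'(2) by (intro exI[of _ "\<beta> h'"]) simp
      qed
    qed
    then show ?thesis using \<open>split_step H H1\<close> by (meson converse_rtranclp_into_rtranclp)
  qed
qed

text \<open>A closed trail that avoids \<open>T\<close> could not be split off, so only the part
  \<open>R\<close> of the colour class that is linked to terminals is kept. It is closed under links
  within \<open>F0\<close>, hence still mated, and trails starting at terminals stay inside
  it.\<close>

lemma connector_of_colour:
  assumes G: "finite_multigraph G" and TV: "T \<subseteq> vertices G"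
    and en: "\<And>h. fst h \<in> edges G \<Longrightarrow> ends G (fst h) = {\<gamma> h, \<gamma> (flip h)}"
    and F0: "F0 \<subseteq> edges G" and mate: "mated F0 \<gamma> T m"
    and conn: "\<And>s t. s \<in> T \<Longrightarrow> t \<in> T \<Longrightarrow> s \<noteq> t \<Longrightarrow>
      \<exists>h h'. fst h \<in> F0 \<and> fst h' \<in> F0 \<and> \<gamma> h = s \<and> \<gamma> h' = t \<and> (h, h') \<in> lnk (trail_step F0 \<gamma> T m)"
  shows "\<exists>F\<subseteq>F0. T_connector G T \<lparr>vertices = vertices G, edges = F, ends = ends G\<rparr>"
proof -
  let ?S = "trail_step F0 \<gamma> T m"
  define R where "R = {h. fst h \<in> F0 \<and> (\<exists>h'. fst h' \<in> F0 \<and> \<gamma> h' \<in> T \<and> (h', h) \<in> lnk ?S)}"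
  define F where "F = fst ` R"
  have closed: "y \<in> R" if x: "x \<in> R" and y: "fst y \<in> F0" and xy: "(x, y) \<in> lnk ?S" for x y
  proof -
    obtain h' where "fst h' \<in> F0" "\<gamma> h' \<in> T" "(h', x) \<in> lnk ?S" using x unfolding R_def by blast
    then show ?thesis using y xy lnk_trans[of h' x ?S y] unfolding R_def by blast
  qed
  have FR: "h \<in> R" if hF: "fst h \<in> F" for h
  proof -
    obtain x where x: "x \<in> R" "fst x = fst h" using hF unfolding F_def by auto
    then have x0: "fst x \<in> F0" "fst h \<in> F0" unfolding R_def by auto
    have "h = x \<or> h = flip x" using same_edge[of x h] x by simp
    then have "(x, h) \<in> lnk ?S" using lnk_base[OF trail_stepI(1)[OF x0]] by auto
    then show ?thesis using closed x x0 by blast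
  qed
  have FF0: "F \<subseteq> F0" unfolding F_def R_def by auto
  have S: "(x, y) \<in> trail_step F \<gamma> T m" if "(x, y) \<in> ?S" "x \<in> R \<or> y \<in> R" for x y
  proof -
    have f: "fst x \<in> F0" "fst y \<in> F0" using that(1) unfolding trail_step_def by auto
    have l: "(x, y) \<in> lnk ?S" using that(1) by (rule lnk_base)
    have "x \<in> R" "y \<in> R" using that(2) closed[OF _ f(2) l] closed[OF _ f(1) lnk_sym[OF l]] by blast+
    then have "fst x \<in> F" "fst y \<in> F" unfolding F_def by auto
    then show ?thesis using that(1) unfolding trail_step_def by simp
  qed
  have path: "y \<in> R \<and> (x, y) \<in> lnk (trail_step F \<gamma> T m)" if xy: "(x, y) \<in> lnk ?S" and x: "x \<in> R" for x y
    using xy unfolding lnk_def[of ?S]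
  proof (induction rule: rtrancl_induct)
    case base
    then show ?case using x by simp
  next
    case (step y z)
    then have yR: "y \<in> R" and xy: "(x, y) \<in> lnk (trail_step F \<gamma> T m)" by auto
    have z0: "fst z \<in> F0" using step.hyps(2) unfolding trail_step_def by auto
    have yz: "(y, z) \<in> lnk ?S" using step.hyps(2) unfolding lnk_def by blast
    have "z \<in> R" by (rule closed[OF yR z0 yz])
    moreover have "(y, z) \<in> trail_step F \<gamma> T m \<or> (z, y) \<in> trail_step F \<gamma> T m"
      using step.hyps(2) S[of y z] S[of z y] yR by blast
    then have "(y, z) \<in> lnk (trail_step F \<gamma> T m)" using lnk_base[of _ _ "trail_step F \<gamma> T m"] lnk_sym[of z y] by metis
    ultimately show ?case using xy lnk_trans by metis
  qed
  have TR: "h \<in> R" if "fst h \<in> F0" "\<gamma> h \<in> T" for h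
    using that lnk_refl[of h ?S] unfolding R_def by blast
  have finE: "finite (edges G)" using G unfolding finite_multigraph_def by simp
  let ?H = "\<lparr>vertices = vertices G, edges = F, ends = ends G\<rparr>"
  have "\<exists>H'. split_step\<^sup>*\<^sup>* ?H H' \<and> vertices (discard_isolated T H') = T \<and> connected_graph (discard_isolated T H')"
  proof (rule split_off[where F = F and \<gamma> = \<gamma> and m = m])
    show "finite F" using finE F0 FF0 by (meson finite_subset)
    show "edges ?H = F" by simp
    show "T \<subseteq> vertices ?H" using TV by simp
    show "ends ?H (fst h) = {\<gamma> h, \<gamma> (flip h)}" if "fst h \<in> F" for h using en[of h] that F0 FF0 by auto
    show "mated F \<gamma> T m" unfolding mated_def
    proof (intro allI impI)
      fix h assume h: "fst h \<in> F \<and> \<gamma> h \<notin> T"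
      then have h0: "fst h \<in> F0" "\<gamma> h \<notin> T" using FF0 by auto
      note d = matedD[OF mate h0]
      have "(h, m h) \<in> lnk ?S" by (rule lnk_base, rule trail_stepI(2)) (use h0 d in simp_all)
      then have "m h \<in> R" using closed[OF _ d(1)] FR h by blast
      then show "fst (m h) \<in> F \<and> m h \<noteq> h \<and> m (m h) = h \<and> \<gamma> (m h) = \<gamma> h" using d unfolding F_def by blast
    qed
    show "\<exists>h h'. fst h \<in> F \<and> fst h' \<in> F \<and> \<gamma> h = s \<and> \<gamma> h' = t \<and> (h, h') \<in> lnk (trail_step F \<gamma> T m)"
      if st: "s \<in> T" "t \<in> T" "s \<noteq> t" for s t
    proof -
      obtain h h' where h: "fst h \<in> F0" "fst h' \<in> F0" "\<gamma> h = s" "\<gamma> h' = t" "(h, h') \<in> lnk ?S" using conn[OF st] by blast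
      have "h \<in> R" using TR h st by simp
      then show ?thesis using path[OF h(5)] h unfolding F_def by blast
    qed
    show "\<exists>h'. fst h' \<in> F \<and> \<gamma> h' \<in> T \<and> (h', h) \<in> lnk (trail_step F \<gamma> T m)" if hF: "fst h \<in> F" for h
    proof -
      obtain h' where h': "fst h' \<in> F0" "\<gamma> h' \<in> T" "(h', h) \<in> lnk ?S" using FR[OF hF] unfolding R_def by blast
      have "h' \<in> R" using TR h' by simp
      then show ?thesis using path[OF h'(3)] h' unfolding F_def by blast
    qed
  qed
  moreover have "subgraph ?H G"
    using G F0 FF0 unfolding subgraph_def finite_multigraph_def wf_multigraph_def by auto
  ultimately show ?thesis using FF0 unfolding T_connector_def by blast
qed

section \<open>Attaching a root to the given graph\<close>

lemma boundary_separates: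
  assumes s: "s \<in> T" "s \<in> X" and t: "t \<in> T" "t \<notin> X" and TV: "T \<subseteq> vertices G" and XV: "X \<subseteq> vertices G"
  shows "edge_cut G (boundary G X)" "separates G (boundary G X) T"
proof -
  show "edge_cut G (boundary G X)" unfolding edge_cut_def
  proof (intro exI conjI)
    show "X \<noteq> {}" "X \<subset> vertices G" using s t TV XV by auto
  qed simp
  let ?D = "delete_edges G (boundary G X)"
  have V: "vertices ?D = vertices G" unfolding delete_edges_def by simp
  have step: "y \<in> X" if "adjacent ?D x y" "x \<in> X" for x y
    using that unfolding adjacent_def delete_edges_def boundary_def by auto
  have inX: "y \<in> X" if "(adjacent ?D)\<^sup>*\<^sup>* s y" for y
    using that
  proof (induction rule: rtranclp_induct)
    case base
    then show ?case using s by simp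
  next
    case (step y z)
    then show ?case using \<open>\<And>x y. adjacent ?D x y \<Longrightarrow> x \<in> X \<Longrightarrow> y \<in> X\<close> by blast
  qed
  define C where "C u = {x \<in> vertices ?D. (adjacent ?D)\<^sup>*\<^sup>* u x}" for u
  have mem: "C u \<in> components ?D" "u \<in> C u" if u: "u \<in> T" for u
  proof -
    have uV: "u \<in> vertices ?D" using u TV V by auto
    then show "C u \<in> components ?D" unfolding components_def C_def by blast
    show "u \<in> C u" using uV unfolding C_def by simp
  qed
  have "t \<notin> C s" using inX t unfolding C_def by blast
  then have "C s \<noteq> C t" using mem(2)[OF t(1)] by auto
  then show "separates G (boundary G X) T"
    unfolding separates_def using mem[OF s(1)] mem[OF t(1)] s t by blast
qed

text \<open>The root is an additional vertex joined to some terminal by \<open>6k + 6\<close> unused edges.\<close>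

lemma colouring_exists:
  fixes G :: "('v, 'e) multigraph"
  assumes G: "finite_multigraph G" and TV: "T \<subseteq> vertices G"
    and hyp: "\<And>C. edge_cut G C \<Longrightarrow> separates G C T \<Longrightarrow> 6 * k + 6 \<le> card C"
    and t0: "t0 \<in> T" and \<gamma>V: "\<And>h. fst h \<in> edges G \<Longrightarrow> \<gamma> h \<in> vertices G"
    and en: "\<And>h. fst h \<in> edges G \<Longrightarrow> ends G (fst h) = {\<gamma> h, \<gamma> (flip h)}"
  shows "\<exists>c m. \<forall>i\<in>{1..k}. mated {e \<in> edges G. c e = i} \<gamma> T m \<and>
    (\<forall>s\<in>T. \<forall>t\<in>T. s \<noteq> t \<longrightarrow> (\<exists>h h'. fst h \<in> {e \<in> edges G. c e = i} \<and> fst h' \<in> {e \<in> edges G. c e = i} \<and>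
       \<gamma> h = s \<and> \<gamma> h' = t \<and> (h, h') \<in> lnk (trail_step {e \<in> edges G. c e = i} \<gamma> T m)))"
proof -
  let ?V = "vertices G"
  have fin: "finite ?V" "finite (edges G)" using G unfolding finite_multigraph_def by auto
  obtain \<iota> :: "'v \<Rightarrow> nat" where \<iota>: "inj_on \<iota> ?V" using finite_imp_inj_to_nat_seg[OF fin(1)] by blast
  \<comment> \<open>Vertices are numbered from 1, which leaves 0 for the root.\<close>
  define \<kappa> where "\<kappa> u = Suc (\<iota> u)" for u
  have \<kappa>: "\<kappa> u = \<kappa> u' \<longleftrightarrow> u = u'" if "u \<in> ?V" "u' \<in> ?V" for u u'
    using inj_on_eq_iff[OF \<iota> that] unfolding \<kappa>_def by simp
  define E :: "('e + nat) set" where "E = edges G <+> {..<6 * k + 6}"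
  define g where "g x = (case fst x of Inl e \<Rightarrow> \<kappa> (\<gamma> (e, snd x)) | Inr j \<Rightarrow> if snd x then \<kappa> t0 else 0)" for x :: "('e + nat) \<times> bool"
  define T1 where "T1 = insert 0 (\<kappa> ` T)"
  have gl: "g (Inl e, b) = \<kappa> (\<gamma> (e, b))" for e b unfolding g_def by simp
  have gr: "g (Inr j, True) = \<kappa> t0" "g (Inr j, False) = 0" for j unfolding g_def by simp_all
  have \<kappa>0: "\<kappa> u \<noteq> 0" for u unfolding \<kappa>_def by simp
  have \<kappa>T: "\<kappa> u \<in> T1 \<longleftrightarrow> u \<in> T" if "u \<in> ?V" for u
  proof
    assume "\<kappa> u \<in> T1"
    then obtain u' where "u' \<in> T" "\<kappa> u = \<kappa> u'" using \<kappa>0[of u] unfolding T1_def by auto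
    then show "u \<in> T" using \<kappa>[OF that, of u'] TV by auto
  qed (simp add: T1_def)
  have EI: "Inl e \<in> E \<longleftrightarrow> e \<in> edges G" "Inr j \<in> E \<longleftrightarrow> j < 6 * k + 6" for e j unfolding E_def by auto
  have dlv: "dl E g {0} = Inr ` {..<6 * k + 6}"
  proof (intro set_eqI iffI)
    fix x assume x: "x \<in> dl E g {0}"
    then show "x \<in> Inr ` {..<6 * k + 6}"
      using gl \<kappa>0 EI unfolding dl_def by (cases x) auto
  next
    fix x :: "'e + nat" assume "x \<in> Inr ` {..<6 * k + 6}"
    then show "x \<in> dl E g {0}" using gr \<kappa>0 EI unfolding dl_def by auto
  qed
  have tv: "card (dl E g {0}) = 6 * k + 6" unfolding dlv by (simp add: card_image)
  have finE: "finite E" unfolding E_def using fin by simp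
  have finT: "finite T1" unfolding T1_def using TV fin finite_subset by blast
  \<comment> \<open>A set that separates the root from \<open>t0\<close> has all added edges in its
    cut. Any other one separates two original terminals, and the hypothesis applies to its trace on
    \<open>G\<close>.\<close>
  have cuts: "6 * k + 6 \<le> card (dl E g X)" if X: "X \<inter> T1 \<noteq> {}" "T1 - X \<noteq> {}" for X
  proof (cases "(0 \<in> X) \<noteq> (\<kappa> t0 \<in> X)")
    case True
    then have "Inr ` {..<6 * k + 6} \<subseteq> dl E g X" using gr EI unfolding dl_def by auto
    then have "card (Inr ` {..<6 * k + 6} :: ('e + nat) set) \<le> card (dl E g X)" using finE by (intro card_mono) auto
    then show ?thesis by (simp add: card_image)
  next
    case False
    have "\<exists>s\<in>T. \<kappa> s \<in> X" "\<exists>t\<in>T. \<kappa> t \<notin> X" using X False t0 unfolding T1_def by blast+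
    then obtain s t where st: "s \<in> T" "\<kappa> s \<in> X" "t \<in> T" "\<kappa> t \<notin> X" by blast
    define Y where "Y = {u \<in> ?V. \<kappa> u \<in> X}"
    have "s \<in> Y" "t \<notin> Y" "Y \<subseteq> ?V" using st TV unfolding Y_def by auto
    note bs = boundary_separates[OF st(1) this(1) st(3) this(2) TV this(3)]
    have "Inl ` boundary G Y \<subseteq> dl E g X"
    proof
      fix x :: "'e + nat" assume "x \<in> Inl ` boundary G Y"
      then obtain e a b where e: "x = Inl e" "e \<in> edges G" "ends G e = {a, b}" "a \<in> Y" "b \<notin> Y" unfolding boundary_def by blast
      have "{\<gamma> (e, True), \<gamma> (e, False)} = {a, b}" using en[of "(e, True)"] e unfolding flip_def by simp
      then have "\<gamma> (e, True) = a \<and> \<gamma> (e, False) = b \<or> \<gamma> (e, True) = b \<and> \<gamma> (e, False) = a" by (simp add: doubleton_eq_iff)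
      moreover have "\<gamma> (e, True) \<in> ?V" "\<gamma> (e, False) \<in> ?V" using \<gamma>V[of "(e, True)"] \<gamma>V[of "(e, False)"] e by auto
      ultimately show "x \<in> dl E g X" using e gl EI unfolding dl_def Y_def by auto
    qed
    then have "card (Inl ` boundary G Y :: ('e + nat) set) \<le> card (dl E g X)" using finE by (intro card_mono) auto
    then show ?thesis using hyp[OF bs] by (simp add: card_image)
  qed
  have "rooted E g T1 0 k" unfolding rooted_def
  proof (intro conjI allI impI finE finT tv cuts)
    show "0 \<in> T1" unfolding T1_def by simp
    have "\<kappa> t0 \<in> T1 - {0}" using t0 \<kappa>0[of t0] unfolding T1_def by simp
    then show "T1 - {0} \<noteq> {}" by blast
  qed
  then have "solvable E g T1 0 k" by (rule rooted_solvable)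
  moreover have "demand E g T1 0 k (\<lambda>_. {}) (\<lambda>_. 0)" unfolding demand_def by simp
  ultimately obtain gv rv where gv: "2 * rv + card (dl E g {0} - gv) \<le> 2 * k"
    and ext: "\<And>\<phi>. (\<forall>e. \<phi> e \<le> k) \<and> rv \<le> card {e \<in> dl E g {0} \<inter> gv. \<phi> e = 0} \<Longrightarrow>
      \<exists>c \<mu>. routing E g T1 0 k c \<mu> \<and> served E g T1 0 (\<lambda>_. {}) (\<lambda>_. 0) c \<and> (\<forall>e\<in>dl E g {0}. c e = \<phi> e)"
    unfolding solvable_def by blast
  \<comment> \<open>The all-zero root colouring is admissible for whatever pair is returned: at
    least \<open>4 * k + 6 + 2 * rv\<close> of the \<open>6 * k + 6\<close> root edges lie in
    \<open>gv\<close>.\<close>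
  have "card (dl E g {0}) = card (dl E g {0} \<inter> gv) + card (dl E g {0} - gv)"
    using finE by (intro card_Int_Diff) simp
  then have "rv \<le> card (dl E g {0} \<inter> gv)" using gv tv by linarith
  moreover have "{e \<in> dl E g {0} \<inter> gv. (\<lambda>_. 0) e = (0::nat)} = dl E g {0} \<inter> gv" by blast
  ultimately obtain c \<mu> where R: "routing E g T1 0 k c \<mu>" and c0: "\<forall>e\<in>dl E g {0}. c e = 0"
    using ext[of "\<lambda>_. 0"] by auto
  have P: "paired E g T1 c \<mu>"
    and C: "\<And>i s t. i \<in> {1..k} \<Longrightarrow> s \<in> T1 - {0} \<Longrightarrow> t \<in> T1 - {0} \<Longrightarrow> s \<noteq> t \<Longrightarrow> reach E g T1 0 c \<mu> i s t"
    using R unfolding routing_def by blast+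
  define low :: "('e + nat) \<times> bool \<Rightarrow> 'e \<times> bool" where "low x = (projl (fst x), snd x)" for x
  define up :: "'e \<times> bool \<Rightarrow> ('e + nat) \<times> bool" where "up h = (Inl (fst h), snd h)" for h
  define m where "m h = low (\<mu> (up h))" for h
  have lu: "low (up h) = h" for h unfolding low_def up_def by simp
  \<comment> \<open>The added edges have colour 0, so a half-edge with a positive colour comes from
    \<open>G\<close>.\<close>
  have ul: "up (low x) = x" "fst (low x) \<in> edges G" "c (Inl (fst (low x))) = c (fst x)" "g x = \<kappa> (\<gamma> (low x))"
    if x: "fst x \<in> E" "c (fst x) \<noteq> 0" for x
  proof -
    have "fst x \<notin> Inr ` {..<6 * k + 6}" using c0 x(2) unfolding dlv by auto
    then obtain e where e: "fst x = Inl e" "e \<in> edges G" using x(1) unfolding E_def by auto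
    then have xe: "x = (Inl e, snd x)" by (simp add: prod_eq_iff)
    show "up (low x) = x" "fst (low x) \<in> edges G" "c (Inl (fst (low x))) = c (fst x)"
      using e xe unfolding up_def low_def by auto
    show "g x = \<kappa> (\<gamma> (low x))" using gl[of e "snd x"] e xe unfolding low_def by simp
  qed
  have gu: "g (up h) = \<kappa> (\<gamma> h)" for h using gl[of "fst h" "snd h"] unfolding up_def by simp
  have uE: "fst (up h) \<in> E \<longleftrightarrow> fst h \<in> edges G" "c (fst (up h)) = c (Inl (fst h))" for h unfolding up_def using EI by auto
  show ?thesis
  proof (intro exI[of _ "\<lambda>e. c (Inl e)"] exI[of _ m] ballI conjI)
    fix i assume i: "i \<in> {1..k}"
    let ?F = "{e \<in> edges G. c (Inl e) = i}"
    have i0: "i \<noteq> 0" using i by simp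
    show "mated ?F \<gamma> T m" unfolding mated_def
    proof (intro allI impI)
      fix h assume h: "fst h \<in> ?F \<and> \<gamma> h \<notin> T"
      have u: "fst (up h) \<in> E" "c (fst (up h)) = i" using h uE by auto
      have "g (up h) \<notin> T1" using gu \<kappa>T[of "\<gamma> h"] \<gamma>V[of h] h by auto
      then have d: "fst (\<mu> (up h)) \<in> E" "\<mu> (up h) \<noteq> up h" "\<mu> (\<mu> (up h)) = up h" "g (\<mu> (up h)) = g (up h)" "c (fst (\<mu> (up h))) = i"
        using pairedD[OF P u(1)] u(2) i0 by simp_all
      have n0: "c (fst (\<mu> (up h))) \<noteq> 0" using d(5) i0 by simp
      note l = ul[OF d(1) n0]
      have um: "up (m h) = \<mu> (up h)" unfolding m_def by (rule l(1))
      have "m (m h) = h" using d(3) lu unfolding m_def[of "m h"] um by simp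
      moreover have "m h \<noteq> h" using d(2) um by auto
      moreover have mF: "fst (m h) \<in> ?F" using l(2,3) d(5) unfolding m_def by simp
      moreover have "\<gamma> (m h) = \<gamma> h"
      proof -
        have "\<kappa> (\<gamma> (m h)) = \<kappa> (\<gamma> h)" using l(4) d(4) gu unfolding m_def by simp
        then show ?thesis using \<kappa>[of "\<gamma> (m h)" "\<gamma> h"] \<gamma>V[of "m h"] \<gamma>V[of h] mF h by simp
      qed
      ultimately show "fst (m h) \<in> ?F \<and> m h \<noteq> h \<and> m (m h) = h \<and> \<gamma> (m h) = \<gamma> h" by blast
    qed
    have step: "(low x, low y) \<in> lnk (trail_step ?F \<gamma> T m)" if "(x, y) \<in> hop E g T1 0 c \<mu> i" for x y
    proof -
      have xy: "fst x \<in> E" "fst y \<in> E" "c (fst x) = i" "c (fst y) = i"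
        and or: "y = flip x \<or> (g x \<notin> T1 \<and> y = \<mu> x) \<or> (g x \<in> T1 - {0} \<and> g y = g x)" using that unfolding hop_def by blast+
      have lx: "up (low x) = x" "fst (low x) \<in> ?F" "g x = \<kappa> (\<gamma> (low x))" using ul[OF xy(1)] xy(3) i0 by simp_all
      have ly: "up (low y) = y" "fst (low y) \<in> ?F" "g y = \<kappa> (\<gamma> (low y))" using ul[OF xy(2)] xy(4) i0 by simp_all
      have V: "\<gamma> (low x) \<in> ?V" "\<gamma> (low y) \<in> ?V" using \<gamma>V lx(2) ly(2) by auto
      from or show ?thesis
      proof (elim disjE conjE)
        assume "y = flip x"
        then have "low y = flip (low x)" unfolding low_def flip_def by simp
        then show ?thesis by (intro lnk_base trail_stepI(1) lx(2) ly(2))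
      next
        assume a: "g x \<notin> T1" "y = \<mu> x"
        then have "\<gamma> (low x) \<notin> T" "low y = m (low x)" using \<kappa>T[OF V(1)] lx unfolding m_def by auto
        then show ?thesis by (intro lnk_base trail_stepI(2) lx(2) ly(2))
      next
        assume a: "g x \<in> T1 - {0}" "g y = g x"
        have "\<gamma> (low x) \<in> T" using a(1) \<kappa>T[OF V(1)] unfolding lx(3) by blast
        moreover have "\<gamma> (low y) = \<gamma> (low x)" using a(2) \<kappa>[OF V(2,1)] unfolding lx(3) ly(3) by blast
        ultimately show ?thesis by (intro lnk_base trail_stepI(3) lx(2) ly(2))
      qed
    qed
    fix s t assume s: "s \<in> T" and t: "t \<in> T"
    show "s \<noteq> t \<longrightarrow> (\<exists>h h'. fst h \<in> ?F \<and> fst h' \<in> ?F \<and> \<gamma> h = s \<and> \<gamma> h' = t \<and> (h, h') \<in> lnk (trail_step ?F \<gamma> T m))"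
    proof
      assume "s \<noteq> t"
      have V: "s \<in> ?V" "t \<in> ?V" using s t TV by auto
      have "reach E g T1 0 c \<mu> i (\<kappa> s) (\<kappa> t)"
        by (rule C[OF i]) (use \<kappa>T[OF V(1)] \<kappa>T[OF V(2)] \<kappa>0 \<kappa>[OF V] \<open>s \<noteq> t\<close> s t in auto)
      then obtain x y where xy: "fst x \<in> E" "fst y \<in> E" "c (fst x) = i" "c (fst y) = i" "g x = \<kappa> s" "g y = \<kappa> t"
        "(x, y) \<in> lnk (hop E g T1 0 c \<mu> i)" unfolding reach_def by blast
      have lx: "fst (low x) \<in> ?F" "g x = \<kappa> (\<gamma> (low x))" using ul[OF xy(1)] xy(3) i0 by simp_all
      have ly: "fst (low y) \<in> ?F" "g y = \<kappa> (\<gamma> (low y))" using ul[OF xy(2)] xy(4) i0 by simp_all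
      have "\<gamma> (low x) \<in> ?V" "\<gamma> (low y) \<in> ?V" using \<gamma>V lx(1) ly(1) by auto
      then have "\<gamma> (low x) = s" "\<gamma> (low y) = t" using \<kappa>[OF _ V(1)] \<kappa>[OF _ V(2)] lx(2) ly(2) xy(5,6) by auto
      moreover have "(low x, low y) \<in> lnk (trail_step ?F \<gamma> T m)" by (rule lnk_image[OF step xy(7)])
      ultimately show "\<exists>h h'. fst h \<in> ?F \<and> fst h' \<in> ?F \<and> \<gamma> h = s \<and> \<gamma> h' = t \<and> (h, h') \<in> lnk (trail_step ?F \<gamma> T m)"
        using lx(1) ly(1) by blast
    qed
  qed
qed

theorem theorem1p6:
  fixes G :: "('v, 'e) multigraph" and T :: "'v set" and k :: nat
  assumes "k > 0"
    and "finite_multigraph G"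
    and "T \<subseteq> vertices G"
    and "\<And>C. edge_cut G C \<Longrightarrow> separates G C T \<Longrightarrow> card C \<ge> 6 * k + 6"
  shows "\<exists>H :: nat \<Rightarrow> ('v, 'e) multigraph.
           (\<forall>i < k. T_connector G T (H i)) \<and>
           (\<forall>i < k. \<forall>j < k. i \<noteq> j \<longrightarrow> edges (H i) \<inter> edges (H j) = {})"
proof (cases "\<forall>s\<in>T. \<forall>t\<in>T. s = t")
  case True
  \<comment> \<open>With at most one terminal the edgeless graph on \<open>T\<close> is a connector,
    and copies of it are edge-disjoint.\<close>
  let ?H = "\<lparr>vertices = T, edges = {}, ends = ends G\<rparr> :: ('v, 'e) multigraph"
  have "subgraph ?H G" using assms(3) unfolding subgraph_def wf_multigraph_def by simp
  moreover have "vertices (discard_isolated T ?H) = T" unfolding discard_isolated_def by auto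
  moreover have "connected_graph (discard_isolated T ?H)"
    using True unfolding connected_graph_def discard_isolated_def by auto
  ultimately have "T_connector G T ?H" unfolding T_connector_def by blast
  then show ?thesis by (intro exI[of _ "\<lambda>_. ?H"]) simp
next
  case False
  then obtain t0 where t0: "t0 \<in> T" by blast
  have "\<forall>e\<in>edges G. \<exists>p. fst p \<in> vertices G \<and> snd p \<in> vertices G \<and> ends G e = {fst p, snd p}"
    using assms(2) unfolding finite_multigraph_def wf_multigraph_def by fastforce
  then obtain P where P: "\<And>e. e \<in> edges G \<Longrightarrow> fst (P e) \<in> vertices G \<and> snd (P e) \<in> vertices G \<and> ends G e = {fst (P e), snd (P e)}"
    using bchoice by metis
  define \<gamma> where "\<gamma> h = (if snd h then snd (P (fst h)) else fst (P (fst h)))" for h :: "'e \<times> bool"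
  have \<gamma>V: "\<gamma> h \<in> vertices G" if "fst h \<in> edges G" for h using P[OF that] unfolding \<gamma>_def by simp
  have en: "ends G (fst h) = {\<gamma> h, \<gamma> (flip h)}" if "fst h \<in> edges G" for h
    using P[OF that] unfolding \<gamma>_def flip_def by (cases "snd h") auto
  have "\<exists>c m. \<forall>i\<in>{1..k}. mated {e \<in> edges G. c e = i} \<gamma> T m \<and>
    (\<forall>s\<in>T. \<forall>t\<in>T. s \<noteq> t \<longrightarrow> (\<exists>h h'. fst h \<in> {e \<in> edges G. c e = i} \<and> fst h' \<in> {e \<in> edges G. c e = i} \<and>
       \<gamma> h = s \<and> \<gamma> h' = t \<and> (h, h') \<in> lnk (trail_step {e \<in> edges G. c e = i} \<gamma> T m)))"
    by (rule colouring_exists[OF assms(2,3)]) (erule (1) assms(4) | rule t0 | erule \<gamma>V | erule en)+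
  then obtain c m where cm: "\<forall>i\<in>{1..k}. mated {e \<in> edges G. c e = i} \<gamma> T m \<and>
    (\<forall>s\<in>T. \<forall>t\<in>T. s \<noteq> t \<longrightarrow> (\<exists>h h'. fst h \<in> {e \<in> edges G. c e = i} \<and> fst h' \<in> {e \<in> edges G. c e = i} \<and>
       \<gamma> h = s \<and> \<gamma> h' = t \<and> (h, h') \<in> lnk (trail_step {e \<in> edges G. c e = i} \<gamma> T m)))"
    by (elim exE)
  have "\<exists>F\<subseteq>{e \<in> edges G. c e = Suc i}. T_connector G T \<lparr>vertices = vertices G, edges = F, ends = ends G\<rparr>" if i: "i < k" for i
  proof (rule connector_of_colour[OF assms(2,3) en])
    have "Suc i \<in> {1..k}" using i by simp
    note c = bspec[OF cm this]
    show "mated {e \<in> edges G. c e = Suc i} \<gamma> T m" using c by (rule conjunct1)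
    show "\<exists>h h'. fst h \<in> {e \<in> edges G. c e = Suc i} \<and> fst h' \<in> {e \<in> edges G. c e = Suc i} \<and> \<gamma> h = s \<and> \<gamma> h' = t \<and>
       (h, h') \<in> lnk (trail_step {e \<in> edges G. c e = Suc i} \<gamma> T m)" if "s \<in> T" "t \<in> T" "s \<noteq> t" for s t
      using c[THEN conjunct2, rule_format, OF that] .
  qed auto
  then obtain F where F: "\<And>i. i < k \<Longrightarrow> F i \<subseteq> {e \<in> edges G. c e = Suc i} \<and>
      T_connector G T \<lparr>vertices = vertices G, edges = F i, ends = ends G\<rparr>"
    by metis
  show ?thesis
  proof (intro exI[of _ "\<lambda>i. \<lparr>vertices = vertices G, edges = F i, ends = ends G\<rparr>"] conjI allI impI)
    fix i assume "i < k"
    then show "T_connector G T \<lparr>vertices = vertices G, edges = F i, ends = ends G\<rparr>" using F by blast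
  next
    fix i j assume ij: "i < k" "j < k" "i \<noteq> j"
    have "x \<notin> F j" if "x \<in> F i" for x
    proof
      assume "x \<in> F j"
      then have "c x = Suc i" "c x = Suc j" using F[OF ij(1)] F[OF ij(2)] \<open>x \<in> F i\<close> by blast+
      then show False using ij(3) by simp
    qed
    then have "F i \<inter> F j = {}" by blast
    then show "edges \<lparr>vertices = vertices G, edges = F i, ends = ends G\<rparr> \<inter>
        edges \<lparr>vertices = vertices G, edges = F j, ends = ends G\<rparr> = {}" by simp
  qed
qed

end
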